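(* Suppose that $\sup_{z_1,z_2\in Z}V(z_1,z_2)\le\Omega_Z^2$ with $\Omega_Z>0$. Let $\sigma:=\sqrt{\sigma_H^2+\sigma_G^2}$, and let the stepsizes $\{\alpha_t\}$ and $\{\gamma_t\}$ in the stochastic AMP method be set to $$\alpha_t=\frac2{t+1}\quad\text{and}\quad\gamma_t=\frac{\mu t}{4L_G+3L_Ht+\sigma(t+1)\sqrt{\mu t}/(\sqrt2\,\Omega_Z)}$$ (where the denominator is positive). Then under the bounded variance assumption A1, for all $t\ge2$, $$\mathbb E[g(w^{ag}_{t+1})]\le\frac{16L_G\Omega_Z^2}{\mu t(t+1)}+\frac{12L_H\Omega_Z^2}{\mu(t+1)}+\frac{7(\sigma_G+\sigma_H)\Omega_Z}{\sqrt{\mu(t-1)}}=:\mathcal C_0(t).$$ Furthermore, under the light-tail assumption A2, for all $t\ge2$ and all $\lambda>0$, $$\mathrm{Prob}\{g(w^{ag}_{t+1})>\mathcal C_0(t)+\lambda\mathcal C_1(t)\}\le2\exp\{-\lambda^2/3\}+3\exp\{-\lambda\},\qquad\text{where}\quad\mathcal C_1(t):=\frac{6(\sigma_G+\sigma_H)\Omega_Z}{\sqrt{\mu(t-1)}}.$$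
   Context: Setting. $\mathcal E$ is a finite-dimensional real vector space with inner product $\langle\cdot,\cdot\rangle$ and a norm $\|\cdot\|$, with dual norm $\|\eta\|_*=\sup_{\|x\|\le1}\langle\eta,x\rangle$; $Z\subset\mathcal E$ is a nonempty closed convex set. $G$ is continuously differentiable with $0\le G(w)-G(v)-\langle\nabla G(v),w-v\rangle\le\frac{L_G}{2}\|w-v\|^2$ for all $w,v\in Z$. $H:Z\to\mathcal E$ satisfies $\langle H(w)-H(v),w-v\rangle\ge0$ and $\|H(w)-H(v)\|_*\le L_H\|w-v\|$ for all $w,v\in Z$. $J$ is a real-valued convex function on $Z$ having a subgradient $J'(u)\in\partial J(u)$ at each $u\in Z$. Prox-mapping. $\omega$ is a differentiable strongly convex function on $Z$ with convexity parameter $\mu>0$ with respect to $\|\cdot\|$; $V(z,u)=\omega(u)-\omega(z)-\langle\nabla\omega(z),u-z\rangle$ for $u,z\in Z$. For $z\in Z$, $\eta\in\mathcal E$, $\gamma>0$, $P_z^{\gamma J}(\eta)=\operatorname{argmin}_{u\in Z}\{\langle\eta,u-z\rangle+V(z,u)+\gamma J(u)\}$, assumed to be well defined. Stochastic oracles. At the $i$-th call with input $x\in Z$, oracles $\mathcal{SO}_G$ and $\mathcal{SO}_H$ return $\mathcal G(x,\xi_i)$ and $\mathcal H(x,\zeta_i)$, where all $\xi_i,\zeta_i$ are independent random variables and $\mathbb E[\mathcal G(x,\xi_i)]=\nabla G(x)$, $\mathbb E[\mathcal H(x,\zeta_i)]=H(x)$. Assumption A1: $\mathbb E[\|\mathcal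 G(x,\xi_i)-\nabla G(x)\|_*^2]\le\sigma_G^2$ and $\mathbb E[\|\mathcal H(x,\zeta_i)-H(x)\|_*^2]\le\sigma_H^2$ for all $x\in Z$ and all $i$. Assumption A2: $\mathbb E[\exp\{\|\nabla G(x)-\mathcal G(x,\xi_i)\|_*^2/\sigma_G^2\}]\le\exp\{1\}$ and $\mathbb E[\exp\{\|H(x)-\mathcal H(x,\zeta_i)\|_*^2/\sigma_H^2\}]\le\exp\{1\}$ for all $x\in Z$ and all $i$. Stochastic AMP method. Choose $r_1\in Z$ and set $w_1=w_1^{ag}=r_1$. For $t=1,2,\ldots$: $w_t^{md}=(1-\alpha_t)w_t^{ag}+\alpha_tr_t$; $w_{t+1}=P_{r_t}^{\gamma_tJ}(\gamma_t\mathcal H(r_t,\zeta_{2t-1})+\gamma_t\mathcal G(w_t^{md},\xi_t))$; $r_{t+1}=P_{r_t}^{\gamma_tJ}(\gamma_t\mathcal H(w_{t+1},\zeta_{2t})+\gamma_t\mathcal G(w_t^{md},\xi_t))$ (same sample $\mathcal G(w_t^{md},\xi_t)$); $w_{t+1}^{ag}=(1-\alpha_t)w_t^{ag}+\alpha_tw_{t+1}$. Gap function. $Q(\tilde u,u)=G(\tilde u)-G(u)+\langle H(u),\tilde u-u\rangle+J(\tilde u)-J(u)$ for $\tilde u,u\in Z$, and $g(\tilde u)=\sup_{u\in Z}Q(\tilde u,u)$. *)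

theory Defs
  imports "HOL-Probability.Probability"
begin

text \<open>
  The ambient space is a type of class \<open>euclidean_space\<close>; its \<open>inner\<close> is the given inner product.
  The norm \<open>N\<close> of the paper is arbitrary and unrelated to the class operation \<open>norm\<close>.
\<close>

definition is_norm :: "('a::real_vector \<Rightarrow> real) \<Rightarrow> bool" where
  "is_norm N \<longleftrightarrow>
     (\<forall>x. 0 \<le> N x) \<and> (\<forall>x. N x = 0 \<longleftrightarrow> x = 0) \<and>
     (\<forall>c x. N (c *\<^sub>R x) = \<bar>c\<bar> * N x) \<and> (\<forall>x y. N (x + y) \<le> N x + N y)"

definition dual_norm :: "('a::real_inner \<Rightarrow> real) \<Rightarrow> 'a \<Rightarrow> real" where
  "dual_norm N \<eta> = (SUP x\<in>{x. N x \<le> 1}. inner \<eta> x)"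

text \<open>
  Gradients of functions given only on \<open>Z\<close> are taken relative to \<open>Z\<close>. If \<open>Z\<close> has empty interior such
  a gradient need not be unique, so it is passed around as a separate function.
\<close>

definition has_gradient_on ::
    "('a::real_inner \<Rightarrow> real) \<Rightarrow> ('a \<Rightarrow> 'a) \<Rightarrow> 'a set \<Rightarrow> bool" where
  "has_gradient_on f grad Z \<longleftrightarrow> (\<forall>z\<in>Z. (f has_derivative (\<lambda>h. inner (grad z) h)) (at z within Z))"

definition strongly_convex_on ::
    "'a::real_vector set \<Rightarrow> ('a \<Rightarrow> real) \<Rightarrow> real \<Rightarrow> ('a \<Rightarrow> real) \<Rightarrow> bool" where
  "strongly_convex_on Z N \<mu> f \<longleftrightarrow> convex Z \<and>
     (\<forall>x\<in>Z. \<forall>y\<in>Z. \<forall>a\<in>{0..1}.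
        f ((1 - a) *\<^sub>R x + a *\<^sub>R y) \<le> (1 - a) * f x + a * f y - \<mu> / 2 * a * (1 - a) * (N (x - y))\<^sup>2)"

definition subdifferential :: "'a::real_inner set \<Rightarrow> ('a \<Rightarrow> real) \<Rightarrow> 'a \<Rightarrow> 'a set" where
  "subdifferential Z J u = {s. \<forall>v\<in>Z. J u + inner s (v - u) \<le> J v}"

definition bregman :: "('a::real_inner \<Rightarrow> real) \<Rightarrow> ('a \<Rightarrow> 'a) \<Rightarrow> 'a \<Rightarrow> 'a \<Rightarrow> real" where
  "bregman \<omega> grad\<omega> z u = \<omega> u - \<omega> z - inner (grad\<omega> z) (u - z)"

definition prox_objective ::
    "('a::real_inner \<Rightarrow> real) \<Rightarrow> ('a \<Rightarrow> 'a) \<Rightarrow> ('a \<Rightarrow> real) \<Rightarrow> 'a \<Rightarrow> real \<Rightarrow> 'a \<Rightarrow> 'a \<Rightarrow> real" where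
  "prox_objective \<omega> grad\<omega> J z c \<eta> u = inner \<eta> (u - z) + bregman \<omega> grad\<omega> z u + c * J u"

text \<open>
  \<open>prox Z \<omega> grad\<omega> J z c \<eta>\<close> is the prox-mapping with centre \<open>z\<close> and weight \<open>c\<close> on \<open>J\<close>, applied to \<open>\<eta>\<close>.
  It is meaningful when \<open>prox_well_defined\<close> holds.
\<close>

definition prox ::
    "'a::real_inner set \<Rightarrow> ('a \<Rightarrow> real) \<Rightarrow> ('a \<Rightarrow> 'a) \<Rightarrow> ('a \<Rightarrow> real) \<Rightarrow> 'a \<Rightarrow> real \<Rightarrow> 'a \<Rightarrow> 'a" where
  "prox Z \<omega> grad\<omega> J z c \<eta> = arg_min_on (prox_objective \<omega> grad\<omega> J z c \<eta>) Z"

definition prox_well_defined ::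
    "'a::real_inner set \<Rightarrow> ('a \<Rightarrow> real) \<Rightarrow> ('a \<Rightarrow> 'a) \<Rightarrow> ('a \<Rightarrow> real) \<Rightarrow> bool" where
  "prox_well_defined Z \<omega> grad\<omega> J \<longleftrightarrow>
     (\<forall>z\<in>Z. \<forall>\<eta>. \<forall>c>0. \<exists>!u. is_arg_min (prox_objective \<omega> grad\<omega> J z c \<eta>) (\<lambda>u. u \<in> Z) u)"

definition gap_Q ::
    "('a::real_inner \<Rightarrow> real) \<Rightarrow> ('a \<Rightarrow> 'a) \<Rightarrow> ('a \<Rightarrow> real) \<Rightarrow> 'a \<Rightarrow> 'a \<Rightarrow> real" where
  "gap_Q G H J v u = G v - G u + inner (H u) (v - u) + J v - J u"

text \<open>
  A real supremum suffices: a uniform bound on the Bregman distance makes \<open>Z\<close> compact, and then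
  \<open>u \<mapsto> gap_Q G H J v u\<close> is bounded above on \<open>Z\<close>, \<open>J\<close> having an affine minorant.
\<close>

definition gap ::
    "'a::real_inner set \<Rightarrow> ('a \<Rightarrow> real) \<Rightarrow> ('a \<Rightarrow> 'a) \<Rightarrow> ('a \<Rightarrow> real) \<Rightarrow> 'a \<Rightarrow> real" where
  "gap Z G H J v = (SUP u\<in>Z. gap_Q G H J v u)"

text \<open>
  Mutual independence of all the variables \<open>\<xi> i\<close> and \<open>\<zeta> i\<close> (\<open>i \<ge> 1\<close>) together. This is \<open>indep_vars\<close> with its
  characterisation \<open>indep_vars_def2\<close> written out, since the two families may have different value types.
\<close>

definition independent_samples ::
    "'w measure \<Rightarrow> 's measure \<Rightarrow> 't measure \<Rightarrow> (nat \<Rightarrow> 'w \<Rightarrow> 's) \<Rightarrow> (nat \<Rightarrow> 'w \<Rightarrow> 't) \<Rightarrow> bool" where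
  "independent_samples M S T \<xi> \<zeta> \<longleftrightarrow>
     (\<forall>i\<ge>1. \<xi> i \<in> measurable M S) \<and> (\<forall>i\<ge>1. \<zeta> i \<in> measurable M T) \<and>
     prob_space.indep_sets M
       (case_sum (\<lambda>i. {\<xi> i -` A \<inter> space M | A. A \<in> sets S})
                 (\<lambda>i. {\<zeta> i -` A \<inter> space M | A. A \<in> sets T}))
       ({1..} <+> {1..})"

text \<open>
  Joint measurability of the oracle in the query point and the sample is what makes the iterates of
  the method random variables.
\<close>

definition unbiased_oracle ::
    "'w measure \<Rightarrow> 's measure \<Rightarrow> 'a::euclidean_space set \<Rightarrow> (nat \<Rightarrow> 'w \<Rightarrow> 's) \<Rightarrow>
     ('a \<Rightarrow> 's \<Rightarrow> 'a) \<Rightarrow> ('a \<Rightarrow> 'a) \<Rightarrow> bool" where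
  "unbiased_oracle M S Z \<xi> F f \<longleftrightarrow>
     (\<lambda>(x, s). F x s) \<in> borel_measurable (restrict_space borel Z \<Otimes>\<^sub>M S) \<and>
     (\<forall>x\<in>Z. \<forall>i\<ge>1. has_bochner_integral M (\<lambda>\<theta>. F x (\<xi> i \<theta>)) (f x))"

definition bounded_variance ::
    "'w measure \<Rightarrow> ('a::euclidean_space \<Rightarrow> real) \<Rightarrow> 'a set \<Rightarrow> (nat \<Rightarrow> 'w \<Rightarrow> 's) \<Rightarrow>
     ('a \<Rightarrow> 's \<Rightarrow> 'a) \<Rightarrow> ('a \<Rightarrow> 'a) \<Rightarrow> real \<Rightarrow> bool" where
  "bounded_variance M N Z \<xi> F f \<sigma> \<longleftrightarrow>
     (\<forall>x\<in>Z. \<forall>i\<ge>1.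
        integrable M (\<lambda>\<theta>. (dual_norm N (F x (\<xi> i \<theta>) - f x))\<^sup>2) \<and>
        (\<integral>\<theta>. (dual_norm N (F x (\<xi> i \<theta>) - f x))\<^sup>2 \<partial>M) \<le> \<sigma>\<^sup>2)"

text \<open>
  For \<open>\<sigma> = 0\<close> the quotient in the exponent is read as \<open>0\<close> where the error vanishes and as \<open>\<infinity>\<close> elsewhere,
  so the condition says that the oracle is almost surely exact; HOL's \<open>x / 0 = 0\<close> would make it void.
\<close>

definition light_tail ::
    "'w measure \<Rightarrow> ('a::euclidean_space \<Rightarrow> real) \<Rightarrow> 'a set \<Rightarrow> (nat \<Rightarrow> 'w \<Rightarrow> 's) \<Rightarrow>
     ('a \<Rightarrow> 's \<Rightarrow> 'a) \<Rightarrow> ('a \<Rightarrow> 'a) \<Rightarrow> real \<Rightarrow> bool" where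
  "light_tail M N Z \<xi> F f \<sigma> \<longleftrightarrow>
     (\<forall>x\<in>Z. \<forall>i\<ge>1.
        if \<sigma> = 0 then (AE \<theta> in M. F x (\<xi> i \<theta>) = f x)
        else integrable M (\<lambda>\<theta>. exp ((dual_norm N (f x - F x (\<xi> i \<theta>)))\<^sup>2 / \<sigma>\<^sup>2)) \<and>
             (\<integral>\<theta>. exp ((dual_norm N (f x - F x (\<xi> i \<theta>)))\<^sup>2 / \<sigma>\<^sup>2) \<partial>M) \<le> exp 1)"

end

theory Submission
  imports Defs
begin

text \<open>
  One round of the method satisfies the recursion \<open>Q (wag (t + 1)) u \<le> (1 - \<alpha> t) * Q (wag t) u + \<alpha> t * X t u\<close>;
  weighting it by \<open>t (t + 1) / 2\<close> makes it telescope, because \<open>t / \<gamma> t\<close> is increasing and the Bregman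
  distances lie between \<open>0\<close> and \<open>\<Omega>\<^sup>2\<close>. The noise enters \<open>X t u\<close> through its squares, through martingale
  differences, and linearly in the comparison point \<open>u\<close>. The last contribution is uniform in \<open>u\<close> only after
  comparison with an auxiliary mirror-descent sequence driven by the noise. With a constant step tuned to
  the horizon this sequence costs so little that the total coefficient of \<open>(\<sigma>\<^sub>G + \<sigma>\<^sub>H) \<Omega> / sqrt (\<mu> t)\<close> stays
  below \<open>7\<close>; with the steps \<open>\<gamma> t\<close> of the method the same estimate exceeds \<open>7\<close>.

  For the large deviations, the squares have a bounded exponential moment by convexity of \<open>exp\<close>, and the
  martingale has the moment generating function of a Gaussian by \<open>exp x \<le> x + exp (x\<^sup>2)\<close>. The latter gives
  \<open>exp (- x\<^sup>2 / 4)\<close> instead of \<open>exp (- x\<^sup>2 / 3)\<close>, which is compensated by slack in the other constants.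
\<close>

subsection \<open>Norms and dual norms\<close>

text \<open>The point \<open>w (t + 1)\<close> is computed from the sample \<open>\<xi> t\<close>
  that also gave the gradient estimate, so gradient noise paired with \<open>w (t + 1)\<close> is no
  martingale difference. It is paired with \<open>r t\<close> instead, and the displacement
  \<open>w (t + 1) - r t\<close> is charged to the strong convexity of the prox-step, at the expense
  of the summand with \<sigma> in the denominator of \<open>\<gamma> t\<close>. Only the second
  operator call of a round is made at a point depending on samples of that round, hence the two
  levels of information, before a round and in the middle of it. In units of
  \<open>(\<sigma>\<^sub>G + \<sigma>\<^sub>H) * \<Omega> / sqrt (\<mu> * n)\<close> the noise costs
  \<open>sqrt 2\<close> through the last step size, \<open>8 / 3 * sqrt 2\<close> through the
  squares and twice \<open>2 / sqrt 6\<close> through the auxiliary sequence, in total less than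
  6.83. For the deviations, the squares at level \<open>l\<close> and the martingale at level
  \<open>2 / sqrt 3 * l\<close> together exceed the permitted slope 6 slightly; what the
  deterministic part leaves of 7 absorbs this for moderate \<open>l\<close>.\<close>

lemma is_norm_zero: "is_norm N \<Longrightarrow> N 0 = 0"
  by (auto simp: is_norm_def)

lemma is_norm_nonneg: "is_norm N \<Longrightarrow> 0 \<le> N x"
  by (auto simp: is_norm_def)

lemma is_norm_scaleR: "is_norm N \<Longrightarrow> N (c *\<^sub>R x) = \<bar>c\<bar> * N x"
  by (auto simp: is_norm_def)

lemma is_norm_triangle: "is_norm N \<Longrightarrow> N (x + y) \<le> N x + N y"
  by (auto simp: is_norm_def)

lemma is_norm_minus: "is_norm N \<Longrightarrow> N (- x) = N x"
  using is_norm_scaleR[of N "-1" x] by simp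

lemma is_norm_minus_commute: "is_norm N \<Longrightarrow> N (x - y) = N (y - x)"
  using is_norm_minus[of N "x - y"] by simp

text \<open>Closedness, continuity and Borel sets refer to the class norm, the hypotheses to
  \<open>N\<close>. Expansion in the basis gives one half of the equivalence; the summand 1 only
  makes the constant positive.\<close>

lemma is_norm_le_norm:
  fixes N :: "'a::euclidean_space \<Rightarrow> real"
  assumes "is_norm N"
  obtains K where "0 < K" "\<And>x. N x \<le> K * norm x"
proof
  show "0 < 1 + (\<Sum>b\<in>(Basis::'a set). N b)"
    using is_norm_nonneg[OF assms] by (intro add_pos_nonneg sum_nonneg) auto
  fix x :: 'a
  have sum_le: "N (\<Sum>b\<in>B. f b) \<le> (\<Sum>b\<in>B. N (f b))" if "finite B" for B :: "'a set" and f
    using that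
    by induction
      (auto simp: is_norm_zero[OF assms] intro: order_trans[OF is_norm_triangle[OF assms]] add_left_mono)
  have "N x = N (\<Sum>b\<in>Basis. (x \<bullet> b) *\<^sub>R b)"
    by (simp add: euclidean_representation)
  also have "\<dots> \<le> (\<Sum>b\<in>Basis. N ((x \<bullet> b) *\<^sub>R b))"
    by (rule sum_le) simp
  also have "\<dots> = (\<Sum>b\<in>Basis. \<bar>x \<bullet> b\<bar> * N b)"
    by (simp add: is_norm_scaleR[OF assms])
  also have "\<dots> \<le> (\<Sum>b\<in>Basis. norm x * N b)"
    by (intro sum_mono mult_right_mono Basis_le_norm is_norm_nonneg[OF assms])
  also have "\<dots> \<le> (1 + (\<Sum>b\<in>(Basis::'a set). N b)) * norm x"
    by (simp add: algebra_simps sum_distrib_right sum_distrib_left)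
  finally show "N x \<le> (1 + (\<Sum>b\<in>(Basis::'a set). N b)) * norm x" .
qed

lemma is_norm_continuous_on:
  fixes N :: "'a::euclidean_space \<Rightarrow> real"
  assumes "is_norm N"
  shows "continuous_on A N"
proof -
  obtain K where K: "0 < K" "\<And>x. N x \<le> K * norm x"
    using is_norm_le_norm[OF assms] by metis
  have "K-lipschitz_on A N"
  proof (rule lipschitz_onI)
    fix x y
    have "N x \<le> N y + N (x - y)" "N y \<le> N x + N (x - y)"
      using is_norm_triangle[OF assms, of y "x - y"] is_norm_triangle[OF assms, of x "y - x"]
        is_norm_minus_commute[OF assms, of x y] by auto
    with K(2)[of "x - y"] show "dist (N x) (N y) \<le> K * dist x y"
      by (simp add: dist_real_def dist_norm)
  qed (use K in simp)
  then show ?thesis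
    by (rule lipschitz_on_continuous_on)
qed

text \<open>The other half of the equivalence: \<open>N\<close> is continuous by the first half, so
  it has a positive minimum on the compact unit sphere, and homogeneity does the rest.\<close>

lemma norm_le_is_norm:
  fixes N :: "'a::euclidean_space \<Rightarrow> real"
  assumes "is_norm N"
  obtains c where "0 < c" "\<And>x. norm x \<le> c * N x"
proof -
  obtain e :: 'a where "e \<in> Basis"
    using nonempty_Basis by blast
  then have "e \<in> sphere 0 1"
    by simp
  then obtain x0 :: 'a where x0: "x0 \<in> sphere 0 1" "\<And>x. x \<in> sphere 0 1 \<Longrightarrow> N x0 \<le> N x"
    using continuous_attains_inf[OF compact_sphere _ is_norm_continuous_on[OF assms]] by fastforce
  have pos: "0 < N x0"
    using x0(1) assms by (force simp: is_norm_def less_le)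
  show thesis
  proof
    show "0 < 1 / N x0" using pos by simp
    fix x :: 'a
    show "norm x \<le> 1 / N x0 * N x"
    proof (cases "x = 0")
      case False
      then have "N x0 \<le> N ((1 / norm x) *\<^sub>R x)"
        by (intro x0(2)) simp
      also have "\<dots> = N x / norm x"
        by (simp add: is_norm_scaleR[OF assms])
      finally show ?thesis
        using False pos by (simp add: field_simps)
    qed (simp add: is_norm_zero[OF assms])
  qed
qed

lemma dual_norm_bdd_above:
  fixes N :: "'a::euclidean_space \<Rightarrow> real"
  assumes "is_norm N"
  shows "bdd_above (inner \<eta> ` {x. N x \<le> 1})"
proof -
  obtain c where c: "0 < c" "\<And>x. norm x \<le> c * N x"
    using norm_le_is_norm[OF assms] by metis
  show ?thesis
  proof (rule bdd_aboveI2)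
    fix x assume "x \<in> {x. N x \<le> 1}"
    then have "norm x \<le> c"
      using order_trans[OF c(2)[of x] mult_left_le[of "N x" c]] c(1) by simp
    then show "inner \<eta> x \<le> norm \<eta> * c"
      using norm_cauchy_schwarz[of \<eta> x] by (meson mult_left_mono norm_ge_zero order_trans)
  qed
qed

lemma inner_le_dual_norm:
  fixes N :: "'a::euclidean_space \<Rightarrow> real"
  assumes "is_norm N"
  shows "inner \<eta> x \<le> dual_norm N \<eta> * N x"
proof (cases "x = 0")
  case False
  then have pos: "0 < N x"
    using assms by (auto simp: is_norm_def less_le)
  have "inner \<eta> ((1 / N x) *\<^sub>R x) \<le> dual_norm N \<eta>"
    unfolding dual_norm_def using pos
    by (intro cSUP_upper dual_norm_bdd_above assms) (simp add: is_norm_scaleR[OF assms])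
  then show ?thesis
    using pos by (simp add: field_simps)
qed (simp add: is_norm_zero[OF assms])

lemma dual_norm_leI:
  fixes N :: "'a::euclidean_space \<Rightarrow> real"
  assumes "is_norm N" "\<And>x. N x \<le> 1 \<Longrightarrow> inner \<eta> x \<le> B"
  shows "dual_norm N \<eta> \<le> B"
  unfolding dual_norm_def
  by (rule cSUP_least) (use assms is_norm_zero[OF assms(1)] in \<open>auto intro: exI[of _ 0]\<close>)

lemma dual_norm_nonneg:
  fixes N :: "'a::euclidean_space \<Rightarrow> real"
  assumes "is_norm N"
  shows "0 \<le> dual_norm N \<eta>"
  using cSUP_upper[OF _ dual_norm_bdd_above[OF assms], of 0 \<eta>] is_norm_zero[OF assms]
  by (simp add: dual_norm_def)

lemma dual_norm_triangle:
  fixes N :: "'a::euclidean_space \<Rightarrow> real"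
  assumes "is_norm N"
  shows "dual_norm N (\<eta> + \<theta>) \<le> dual_norm N \<eta> + dual_norm N \<theta>"
proof (rule dual_norm_leI[OF assms])
  fix x assume "N x \<le> 1"
  then have "dual_norm N \<zeta> * N x \<le> dual_norm N \<zeta>" for \<zeta>
    by (simp add: mult_left_le dual_norm_nonneg[OF assms])
  then show "inner (\<eta> + \<theta>) x \<le> dual_norm N \<eta> + dual_norm N \<theta>"
    using inner_le_dual_norm[OF assms, of \<eta> x] inner_le_dual_norm[OF assms, of \<theta> x]
    by (smt (verit) inner_add_left)
qed

lemma dual_norm_minus:
  fixes N :: "'a::euclidean_space \<Rightarrow> real"
  assumes "is_norm N"
  shows "dual_norm N (- \<eta>) = dual_norm N \<eta>"
proof -
  have "dual_norm N (- \<theta>) \<le> dual_norm N \<theta>" for \<theta>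
  proof (rule dual_norm_leI[OF assms])
    fix x assume "N x \<le> 1"
    then show "inner (- \<theta>) x \<le> dual_norm N \<theta>"
      using inner_le_dual_norm[OF assms, of \<theta> "- x"]
        mult_left_le[OF _ dual_norm_nonneg[OF assms], of "N x" \<theta>]
      by (simp add: is_norm_minus[OF assms])
  qed
  from this[of \<eta>] this[of "- \<eta>"] show ?thesis by simp
qed

lemma dual_norm_minus_commute:
  fixes N :: "'a::euclidean_space \<Rightarrow> real"
  assumes "is_norm N"
  shows "dual_norm N (\<eta> - \<theta>) = dual_norm N (\<theta> - \<eta>)"
  using dual_norm_minus[OF assms, of "\<eta> - \<theta>"] by simp

lemma dual_norm_zero: "is_norm N \<Longrightarrow> dual_norm N (0::'a::euclidean_space) = 0"
  by (rule antisym[OF dual_norm_leI dual_norm_nonneg]) auto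

lemma abs_inner_le_dual_norm:
  fixes N :: "'a::euclidean_space \<Rightarrow> real"
  assumes "is_norm N"
  shows "\<bar>inner \<eta> x\<bar> \<le> dual_norm N \<eta> * N x"
  using inner_le_dual_norm[OF assms, of \<eta> x] inner_le_dual_norm[OF assms, of "-\<eta>" x]
  by (simp add: dual_norm_minus[OF assms])

lemma norm_le_dual_norm:
  fixes N :: "'a::euclidean_space \<Rightarrow> real"
  assumes "is_norm N"
  obtains K where "0 < K" "\<And>\<eta>. norm \<eta> \<le> K * dual_norm N \<eta>"
proof -
  obtain K where K: "0 < K" "\<And>x. N x \<le> K * norm x"
    using is_norm_le_norm[OF assms] by metis
  have "norm \<eta> \<le> K * dual_norm N \<eta>" for \<eta>
  proof (cases "\<eta> = 0")
    case False
    have "norm \<eta> * norm \<eta> \<le> dual_norm N \<eta> * N \<eta>"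
      using inner_le_dual_norm[OF assms, of \<eta> \<eta>] by (simp add: dot_square_norm power2_eq_square)
    also have "\<dots> \<le> dual_norm N \<eta> * (K * norm \<eta>)"
      by (intro mult_left_mono K dual_norm_nonneg assms)
    finally show ?thesis
      using False by (simp add: mult.assoc mult.left_commute)
  qed (simp add: dual_norm_zero[OF assms])
  with K(1) that show thesis by blast
qed

lemma dual_norm_le_norm:
  fixes N :: "'a::euclidean_space \<Rightarrow> real"
  assumes "is_norm N"
  obtains c where "0 < c" "\<And>\<eta>. dual_norm N \<eta> \<le> c * norm \<eta>"
proof -
  obtain c where c: "0 < c" "\<And>x. norm x \<le> c * N x"
    using norm_le_is_norm[OF assms] by metis
  have "dual_norm N \<eta> \<le> c * norm \<eta>" for \<eta>
  proof (rule dual_norm_leI[OF assms])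
    fix x assume "N x \<le> 1"
    then have "norm x \<le> c"
      using order_trans[OF c(2)[of x] mult_left_le[of "N x" c]] c(1) by simp
    then show "inner \<eta> x \<le> c * norm \<eta>"
      using norm_cauchy_schwarz[of \<eta> x] mult_left_mono[of "norm x" c "norm \<eta>"]
      by (simp add: mult.commute)
  qed
  with c(1) that show thesis by blast
qed

lemma dual_norm_continuous_on:
  fixes N :: "'a::euclidean_space \<Rightarrow> real"
  assumes "is_norm N"
  shows "continuous_on A (dual_norm N)"
proof -
  obtain c where c: "0 < c" "\<And>\<eta>. dual_norm N \<eta> \<le> c * norm \<eta>"
    using dual_norm_le_norm[OF assms] by metis
  have "c-lipschitz_on A (dual_norm N)"
  proof (rule lipschitz_onI)
    fix x y
    have "dual_norm N x \<le> dual_norm N y + dual_norm N (x - y)"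
      "dual_norm N y \<le> dual_norm N x + dual_norm N (x - y)"
      using dual_norm_triangle[OF assms, of y "x - y"] dual_norm_triangle[OF assms, of x "y - x"]
        dual_norm_minus_commute[OF assms, of x y] by auto
    with c(2)[of "x - y"] show "dist (dual_norm N x) (dual_norm N y) \<le> c * dist x y"
      by (simp add: dist_real_def dist_norm)
  qed (use c in simp)
  then show ?thesis
    by (rule lipschitz_on_continuous_on)
qed

lemma measurable_dual_norm:
  fixes N :: "'a::euclidean_space \<Rightarrow> real"
  assumes "is_norm N"
  shows "dual_norm N \<in> borel_measurable borel"
  by (intro borel_measurable_continuous_onI dual_norm_continuous_on assms)

subsection \<open>Bregman distances and prox-mappings\<close>

locale mirror_setup =
  fixes Z :: "'a::euclidean_space set"
    and N :: "'a \<Rightarrow> real"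
    and \<omega> :: "'a \<Rightarrow> real"
    and grad\<omega> :: "'a \<Rightarrow> 'a"
    and \<mu> \<Omega> :: real
  assumes norm: "is_norm N"
    and Z_nonempty: "Z \<noteq> {}" and Z_closed: "closed Z" and Z_convex: "convex Z"
    and \<mu>_pos: "0 < \<mu>"
    and \<omega>_diff: "has_gradient_on \<omega> grad\<omega> Z"
    and \<omega>_strongly_convex: "strongly_convex_on Z N \<mu> \<omega>"
    and \<Omega>_pos: "0 < \<Omega>"
    and V_bound: "\<And>z1 z2. z1 \<in> Z \<Longrightarrow> z2 \<in> Z \<Longrightarrow> bregman \<omega> grad\<omega> z1 z2 \<le> \<Omega>\<^sup>2"
begin

abbreviation V :: "'a \<Rightarrow> 'a \<Rightarrow> real" where
  "V \<equiv> bregman \<omega> grad\<omega>"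

lemma segment_in_Z:
  assumes "z \<in> Z" "u \<in> Z" "0 \<le> a" "a \<le> 1"
  shows "z + a *\<^sub>R (u - z) \<in> Z"
proof -
  have "(1 - a) *\<^sub>R z + a *\<^sub>R u \<in> Z"
    using Z_convex assms by (intro convexD) auto
  then show ?thesis by (simp add: algebra_simps)
qed

text \<open>\<open>Z\<close> may have empty interior, so the gradient is tested only along segments
  inside \<open>Z\<close>. The form as a sequence later exhibits
  \<open>inner (grad\<omega> z) (u - z)\<close> as a limit of measurable functions of
  \<open>z\<close>.\<close>

lemma directional_derivative:
  assumes "z \<in> Z" "u \<in> Z"
  shows "(\<lambda>n. (\<omega> (z + inverse (real (Suc n)) *\<^sub>R (u - z)) - \<omega> z) / inverse (real (Suc n)))
    \<longlonglongrightarrow> inner (grad\<omega> z) (u - z)"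
proof -
  let ?c = "\<lambda>a::real. z + a *\<^sub>R (u - z)"
  have "(?c has_derivative (\<lambda>a. a *\<^sub>R (u - z))) (at 0 within {0..1})"
    by (auto intro!: derivative_eq_intros)
  moreover have "(\<omega> has_derivative inner (grad\<omega> z)) (at (?c 0) within ?c ` {0..1})"
  proof (rule has_derivative_subset)
    show "(\<omega> has_derivative inner (grad\<omega> z)) (at (?c 0) within Z)"
      using \<omega>_diff assms by (simp add: has_gradient_on_def)
    show "?c ` {0..1} \<subseteq> Z"
      using segment_in_Z[OF assms] by auto
  qed
  ultimately have "((\<omega> \<circ> ?c) has_derivative (inner (grad\<omega> z) \<circ> (\<lambda>a. a *\<^sub>R (u - z)))) (at 0 within {0..1})"
    by (rule diff_chain_within)
  then have "((\<omega> \<circ> ?c) has_real_derivative inner (grad\<omega> z) (u - z)) (at 0 within {0..1})"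
    unfolding has_field_derivative_def o_def by (rule has_derivative_eq_rhs) (simp add: fun_eq_iff)
  then have lim: "((\<lambda>a. (\<omega> (?c a) - \<omega> z) / a) \<longlongrightarrow> inner (grad\<omega> z) (u - z)) (at 0 within {0..1})"
    by (simp add: has_field_derivative_iff)
  have "filterlim (\<lambda>n. inverse (real (Suc n))) (at 0 within {0..1}) sequentially"
    unfolding filterlim_at
    by (intro conjI LIMSEQ_inverse_real_of_nat eventuallyI) (auto simp: field_simps)
  from filterlim_compose[OF lim this] show ?thesis .
qed

text \<open>Strong convexity on the segment is divided by the step length \<open>a\<close> and
  passed to the limit \<open>a = 0\<close>, where the factor \<open>1 - a\<close>
  disappears.\<close>

lemma bregman_ge:
  assumes "z \<in> Z" "u \<in> Z"
  shows "\<mu> / 2 * (N (u - z))\<^sup>2 \<le> V z u"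
proof -
  let ?a = "\<lambda>n. inverse (real (Suc n))"
  have "(\<omega> (z + ?a n *\<^sub>R (u - z)) - \<omega> z) / ?a n \<le> \<omega> u - \<omega> z - \<mu> / 2 * (1 - ?a n) * (N (u - z))\<^sup>2" for n
  proof -
    have a: "0 < ?a n" "?a n \<le> 1" by (auto simp: field_simps)
    then have "\<omega> ((1 - ?a n) *\<^sub>R z + ?a n *\<^sub>R u)
        \<le> (1 - ?a n) * \<omega> z + ?a n * \<omega> u - \<mu> / 2 * ?a n * (1 - ?a n) * (N (z - u))\<^sup>2"
      using \<omega>_strongly_convex assms by (auto simp: strongly_convex_on_def)
    moreover have "(1 - ?a n) *\<^sub>R z + ?a n *\<^sub>R u = z + ?a n *\<^sub>R (u - z)"
      by (simp add: algebra_simps)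
    ultimately have "\<omega> (z + ?a n *\<^sub>R (u - z)) - \<omega> z
        \<le> ?a n * (\<omega> u - \<omega> z - \<mu> / 2 * (1 - ?a n) * (N (u - z))\<^sup>2)"
      by (simp add: algebra_simps diff_divide_distrib is_norm_minus_commute[OF norm, of z u])
    then show ?thesis
      using a(1) by (simp add: pos_divide_le_eq mult.commute del: of_nat_Suc)
  qed
  moreover have "(\<lambda>n. \<omega> u - \<omega> z - \<mu> / 2 * (1 - ?a n) * (N (u - z))\<^sup>2)
      \<longlonglongrightarrow> \<omega> u - \<omega> z - \<mu> / 2 * (1 - 0) * (N (u - z))\<^sup>2"
    by (intro tendsto_intros LIMSEQ_inverse_real_of_nat)
  ultimately have "inner (grad\<omega> z) (u - z) \<le> \<omega> u - \<omega> z - \<mu> / 2 * (1 - 0) * (N (u - z))\<^sup>2"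
    by (intro LIMSEQ_le[OF directional_derivative[OF assms]]) auto
  then show ?thesis
    by (simp add: bregman_def)
qed

lemma bregman_nonneg: "z \<in> Z \<Longrightarrow> u \<in> Z \<Longrightarrow> 0 \<le> V z u"
  using bregman_ge[of z u] \<mu>_pos by (meson order_trans mult_nonneg_nonneg zero_le_power2 divide_nonneg_nonneg less_imp_le zero_le_numeral)

lemma diameter_bound:
  assumes "z \<in> Z" "u \<in> Z"
  shows "N (u - z) \<le> \<Omega> * sqrt (2 / \<mu>)"
proof -
  have "(N (u - z))\<^sup>2 \<le> \<Omega>\<^sup>2 * (2 / \<mu>)"
    using bregman_ge[OF assms] V_bound[OF assms] \<mu>_pos by (simp add: field_simps)
  then have "N (u - z) \<le> sqrt (\<Omega>\<^sup>2 * (2 / \<mu>))"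
    by (rule real_le_rsqrt)
  then show ?thesis
    using \<Omega>_pos unfolding real_sqrt_mult by simp
qed

lemma compact_Z: "compact Z"
proof -
  obtain c where c: "0 < c" "\<And>x. norm x \<le> c * N x"
    using norm_le_is_norm[OF norm] by metis
  obtain z where z: "z \<in> Z" using Z_nonempty by blast
  have "dist z u \<le> c * (\<Omega> * sqrt (2 / \<mu>))" if "u \<in> Z" for u
    using order_trans[OF c(2)[of "u - z"] mult_left_mono[OF diameter_bound[OF z that], of c]] c(1)
    by (simp add: dist_norm norm_minus_commute)
  then have "bounded Z"
    unfolding bounded_def by blast
  then show ?thesis
    using Z_closed by (simp add: compact_eq_bounded_closed)
qed

lemma continuous_on_\<omega>: "continuous_on Z \<omega>"
  using \<omega>_diff by (auto simp: has_gradient_on_def intro: has_derivative_continuous_on)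

text \<open>
  First-order optimality along the segment from \<open>w\<close> to \<open>u\<close>.
\<close>

lemma prox_optimality:
  assumes J: "convex_on Z J" and z: "z \<in> Z" and c: "0 < c"
    and w: "is_arg_min (prox_objective \<omega> grad\<omega> J z c \<eta>) (\<lambda>u. u \<in> Z) w" and u: "u \<in> Z"
  shows "inner \<eta> (w - u) + c * (J w - J u) \<le> V z u - V z w - V w u"
proof -
  let ?a = "\<lambda>n. inverse (real (Suc n))"
  have wZ: "w \<in> Z" and min: "\<And>y. y \<in> Z \<Longrightarrow> prox_objective \<omega> grad\<omega> J z c \<eta> w \<le> prox_objective \<omega> grad\<omega> J z c \<eta> y"
    using w by (auto simp: is_arg_min_linorder)
  have "inner \<eta> (w - u) + inner (grad\<omega> z) (u - w) + c * (J w - J u)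
      \<le> (\<omega> (w + ?a n *\<^sub>R (u - w)) - \<omega> w) / ?a n" for n
  proof -
    have a: "0 < ?a n" "?a n \<le> 1" by (auto simp: field_simps)
    have y: "w + ?a n *\<^sub>R (u - w) \<in> Z"
      using a by (intro segment_in_Z wZ u) auto
    have "J ((1 - ?a n) *\<^sub>R w + ?a n *\<^sub>R u) \<le> (1 - ?a n) * J w + ?a n * J u"
      using a J wZ u by (intro convex_onD) auto
    moreover have "(1 - ?a n) *\<^sub>R w + ?a n *\<^sub>R u = w + ?a n *\<^sub>R (u - w)"
      by (simp add: algebra_simps)
    ultimately have "c * J (w + ?a n *\<^sub>R (u - w)) \<le> c * ((1 - ?a n) * J w + ?a n * J u)"
      using c by simp
    with min[OF y] have "?a n * (inner \<eta> (w - u) + inner (grad\<omega> z) (u - w) + c * (J w - J u))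
        \<le> \<omega> (w + ?a n *\<^sub>R (u - w)) - \<omega> w"
      by (simp add: prox_objective_def bregman_def inner_add_right inner_diff_right algebra_simps)
    then show ?thesis
      using a(1) by (simp add: pos_le_divide_eq mult.commute del: of_nat_Suc)
  qed
  then have "inner \<eta> (w - u) + inner (grad\<omega> z) (u - w) + c * (J w - J u) \<le> inner (grad\<omega> w) (u - w)"
    by (intro LIMSEQ_le_const[OF directional_derivative[OF wZ u]]) auto
  then show ?thesis
    by (simp add: bregman_def inner_diff_right algebra_simps)
qed

text \<open>Near-minimal values force near-minimal points; this quantitative uniqueness is the
  growth condition in the measurable selection of the minimiser.\<close>

lemma prox_growth:
  assumes "convex_on Z J" "z \<in> Z" "0 < c"
    "is_arg_min (prox_objective \<omega> grad\<omega> J z c \<eta>) (\<lambda>u. u \<in> Z) w" "u \<in> Z"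
  shows "\<mu> / 2 * (N (u - w))\<^sup>2 \<le> prox_objective \<omega> grad\<omega> J z c \<eta> u - prox_objective \<omega> grad\<omega> J z c \<eta> w"
proof -
  have "w \<in> Z" using assms(4) by (simp add: is_arg_min_def)
  from prox_optimality[OF assms] bregman_ge[OF this assms(5)] show ?thesis
    by (simp add: prox_objective_def inner_diff_right algebra_simps)
qed

lemma is_arg_min_prox:
  assumes "\<exists>u. is_arg_min (prox_objective \<omega> grad\<omega> J z c \<eta>) (\<lambda>u. u \<in> Z) u"
  shows "is_arg_min (prox_objective \<omega> grad\<omega> J z c \<eta>) (\<lambda>u. u \<in> Z) (prox Z \<omega> grad\<omega> J z c \<eta>)"
  using someI_ex[OF assms] by (simp add: prox_def arg_min_on_def arg_min_def)

text \<open>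
  The auxiliary sequence of the convergence proof uses the prox-mapping without the term \<open>J\<close>, whose
  existence comes from compactness.
\<close>

lemma prox_zero_exists:
  "\<exists>u. is_arg_min (prox_objective \<omega> grad\<omega> (\<lambda>_. 0) z c \<eta>) (\<lambda>u. u \<in> Z) u"
proof -
  have "continuous_on Z (prox_objective \<omega> grad\<omega> (\<lambda>_. 0) z c \<eta>)"
    unfolding prox_objective_def bregman_def by (intro continuous_intros continuous_on_\<omega>)
  from continuous_attains_inf[OF compact_Z Z_nonempty this] show ?thesis
    by (auto simp: is_arg_min_linorder)
qed

lemma convex_on_zero: "convex_on Z (\<lambda>_. 0 :: real)"
  using Z_convex by (simp add: convex_on_def)

text \<open>
  Two prox-mappings with the same centre: the extragradient pair \<open>w\<close> (prediction) and \<open>y\<close> (correction).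
\<close>

lemma prox_pair:
  assumes J: "convex_on Z J" and r: "r \<in> Z" and c: "0 < c"
    and w: "is_arg_min (prox_objective \<omega> grad\<omega> J r c \<eta>) (\<lambda>u. u \<in> Z) w"
    and y: "is_arg_min (prox_objective \<omega> grad\<omega> J r c \<theta>) (\<lambda>u. u \<in> Z) y"
    and u: "u \<in> Z"
  shows "inner \<theta> (w - u) + c * (J w - J u)
    \<le> V r u - V y u + inner (\<theta> - \<eta>) (w - y) - \<mu> / 2 * (N (w - r))\<^sup>2 - \<mu> / 2 * (N (w - y))\<^sup>2"
proof -
  have wZ: "w \<in> Z" and yZ: "y \<in> Z"
    using w y by (simp_all add: is_arg_min_def)
  show ?thesis
    \<comment> \<open>Optimality of \<open>w\<close> is tested at \<open>y\<close>, that of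
      \<open>y\<close> at \<open>u\<close>. In the sum \<open>V r y\<close> cancels, and
      \<open>V r w\<close> and \<open>V w y\<close> become the two negative squares.\<close>
    using prox_optimality[OF J r c w yZ] prox_optimality[OF J r c y u]
      bregman_ge[OF r wZ] bregman_ge[OF wZ yZ]
    by (simp add: inner_diff_left inner_diff_right algebra_simps is_norm_minus_commute[OF norm, of y w])
qed

text \<open>The step goes in the direction of \<eta>, so the sequence chases the maximiser. What
  moving from \<open>v\<close> to \<open>v'\<close> gains is at most the dual norm of \<eta> times
  \<open>N (v' - v)\<close>, and Young's inequality balances this against the strong convexity of
  \<open>V v v'\<close>.\<close>

lemma prox_zero_step:
  assumes v: "v \<in> Z" and u: "u \<in> Z"
    and v': "is_arg_min (prox_objective \<omega> grad\<omega> (\<lambda>_. 0) v 1 (- \<eta>)) (\<lambda>u. u \<in> Z) v'"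
  shows "inner \<eta> (u - v) \<le> V v u - V v' u + (dual_norm N \<eta>)\<^sup>2 / (2 * \<mu>)"
proof -
  have v'Z: "v' \<in> Z"
    using v' by (simp add: is_arg_min_def)
  let ?p = "N (v' - v)" and ?d = "dual_norm N \<eta>"
  have "0 \<le> (?d - \<mu> * ?p)\<^sup>2 / (2 * \<mu>)"
    using \<mu>_pos by simp
  also have "\<dots> = ?d\<^sup>2 / (2 * \<mu>) - ?d * ?p + \<mu> / 2 * ?p\<^sup>2"
    using \<mu>_pos by (simp add: power2_eq_square field_simps)
  finally show ?thesis
    using prox_optimality[OF convex_on_zero v zero_less_one v' u] bregman_ge[OF v v'Z]
      inner_le_dual_norm[OF norm, of \<eta> "v' - v"]
    by (simp add: inner_diff_left inner_diff_right algebra_simps)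
qed

end

subsection \<open>Measurability of the prox-mapping\<close>

text \<open>
  The minimiser is the limit of points \<open>D (k x)\<close>, where \<open>k x\<close> is the first index whose value is
  within a given tolerance of the infimum.
\<close>

lemma measurable_minimiser:
  fixes g :: "'b \<Rightarrow> 'a::euclidean_space \<Rightarrow> real" and D :: "nat \<Rightarrow> 'a"
  assumes meas [measurable]: "\<And>n. (\<lambda>x. g x (D n)) \<in> borel_measurable B"
    and near: "\<And>x e. x \<in> space B \<Longrightarrow> 0 < e \<Longrightarrow> \<exists>n. g x (D n) < g x (p x) + e"
    and growth: "\<And>x n. x \<in> space B \<Longrightarrow> (norm (D n - p x))\<^sup>2 \<le> C * (g x (D n) - g x (p x))"
    and C: "0 < C"
  shows "p \<in> borel_measurable B"
proof -
  define m where "m x = (INF n. g x (D n))" for x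
  have ge: "g x (p x) \<le> g x (D n)" if "x \<in> space B" for x n
    using order_trans[OF zero_le_power2 growth[OF that, of n]] C by (simp add: zero_le_mult_iff)
  have bdd: "bdd_below (range (\<lambda>n. g x (D n)))" if "x \<in> space B" for x
    using ge[OF that] by (intro bdd_belowI2)
  have m_eq: "m x = g x (p x)" if x: "x \<in> space B" for x
  proof (rule antisym)
    show "g x (p x) \<le> m x"
      unfolding m_def by (rule cINF_greatest) (auto intro: ge x)
    show "m x \<le> g x (p x)"
    proof (rule field_le_epsilon)
      fix e :: real assume "0 < e"
      then obtain n where "g x (D n) < g x (p x) + e"
        using near[OF x] by blast
      moreover have "m x \<le> g x (D n)"
        unfolding m_def by (rule cINF_lower[OF bdd[OF x]]) simp
      ultimately show "m x \<le> g x (p x) + e" by simp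
    qed
  qed
  have [measurable]: "m \<in> borel_measurable B"
    unfolding m_def by (rule borel_measurable_cINF) (auto intro: bdd)
  define k where "k j x = (LEAST n. g x (D n) < m x + inverse (real (Suc j)))" for j x
  have [measurable]: "k j \<in> measurable B (count_space UNIV)" for j
    unfolding k_def by measurable
  have k: "g x (D (k j x)) < m x + inverse (real (Suc j))" if "x \<in> space B" for x j
    unfolding k_def m_eq[OF that] by (rule LeastI_ex, rule near[OF that]) simp
  show ?thesis
  proof (rule borel_measurable_LIMSEQ_metric)
    show "(\<lambda>x. D (k j x)) \<in> borel_measurable B" for j
      by measurable
    fix x assume x: "x \<in> space B"
    have le: "norm (D (k j x) - p x) \<le> sqrt (C * inverse (real (Suc j)))" for j
    proof (rule real_le_rsqrt)
      have "C * (g x (D (k j x)) - g x (p x)) \<le> C * inverse (real (Suc j))"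
        using k[OF x, of j] m_eq[OF x] C by (intro mult_left_mono) auto
      with growth[OF x, of "k j x"] show "(norm (D (k j x) - p x))\<^sup>2 \<le> C * inverse (real (Suc j))"
        by simp
    qed
    have "(\<lambda>j. sqrt (C * inverse (real (Suc j)))) \<longlonglongrightarrow> sqrt (C * 0)"
      by (intro tendsto_intros LIMSEQ_inverse_real_of_nat)
    then have "(\<lambda>j. sqrt (C * inverse (real (Suc j)))) \<longlonglongrightarrow> 0"
      by simp
    then have "(\<lambda>j. D (k j x) - p x) \<longlonglongrightarrow> 0"
      by (rule Lim_null_comparison[OF always_eventually[OF allI[OF le]]])
    then show "(\<lambda>j. D (k j x)) \<longlonglongrightarrow> p x"
      by (rule LIM_zero_cancel)
  qed
qed

context mirror_setup
begin

text \<open>A gradient relative to \<open>Z\<close> may have an arbitrary component orthogonal to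
  the affine hull of \<open>Z\<close>, so \<open>grad\<omega>\<close> itself can fail to be
  measurable. Only its pairing with \<open>u - z\<close> enters, a limit of continuous difference
  quotients.\<close>

lemma borel_measurable_bregman:
  assumes u: "u \<in> Z"
  shows "(\<lambda>z. V z u) \<in> borel_measurable (restrict_space borel Z)"
proof -
  have cont: "f \<in> borel_measurable (restrict_space borel Z)" if "continuous_on Z f" for f :: "'a \<Rightarrow> real"
    using that by (rule borel_measurable_continuous_on_restrict)
  have "(\<lambda>z. inner (grad\<omega> z) (u - z)) \<in> borel_measurable (restrict_space borel Z)"
  proof (rule borel_measurable_LIMSEQ_real)
    show "(\<lambda>n. (\<omega> (z + inverse (real (Suc n)) *\<^sub>R (u - z)) - \<omega> z) / inverse (real (Suc n)))
        \<longlonglongrightarrow> inner (grad\<omega> z) (u - z)" if "z \<in> space (restrict_space borel Z)" for z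
      using that by (intro directional_derivative u) (simp add: space_restrict_space)
    show "(\<lambda>z. (\<omega> (z + inverse (real (Suc n)) *\<^sub>R (u - z)) - \<omega> z) / inverse (real (Suc n)))
        \<in> borel_measurable (restrict_space borel Z)" for n
    proof (rule cont)
      have "(\<lambda>z. z + inverse (real (Suc n)) *\<^sub>R (u - z)) ` Z \<subseteq> Z"
        using segment_in_Z[OF _ u, of _ "inverse (real (Suc n))"] inverse_le_1_iff[of "real (Suc n)"]
        by (auto simp del: of_nat_Suc)
      then have "continuous_on Z (\<lambda>z. \<omega> (z + inverse (real (Suc n)) *\<^sub>R (u - z)))"
        by (intro continuous_on_compose2[OF continuous_on_\<omega>] continuous_intros)
      then show "continuous_on Z (\<lambda>z. (\<omega> (z + inverse (real (Suc n)) *\<^sub>R (u - z)) - \<omega> z) / inverse (real (Suc n)))"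
        by (intro continuous_on_divide continuous_on_diff continuous_on_\<omega> continuous_on_const) simp_all
    qed
  qed
  with cont[OF continuous_on_\<omega>] show ?thesis
    unfolding bregman_def by (intro borel_measurable_diff borel_measurable_const)
qed

text \<open>
  \<open>J\<close> need not be continuous, so the near-minimisers are taken from a countable set that is dense in
  the graph of \<open>J\<close> rather than merely in \<open>Z\<close>.
\<close>

lemma measurable_prox:
  assumes J: "convex_on Z J" and c: "0 < c"
    and ex: "\<And>z \<eta>. z \<in> Z \<Longrightarrow> \<exists>u. is_arg_min (prox_objective \<omega> grad\<omega> J z c \<eta>) (\<lambda>u. u \<in> Z) u"
    and X [measurable]: "X \<in> measurable B (restrict_space borel Z)"
    and Y [measurable]: "Y \<in> borel_measurable B"
  shows "(\<lambda>x. prox Z \<omega> grad\<omega> J (X x) c (Y x)) \<in> measurable B (restrict_space borel Z)"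
proof -
  let ?p = "\<lambda>x. prox Z \<omega> grad\<omega> J (X x) c (Y x)"
  let ?g = "\<lambda>x. prox_objective \<omega> grad\<omega> J (X x) c (Y x)"
  have XZ: "X x \<in> Z" if "x \<in> space B" for x
    using measurable_space[OF X that] by (simp add: space_restrict_space)
  have [measurable]: "X \<in> borel_measurable B"
    using X by (simp add: measurable_restrict_space2_iff)
  have p: "is_arg_min (?g x) (\<lambda>u. u \<in> Z) (?p x)" if "x \<in> space B" for x
    by (intro is_arg_min_prox ex XZ that)
  then have pZ: "?p x \<in> Z" if "x \<in> space B" for x
    using that by (simp add: is_arg_min_def)
  obtain D' :: "('a \<times> real) set" where D': "countable D'" "D' \<subseteq> (\<lambda>u. (u, J u)) ` Z"
      "(\<lambda>u. (u, J u)) ` Z \<subseteq> closure D'"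
    using separable by blast
  have "D' \<noteq> {}"
    using D'(3) Z_nonempty by auto
  define D where "D n = fst (from_nat_into D' n)" for n
  have from_D': "from_nat_into D' n \<in> D'" for n
    using \<open>D' \<noteq> {}\<close> by (rule from_nat_into)
  have DZ: "D n \<in> Z" for n
    using from_D'[of n] D'(2) by (auto simp: D_def)
  obtain a where a: "0 < a" "\<And>x. norm x \<le> a * N x"
    using norm_le_is_norm[OF norm] by metis
  have "?p \<in> borel_measurable B"
  proof (rule measurable_minimiser[where g = ?g and D = D])
    show "0 < a\<^sup>2 * (2 / \<mu>)"
      using a \<mu>_pos by simp
    show "(\<lambda>x. ?g x (D n)) \<in> borel_measurable B" for n
    proof -
      have "(\<lambda>x. V (X x) (D n)) \<in> borel_measurable B"
        using measurable_compose[OF X borel_measurable_bregman[OF DZ[of n]]] by simp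
      then show ?thesis
        unfolding prox_objective_def by measurable
    qed
    fix x assume x: "x \<in> space B"
    show "(norm (D n - ?p x))\<^sup>2 \<le> a\<^sup>2 * (2 / \<mu>) * (?g x (D n) - ?g x (?p x))" for n
    proof -
      have "(norm (D n - ?p x))\<^sup>2 \<le> (a * N (D n - ?p x))\<^sup>2"
        by (intro power_mono a) simp
      also have "\<dots> = a\<^sup>2 * (2 / \<mu>) * (\<mu> / 2 * (N (D n - ?p x))\<^sup>2)"
        using \<mu>_pos by (simp add: power_mult_distrib)
      also have "\<dots> \<le> a\<^sup>2 * (2 / \<mu>) * (?g x (D n) - ?g x (?p x))"
        using prox_growth[OF J XZ[OF x] c p[OF x] DZ] \<mu>_pos by (intro mult_left_mono) auto
      finally show ?thesis .
    qed
    fix e :: real assume e: "0 < e"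
    have "(?p x, J (?p x)) \<in> closure D'"
      using D'(3) pZ[OF x] by blast
    then obtain s where s: "\<And>n. s n \<in> D'" "s \<longlonglongrightarrow> (?p x, J (?p x))"
      unfolding closure_sequential by blast
    have sJ: "fst (s n) \<in> Z" "J (fst (s n)) = snd (s n)" for n
      using s(1)[of n] D'(2) by auto
    have "(\<lambda>n. \<omega> (fst (s n))) \<longlonglongrightarrow> \<omega> (?p x)"
      using tendsto_fst[OF s(2)] sJ(1) pZ[OF x]
      by (intro continuous_on_tendsto_compose[OF continuous_on_\<omega>]) auto
    moreover have "(\<lambda>n. fst (s n)) \<longlonglongrightarrow> ?p x" "(\<lambda>n. J (fst (s n))) \<longlonglongrightarrow> J (?p x)"
      using tendsto_fst[OF s(2)] tendsto_snd[OF s(2)] by (simp_all add: sJ(2))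
    ultimately have "(\<lambda>n. ?g x (fst (s n))) \<longlonglongrightarrow> ?g x (?p x)"
      unfolding prox_objective_def bregman_def by (intro tendsto_intros)
    then have "\<forall>\<^sub>F n in sequentially. ?g x (fst (s n)) < ?g x (?p x) + e"
      using e by (intro order_tendstoD) auto
    then obtain n where "?g x (fst (s n)) < ?g x (?p x) + e"
      by (auto simp: eventually_sequentially)
    moreover obtain i where "from_nat_into D' i = s n"
      using from_nat_into_surj[OF D'(1) s(1)] by blast
    ultimately show "\<exists>n. ?g x (D n) < ?g x (?p x) + e"
      by (intro exI[of _ i]) (simp add: D_def)
  qed
  then show ?thesis
    using pZ by (intro measurable_restrict_space2) auto
qed

end

subsection \<open>The gap function and one step of the method\<close>

locale vi_setup = mirror_setup Z N \<omega> grad\<omega> \<mu> \<Omega>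
  for Z :: "'a::euclidean_space set" and N \<omega> grad\<omega> \<mu> \<Omega> +
  fixes G J :: "'a \<Rightarrow> real"
    and gradG H :: "'a \<Rightarrow> 'a"
    and L\<^sub>G L\<^sub>H :: real
  assumes G_diff: "has_gradient_on G gradG Z"
    and gradG_continuous: "continuous_on Z gradG"
    and L\<^sub>G_nonneg: "0 \<le> L\<^sub>G"
    and G_smooth: "\<And>v u. v \<in> Z \<Longrightarrow> u \<in> Z \<Longrightarrow>
          0 \<le> G u - G v - inner (gradG v) (u - v) \<and>
          G u - G v - inner (gradG v) (u - v) \<le> L\<^sub>G / 2 * (N (u - v))\<^sup>2"
    and L\<^sub>H_nonneg: "0 \<le> L\<^sub>H"
    and H_monotone: "\<And>v u. v \<in> Z \<Longrightarrow> u \<in> Z \<Longrightarrow> 0 \<le> inner (H u - H v) (u - v)"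
    and H_Lipschitz: "\<And>v u. v \<in> Z \<Longrightarrow> u \<in> Z \<Longrightarrow> dual_norm N (H u - H v) \<le> L\<^sub>H * N (u - v)"
    and J_convex: "convex_on Z J"
    and J_subgradient: "\<And>u. u \<in> Z \<Longrightarrow> subdifferential Z J u \<noteq> {}"
begin

abbreviation Q :: "'a \<Rightarrow> 'a \<Rightarrow> real" where
  "Q \<equiv> gap_Q G H J"

lemma continuous_on_G: "continuous_on Z G"
  using G_diff by (auto simp: has_gradient_on_def intro: has_derivative_continuous_on)

lemma continuous_on_H: "continuous_on Z H"
proof -
  obtain K where K: "0 < K" "\<And>\<eta>. norm \<eta> \<le> K * dual_norm N \<eta>"
    using norm_le_dual_norm[OF norm] by metis
  obtain C where C: "0 < C" "\<And>x. N x \<le> C * norm x"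
    using is_norm_le_norm[OF norm] by metis
  have "(K * (L\<^sub>H * C))-lipschitz_on Z H"
  proof (rule lipschitz_onI)
    fix x y assume "x \<in> Z" "y \<in> Z"
    then have "norm (H x - H y) \<le> K * (L\<^sub>H * N (x - y))"
      using K(1) by (intro order_trans[OF K(2)] mult_left_mono H_Lipschitz) auto
    also have "\<dots> \<le> K * (L\<^sub>H * (C * norm (x - y)))"
      using K(1) L\<^sub>H_nonneg by (intro mult_left_mono C) auto
    finally show "dist (H x) (H y) \<le> K * (L\<^sub>H * C) * dist x y"
      by (simp add: dist_norm mult.assoc)
  qed (use K C L\<^sub>H_nonneg in simp)
  then show ?thesis
    by (rule lipschitz_on_continuous_on)
qed

lemma gap_bdd_above: "bdd_above (Q v ` Z)"
proof -
  obtain z where z: "z \<in> Z" using Z_nonempty by blast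
  obtain s where s: "\<And>u. u \<in> Z \<Longrightarrow> J z + inner s (u - z) \<le> J u"
    using J_subgradient[OF z] by (auto simp: subdifferential_def)
  have "continuous_on Z (\<lambda>u. G v - G u + inner (H u) (v - u) + J v - (J z + inner s (u - z)))"
    by (intro continuous_intros continuous_on_G continuous_on_H)
  then obtain y where y: "\<And>u. u \<in> Z \<Longrightarrow> G v - G u + inner (H u) (v - u) + J v - (J z + inner s (u - z))
      \<le> G v - G y + inner (H y) (v - y) + J v - (J z + inner s (y - z))"
    using continuous_attains_sup[OF compact_Z Z_nonempty] by blast
  show ?thesis
  proof (rule bdd_aboveI2)
    fix u assume "u \<in> Z"
    from y[OF this] s[OF this]
    show "Q v u \<le> G v - G y + inner (H y) (v - y) + J v - (J z + inner s (y - z))"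
      by (simp add: gap_Q_def)
  qed
qed

lemma gap_upper: "u \<in> Z \<Longrightarrow> Q v u \<le> gap Z G H J v"
  unfolding gap_def by (intro cSUP_upper gap_bdd_above)

lemma gap_le_iff: "gap Z G H J v \<le> c \<longleftrightarrow> (\<forall>u\<in>Z. Q v u \<le> c)"
  unfolding gap_def by (intro cSUP_le_iff Z_nonempty gap_bdd_above)

lemma gap_nonneg: "v \<in> Z \<Longrightarrow> 0 \<le> gap Z G H J v"
  using gap_upper[of v v] by (simp add: gap_Q_def)

text \<open>
  The gap is lower semicontinuous because \<open>J\<close> is, thanks to its subgradients.
\<close>

lemma measurable_gap: "gap Z G H J \<in> borel_measurable (restrict_space borel Z)"
proof -
  have "closed {v \<in> Z. gap Z G H J v \<le> c}" for c
    unfolding closed_sequential_limits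
  proof (intro allI impI, elim conjE)
    fix x l assume x: "\<forall>n. x n \<in> {v \<in> Z. gap Z G H J v \<le> c}" and lim: "x \<longlonglongrightarrow> l"
    have xZ: "x n \<in> Z" for n using x by simp
    have l: "l \<in> Z"
      using Z_closed xZ lim by (auto simp: closed_sequential_limits)
    obtain s where s: "\<And>u. u \<in> Z \<Longrightarrow> J l + inner s (u - l) \<le> J u"
      using J_subgradient[OF l] by (auto simp: subdifferential_def)
    have "Q l u \<le> c" if u: "u \<in> Z" for u
    proof -
      have "G (x n) - G u + inner (H u) (x n - u) + (J l + inner s (x n - l)) - J u \<le> c" for n
        using s[OF xZ[of n]] gap_upper[OF u, of "x n"] x by (simp add: gap_Q_def) (smt (verit))
      moreover have "(\<lambda>n. G (x n)) \<longlonglongrightarrow> G l"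
        using xZ l by (intro continuous_on_tendsto_compose[OF continuous_on_G lim]) auto
      then have "(\<lambda>n. G (x n) - G u + inner (H u) (x n - u) + (J l + inner s (x n - l)) - J u)
          \<longlonglongrightarrow> G l - G u + inner (H u) (l - u) + (J l + inner s (l - l)) - J u"
        by (intro tendsto_intros lim)
      ultimately show ?thesis
        by (auto simp: gap_Q_def dest: LIMSEQ_le_const2)
    qed
    with l show "l \<in> {v \<in> Z. gap Z G H J v \<le> c}"
      by (simp add: gap_le_iff)
  qed
  then have "{v \<in> Z. gap Z G H J v \<le> c} \<in> sets (restrict_space borel Z)" for c
    using Z_closed by (subst sets_restrict_space_iff) (auto simp: borel_closed)
  then show ?thesis
    by (simp add: borel_measurable_iff_le space_restrict_space)
qed

end

text \<open>Young's inequality. At \<open>b = 0\<close> both quotients are 0, so it survives only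
  because \<open>s\<close> vanishes too; this is the noiseless case of the step sizes.\<close>

lemma mult_le_weighted_squares:
  fixes s q b t :: real
  assumes "0 \<le> b" "b = 0 \<Longrightarrow> s = 0" "0 < t"
  shows "s * q \<le> b / (2 * t) * q\<^sup>2 + t / (2 * b) * s\<^sup>2"
proof (cases "b = 0")
  case False
  then have "0 < b" using assms by simp
  have "0 \<le> (b * q - t * s)\<^sup>2 / (2 * b * t)"
    using \<open>0 < b\<close> assms(3) by simp
  also have "\<dots> = b / (2 * t) * q\<^sup>2 + t / (2 * b) * s\<^sup>2 - s * q"
    using \<open>0 < b\<close> assms(3) by (simp add: power2_eq_square field_simps)
  finally show ?thesis by simp
qed (use assms in simp)

context vi_setup
begin

text \<open>The step size is designed so that strong convexity of the two prox-steps supplies the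
  squared lengths of \<open>w - r\<close> and \<open>w - y\<close> with coefficient
  \<open>D / (2 * t)\<close>, where \<open>D\<close> is its denominator. The three summands of
  \<open>D\<close> pay for the curvature of \<open>G\<close>, the extrapolation error of
  \<open>H\<close> and the noise.\<close>

lemma amp_step:
  fixes t b :: real
  assumes t: "1 \<le> t" and b: "0 \<le> b"
    and \<alpha>: "\<alpha> = 2 / (t + 1)"
    and den: "0 < 4 * L\<^sub>G + 3 * L\<^sub>H * t + b"
    and \<gamma>: "\<gamma> = \<mu> * t / (4 * L\<^sub>G + 3 * L\<^sub>H * t + b)"
    and r: "r \<in> Z" and wag: "wag \<in> Z" and u: "u \<in> Z"
    and wmd: "wmd = (1 - \<alpha>) *\<^sub>R wag + \<alpha> *\<^sub>R r"
    and w: "is_arg_min (prox_objective \<omega> grad\<omega> J r \<gamma> (\<gamma> *\<^sub>R h1 + \<gamma> *\<^sub>R g)) (\<lambda>u. u \<in> Z) w"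
    and y: "is_arg_min (prox_objective \<omega> grad\<omega> J r \<gamma> (\<gamma> *\<^sub>R h2 + \<gamma> *\<^sub>R g)) (\<lambda>u. u \<in> Z) y"
    and wag': "wag' = (1 - \<alpha>) *\<^sub>R wag + \<alpha> *\<^sub>R w"
    and exact: "b = 0 \<Longrightarrow> dual_norm N (h1 - H r) = 0 \<and> dual_norm N (h2 - H w) = 0
      \<and> dual_norm N (g - gradG wmd) = 0"
  shows "t * (t + 1) / 2 * Q wag' u \<le> t * (t - 1) / 2 * Q wag u
    + t * ((V r u - V y u) / \<gamma>
      + t / (2 * b) * ((dual_norm N (h2 - H w) + dual_norm N (h1 - H r))\<^sup>2 + (dual_norm N (g - gradG wmd))\<^sup>2)
      - inner (g - gradG wmd) (r - u) - inner (h2 - H w) (w - u))"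
proof -
  define D where "D = 4 * L\<^sub>G + 3 * L\<^sub>H * t + b"
  define p where "p = N (w - r)"
  define q where "q = N (w - y)"
  define d1 where "d1 = dual_norm N (h1 - H r)"
  define d2 where "d2 = dual_norm N (h2 - H w)"
  define dG where "dG = dual_norm N (g - gradG wmd)"
  have \<gamma>_pos: "0 < \<gamma>" using den t \<mu>_pos by (simp add: \<gamma>)
  have \<alpha>01: "0 \<le> \<alpha>" "\<alpha> \<le> 1" using t by (auto simp: \<alpha>)
  have wZ: "w \<in> Z" and yZ: "y \<in> Z"
    using w y by (simp_all add: is_arg_min_def)
  have wmdZ: "wmd \<in> Z" and wag'Z: "wag' \<in> Z"
    using Z_convex wag r wZ \<alpha>01 unfolding wmd wag' by (auto intro!: convexD)
  \<comment> \<open>The displacement is \<alpha> times a displacement of the prox-step, so the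
    curvature error carries \<open>\<alpha>\<^sup>2\<close>; this is the source of the acceleration
    in the term with \<open>L\<^sub>G\<close>.\<close>
  have diff: "wag' - wmd = \<alpha> *\<^sub>R (w - r)"
    by (simp add: wmd wag' algebra_simps)
  have diff': "wag' - wmd = (1 - \<alpha>) *\<^sub>R (wag - wmd) + \<alpha> *\<^sub>R (w - wmd)"
    by (simp add: wag' algebra_simps)

  have "(N (wag' - wmd))\<^sup>2 = \<alpha>\<^sup>2 * p\<^sup>2"
    by (simp add: diff is_norm_scaleR[OF norm] power_mult_distrib p_def)
  then have "G wag' \<le> G wmd + inner (gradG wmd) (wag' - wmd) + L\<^sub>G / 2 * (\<alpha>\<^sup>2 * p\<^sup>2)"
    using G_smooth[OF wmdZ wag'Z] by simp
  moreover have "inner (gradG wmd) (wag' - wmd)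
      = (1 - \<alpha>) * inner (gradG wmd) (wag - wmd) + \<alpha> * inner (gradG wmd) (w - wmd)"
    by (simp add: diff' inner_add_right)
  \<comment> \<open>Convexity of \<open>G\<close> is used twice from the base point
    \<open>wmd\<close>: towards \<open>wag\<close> and towards \<open>u\<close>.\<close>
  moreover have "(1 - \<alpha>) * (G wmd + inner (gradG wmd) (wag - wmd)) \<le> (1 - \<alpha>) * G wag"
    using G_smooth[OF wmdZ wag] \<alpha>01 by (intro mult_left_mono) auto
  moreover have "\<alpha> * (G wmd + inner (gradG wmd) (w - wmd)) \<le> \<alpha> * (G u + inner (gradG wmd) (w - u))"
    using G_smooth[OF wmdZ u] \<alpha>01 by (intro mult_left_mono) (auto simp: inner_diff_right)
  ultimately have G_le: "G wag' \<le> (1 - \<alpha>) * G wag + \<alpha> * (G u + inner (gradG wmd) (w - u)) + L\<^sub>G / 2 * (\<alpha>\<^sup>2 * p\<^sup>2)"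
    by (simp add: algebra_simps)
  have J_le: "J wag' \<le> (1 - \<alpha>) * J wag + \<alpha> * J w"
    unfolding wag' using \<alpha>01 wag wZ J_convex by (intro convex_onD) auto
  \<comment> \<open>Monotonicity replaces \<open>H u\<close> from the gap function by
    \<open>H w\<close>, of which the oracle returns an estimate.\<close>
  have "\<alpha> * inner (H u) (w - u) \<le> \<alpha> * inner (H w) (w - u)"
    using H_monotone[OF u wZ] \<alpha>01 by (intro mult_left_mono) (auto simp: inner_diff_left)
  moreover have "inner (H u) (wag' - u) = (1 - \<alpha>) * inner (H u) (wag - u) + \<alpha> * inner (H u) (w - u)"
    by (simp add: wag' inner_add_right inner_diff_right algebra_simps)
  ultimately have H_le: "inner (H u) (wag' - u) \<le> (1 - \<alpha>) * inner (H u) (wag - u) + \<alpha> * inner (H w) (w - u)"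
    by simp
  have Q_le: "Q wag' u \<le> (1 - \<alpha>) * Q wag u
      + \<alpha> * (inner (gradG wmd) (w - u) + inner (H w) (w - u) + (J w - J u)) + L\<^sub>G / 2 * (\<alpha>\<^sup>2 * p\<^sup>2)"
    using G_le J_le H_le by (simp add: gap_Q_def algebra_simps)

  have "\<gamma> * (inner (h2 + g) (w - u) + (J w - J u))
      \<le> \<gamma> * ((V r u - V y u) / \<gamma> + inner (h2 - h1) (w - y) - D / (2 * t) * (p\<^sup>2 + q\<^sup>2))"
  proof -
    have "\<mu> / 2 = \<gamma> * (D / (2 * t))"
      using den t by (simp add: \<gamma> D_def[symmetric])
    then have "\<gamma> * (D / (2 * t) * (p\<^sup>2 + q\<^sup>2)) = \<mu> / 2 * p\<^sup>2 + \<mu> / 2 * q\<^sup>2"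
      by (metis distrib_left mult.assoc)
    moreover have "\<gamma> * ((V r u - V y u) / \<gamma>) = V r u - V y u"
      using \<gamma>_pos by simp
    moreover have "\<gamma> * (inner (h2 + g) (w - u) + (J w - J u))
        = inner (\<gamma> *\<^sub>R h2 + \<gamma> *\<^sub>R g) (w - u) + \<gamma> * (J w - J u)"
      by (simp add: inner_add_left algebra_simps)
    moreover have "inner (\<gamma> *\<^sub>R h2 + \<gamma> *\<^sub>R g - (\<gamma> *\<^sub>R h1 + \<gamma> *\<^sub>R g)) (w - y) = \<gamma> * inner (h2 - h1) (w - y)"
      by (simp add: inner_diff_left algebra_simps)
    ultimately show ?thesis
      using prox_pair[OF J_convex r \<gamma>_pos w y u]
      unfolding p_def[symmetric] q_def[symmetric] distrib_left right_diff_distrib by linarith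
  qed
  then have prox: "inner (h2 + g) (w - u) + (J w - J u)
      \<le> (V r u - V y u) / \<gamma> + inner (h2 - h1) (w - y) - D / (2 * t) * (p\<^sup>2 + q\<^sup>2)"
    using \<gamma>_pos by simp
  have "inner (h2 - h1) (w - y) \<le> (L\<^sub>H * p + (d2 + d1)) * q"
  proof -
    have "h2 - h1 = (H w - H r) + ((h2 - H w) + - (h1 - H r))" by simp
    then have "dual_norm N (h2 - h1) \<le> dual_norm N (H w - H r) + (d2 + d1)"
      using dual_norm_triangle[OF norm, of "H w - H r" "(h2 - H w) + - (h1 - H r)"]
        dual_norm_triangle[OF norm, of "h2 - H w" "- (h1 - H r)"]
      unfolding d1_def d2_def dual_norm_minus[OF norm] by simp
    also have "\<dots> \<le> L\<^sub>H * p + (d2 + d1)"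
      using H_Lipschitz[OF r wZ] by (simp add: p_def)
    finally have "dual_norm N (h2 - h1) * q \<le> (L\<^sub>H * p + (d2 + d1)) * q"
      by (rule mult_right_mono) (simp add: q_def is_norm_nonneg[OF norm])
    then show ?thesis
      using inner_le_dual_norm[OF norm, of "h2 - h1" "w - y"] by (simp add: q_def)
  qed
  \<comment> \<open>The change from \<open>w\<close> to \<open>r\<close>, which is independent of
    the sample behind \<open>g\<close>, costs \<open>dG * p\<close>.\<close>
  moreover have "- inner (g - gradG wmd) (w - u) \<le> - inner (g - gradG wmd) (r - u) + dG * p"
    using abs_inner_le_dual_norm[OF norm, of "g - gradG wmd" "w - r"]
    by (simp add: dG_def p_def inner_diff_right)
  \<comment> \<open>\<open>D / (2 * t)\<close> splits into \<open>2 * L\<^sub>G / t\<close>,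
    \<open>3 / 2 * L\<^sub>H\<close> and \<open>b / (2 * t)\<close>, one for each error. The first
    two have room to spare; the third is used up by Young's inequality.\<close>
  moreover have "(L\<^sub>H * p + (d2 + d1)) * q + dG * p - D / (2 * t) * (p\<^sup>2 + q\<^sup>2) + L\<^sub>G / 2 * (\<alpha> * p\<^sup>2)
      \<le> t / (2 * b) * ((d2 + d1)\<^sup>2 + dG\<^sup>2)"
  proof -
    have "(d2 + d1) * q \<le> b / (2 * t) * q\<^sup>2 + t / (2 * b) * (d2 + d1)\<^sup>2"
      "dG * p \<le> b / (2 * t) * p\<^sup>2 + t / (2 * b) * dG\<^sup>2"
      by (rule mult_le_weighted_squares; use t b exact in \<open>simp add: d1_def d2_def dG_def\<close>)+
    moreover have "p * q \<le> 3 / 2 * p\<^sup>2 + 3 / 2 * q\<^sup>2"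
      using sum_squares_bound[of p q] zero_le_power2[of p] zero_le_power2[of q] by argo
    then have "L\<^sub>H * (p * q) \<le> L\<^sub>H * (3 / 2 * p\<^sup>2 + 3 / 2 * q\<^sup>2)"
      by (rule mult_left_mono[OF _ L\<^sub>H_nonneg])
    moreover have "L\<^sub>G / 2 * \<alpha> \<le> 2 * L\<^sub>G / t"
      using t L\<^sub>G_nonneg by (simp add: \<alpha> field_simps mult_left_mono)
    then have "L\<^sub>G / 2 * (\<alpha> * p\<^sup>2) \<le> 2 * (L\<^sub>G / t * p\<^sup>2)"
      using mult_right_mono[of "L\<^sub>G / 2 * \<alpha>" "2 * L\<^sub>G / t" "p\<^sup>2"] by (simp add: mult.assoc)
    moreover have "0 \<le> L\<^sub>G / t * q\<^sup>2"
      using t L\<^sub>G_nonneg by simp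
    moreover have "D / (2 * t) = 2 * (L\<^sub>G / t) + 3 / 2 * L\<^sub>H + b / (2 * t)"
      using t by (simp add: D_def field_simps)
    then have "D / (2 * t) * (p\<^sup>2 + q\<^sup>2) = 2 * (L\<^sub>G / t * p\<^sup>2) + 2 * (L\<^sub>G / t * q\<^sup>2)
        + L\<^sub>H * (3 / 2 * p\<^sup>2 + 3 / 2 * q\<^sup>2) + b / (2 * t) * p\<^sup>2 + b / (2 * t) * q\<^sup>2"
      by (simp add: algebra_simps)
    moreover have "(L\<^sub>H * p + (d2 + d1)) * q = L\<^sub>H * (p * q) + (d2 + d1) * q"
      "t / (2 * b) * ((d2 + d1)\<^sup>2 + dG\<^sup>2) = t / (2 * b) * (d2 + d1)\<^sup>2 + t / (2 * b) * dG\<^sup>2"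
      by (simp_all add: distrib_left distrib_right mult.assoc)
    ultimately show ?thesis
      by linarith
  qed
  moreover have "inner (gradG wmd) (w - u) + inner (H w) (w - u)
      = inner (h2 + g) (w - u) - inner (g - gradG wmd) (w - u) - inner (h2 - H w) (w - u)"
    by (simp add: inner_diff_left inner_add_left)
  ultimately have "inner (gradG wmd) (w - u) + inner (H w) (w - u) + (J w - J u) + L\<^sub>G / 2 * (\<alpha> * p\<^sup>2)
      \<le> (V r u - V y u) / \<gamma> + t / (2 * b) * ((d2 + d1)\<^sup>2 + dG\<^sup>2)
        - inner (g - gradG wmd) (r - u) - inner (h2 - H w) (w - u)" (is "?lhs \<le> ?rhs")
    using prox by linarith
  then have "\<alpha> * ?lhs \<le> \<alpha> * ?rhs"
    using \<alpha>01 by (intro mult_left_mono)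
  with Q_le have "Q wag' u \<le> (1 - \<alpha>) * Q wag u + \<alpha> * ?rhs"
    by (simp add: algebra_simps power2_eq_square)
  then have "t * (t + 1) / 2 * Q wag' u \<le> t * (t + 1) / 2 * ((1 - \<alpha>) * Q wag u + \<alpha> * ?rhs)"
    using t by (intro mult_left_mono) auto
  also have "\<dots> = (t * (t + 1) / 2 * (1 - \<alpha>)) * Q wag u + (t * (t + 1) / 2 * \<alpha>) * ?rhs"
    by (simp only: distrib_left mult.assoc)
  also have "t * (t + 1) / 2 * (1 - \<alpha>) = t * (t - 1) / 2"
    using t by (simp add: \<alpha> field_simps)
  also have "t * (t + 1) / 2 * \<alpha> = t"
    using t by (simp add: \<alpha> field_simps)
  finally show ?thesis
    unfolding d1_def d2_def dG_def .
qed

end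

subsection \<open>Exponential moments\<close>

text \<open>For a centred variable the linear term integrates to zero and leaves an exponential
  moment of the square. The coefficient 1 of \<open>x\<^sup>2\<close> fixes the variance proxy,
  hence the 4 in the Gaussian tail.\<close>

lemma exp_le_add_exp_square: "exp x \<le> x + exp (x\<^sup>2)" for x :: real
proof -
  consider "1 \<le> x" | "0 \<le> x" "x \<le> 1" | "x \<le> 0" by linarith
  then show ?thesis
  proof cases
    case 1
    then have "exp x \<le> exp (x\<^sup>2)"
      by (simp add: power2_eq_square mult_le_cancel_left1)
    with 1 show ?thesis by linarith
  next
    case 2
    then show ?thesis
      using exp_bound[of x] exp_ge_add_one_self[of "x\<^sup>2"] by linarith
  next
    case 3
    have "exp x * (1 - x) \<le> exp x * exp (- x)"
      using exp_ge_add_one_self[of "- x"] by (intro mult_left_mono) auto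
    also have "\<dots> = 1"
      by (simp add: exp_minus)
    also have "1 \<le> (1 + x + x\<^sup>2) * (1 - x)"
      using 3 zero_le_power2[of x] mult_nonpos_nonneg[of x "x\<^sup>2"]
      by (simp add: algebra_simps power2_eq_square)
    finally have "exp x \<le> 1 + x + x\<^sup>2"
      using 3 by simp
    then show ?thesis
      using exp_ge_add_one_self[of "x\<^sup>2"] by linarith
  qed
qed

text \<open>After splitting off \<open>exp p\<close>, the exponential is taken on the segment from 0
  to \<open>q - 1\<close> and lies below its chord. If \<open>exp q\<close> has mean at most
  \<open>exp 1\<close>, integrating the chord shows that \<open>exp (p * q)\<close> has mean at most
  \<open>exp p\<close>.\<close>

lemma exp_mult_le_chord:
  fixes p q :: real
  assumes "0 \<le> p" "p \<le> 1"
  shows "exp (p * q) \<le> exp p * ((1 - p) + p * exp (q - 1))"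
proof -
  have "exp (p * q) = exp p * exp ((1 - p) *\<^sub>R 0 + p *\<^sub>R (q - 1))"
    by (simp add: algebra_simps flip: exp_add)
  also have "\<dots> \<le> exp p * ((1 - p) * exp 0 + p * exp (q - 1))"
    using assms by (intro mult_left_mono convex_onD[OF exp_convex]) auto
  finally show ?thesis by simp
qed

context prob_space
begin

text \<open>The chord bound with exponent \<open>c\<^sup>2\<close> works only for
  \<open>c\<^sup>2 \<le> 1\<close>. Beyond that, centring can be forgotten: Young's inequality alone
  is good enough, as \<open>exp (c\<^sup>2)\<close> then leaves room.\<close>

lemma exp_moment_subgaussian:
  fixes X q :: "'a \<Rightarrow> real"
  assumes X: "integrable M X" "expectation X = 0"
    and q: "integrable M (\<lambda>\<theta>. exp (q \<theta>))" "expectation (\<lambda>\<theta>. exp (q \<theta>)) \<le> exp 1"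
    and X_le: "AE \<theta> in M. (X \<theta>)\<^sup>2 \<le> c\<^sup>2 * q \<theta>"
  shows "(\<integral>\<^sup>+\<theta>. ennreal (exp (X \<theta>)) \<partial>M) \<le> ennreal (exp (c\<^sup>2))"
proof -
  have chord: "integrable M (\<lambda>\<theta>. exp p * ((1 - p) + p * exp (q \<theta> - 1)))"
    "expectation (\<lambda>\<theta>. exp p * ((1 - p) + p * exp (q \<theta> - 1))) \<le> exp p" if "0 \<le> p" for p
  proof -
    have "integrable M (\<lambda>\<theta>. exp (q \<theta> - 1))" "expectation (\<lambda>\<theta>. exp (q \<theta> - 1)) \<le> 1"
      using q by (simp_all add: exp_diff)
    then show "integrable M (\<lambda>\<theta>. exp p * ((1 - p) + p * exp (q \<theta> - 1)))"
      "expectation (\<lambda>\<theta>. exp p * ((1 - p) + p * exp (q \<theta> - 1))) \<le> exp p"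
      using mult_left_mono[of "expectation (\<lambda>\<theta>. exp (q \<theta> - 1))" 1 p] that
      by (auto simp: prob_space)
  qed
  have bound: "(\<integral>\<^sup>+\<theta>. ennreal (exp (X \<theta>)) \<partial>M) \<le> ennreal (exp (c\<^sup>2))"
    if g: "integrable M g" "expectation g \<le> exp (c\<^sup>2)" and le: "AE \<theta> in M. exp (X \<theta>) \<le> g \<theta>" for g
  proof -
    have "(\<integral>\<^sup>+\<theta>. ennreal (exp (X \<theta>)) \<partial>M) \<le> (\<integral>\<^sup>+\<theta>. ennreal (g \<theta>) \<partial>M)"
      using le by (intro nn_integral_mono_AE) (auto elim!: eventually_mono intro: ennreal_leI)
    also have "\<dots> = ennreal (expectation g)"
      using le by (intro nn_integral_eq_integral g) (auto elim!: eventually_mono intro: order_trans[OF exp_ge_zero])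
    also have "\<dots> \<le> ennreal (exp (c\<^sup>2))"
      by (intro ennreal_leI g)
    finally show ?thesis .
  qed
  show ?thesis
  proof (cases "c\<^sup>2 \<le> 1")
    case True
    show ?thesis
    proof (rule bound)
      let ?g = "\<lambda>\<theta>. exp (c\<^sup>2) * ((1 - c\<^sup>2) + c\<^sup>2 * exp (q \<theta> - 1))"
      show "integrable M (\<lambda>\<theta>. X \<theta> + ?g \<theta>)"
        by (intro Bochner_Integration.integrable_add X chord) simp
      have "expectation (\<lambda>\<theta>. X \<theta> + ?g \<theta>) = expectation X + expectation ?g"
        by (intro Bochner_Integration.integral_add X chord) simp
      with X(2) chord(2)[of "c\<^sup>2"] show "expectation (\<lambda>\<theta>. X \<theta> + ?g \<theta>) \<le> exp (c\<^sup>2)"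
        by simp
      show "AE \<theta> in M. exp (X \<theta>) \<le> X \<theta> + ?g \<theta>"
        using X_le
      proof eventually_elim
        case (elim \<theta>)
        have "exp (X \<theta>) \<le> X \<theta> + exp ((X \<theta>)\<^sup>2)" by (rule exp_le_add_exp_square)
        also have "exp ((X \<theta>)\<^sup>2) \<le> exp (c\<^sup>2 * q \<theta>)" using elim by simp
        also have "\<dots> \<le> ?g \<theta>" using True by (intro exp_mult_le_chord) auto
        finally show ?case by simp
      qed
    qed
  next
    case False
    show ?thesis
    proof (rule bound)
      \<comment> \<open>From \<open>X \<theta> \<le> c\<^sup>2 / 2 + 1 / 2 * q \<theta>\<close> and
        the chord at \<open>p = 1 / 2\<close>. The mean is at most
        \<open>exp (c\<^sup>2 / 2 + 1 / 2)\<close>, and \<open>1 / 2 \<le> c\<^sup>2 / 2\<close> in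
        this case.\<close>
      let ?g = "\<lambda>\<theta>. exp (c\<^sup>2 / 2) * (exp (1 / 2) * ((1 - 1 / 2) + 1 / 2 * exp (q \<theta> - 1)))"
      show "integrable M ?g"
        by (intro integrable_mult_right chord) simp
      have "expectation ?g \<le> exp (c\<^sup>2 / 2) * exp (1 / 2)"
        unfolding integral_mult_right_zero[of M "exp (c\<^sup>2 / 2)"] by (intro mult_left_mono chord) auto
      also have "\<dots> \<le> exp (c\<^sup>2)"
        using False by (simp flip: exp_add)
      finally show "expectation ?g \<le> exp (c\<^sup>2)" .
      show "AE \<theta> in M. exp (X \<theta>) \<le> ?g \<theta>"
        using X_le
      proof eventually_elim
        case (elim \<theta>)
        have "0 < c\<^sup>2" using False by linarith
        have "X \<theta> \<le> c\<^sup>2 / 2 + 1 / 2 * q \<theta>"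
        proof -
          have "0 \<le> (X \<theta> - c\<^sup>2)\<^sup>2" by simp
          then have "2 * c\<^sup>2 * X \<theta> \<le> c\<^sup>2 * c\<^sup>2 + c\<^sup>2 * q \<theta>"
            using elim by (simp add: power2_diff) (simp add: power2_eq_square algebra_simps)
          then have "c\<^sup>2 * (2 * X \<theta>) \<le> c\<^sup>2 * (c\<^sup>2 + q \<theta>)"
            by (simp add: algebra_simps)
          then show ?thesis
            using \<open>0 < c\<^sup>2\<close> by simp
        qed
        then have "exp (X \<theta>) \<le> exp (c\<^sup>2 / 2) * exp (1 / 2 * q \<theta>)"
          by (simp flip: exp_add)
        also have "\<dots> \<le> ?g \<theta>"
          by (intro mult_left_mono exp_mult_le_chord) auto
        finally show ?case .
      qed
    qed
  qed
qed

text \<open>Jensen's inequality for the normalised weights. The summands may depend on each other in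
  any way, as the squared errors of different calls do.\<close>

lemma exp_moment_weighted_sum:
  fixes q :: "'i \<Rightarrow> 'a \<Rightarrow> real" and c :: "'i \<Rightarrow> real"
  assumes I: "finite I" and c: "\<And>i. i \<in> I \<Longrightarrow> 0 \<le> c i" and W: "0 < (\<Sum>i\<in>I. c i)"
    and q [measurable]: "\<And>i. i \<in> I \<Longrightarrow> q i \<in> borel_measurable M"
    and le: "\<And>i. i \<in> I \<Longrightarrow> (\<integral>\<^sup>+\<theta>. ennreal (exp (q i \<theta>)) \<partial>M) \<le> ennreal (exp 1)"
  shows "(\<integral>\<^sup>+\<theta>. ennreal (exp ((\<Sum>i\<in>I. c i * q i \<theta>) / (\<Sum>i\<in>I. c i))) \<partial>M) \<le> ennreal (exp 1)"
proof -
  let ?W = "\<Sum>i\<in>I. c i"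
  have pointwise: "exp ((\<Sum>i\<in>I. c i * q i \<theta>) / ?W) \<le> (\<Sum>i\<in>I. c i / ?W * exp (q i \<theta>))" for \<theta>
  proof -
    have "(\<Sum>i\<in>I. c i * q i \<theta>) / ?W = (\<Sum>i\<in>I. (c i / ?W) *\<^sub>R q i \<theta>)"
      by (simp add: sum_divide_distrib)
    moreover have "exp (\<Sum>i\<in>I. (c i / ?W) *\<^sub>R q i \<theta>) \<le> (\<Sum>i\<in>I. c i / ?W * exp (q i \<theta>))"
      using I W c by (intro convex_on_sum[OF _ _ exp_convex]) (auto simp: sum_divide_distrib[symmetric])
    ultimately show ?thesis by simp
  qed
  have sum_weights: "(\<Sum>i\<in>I. ennreal (c i / ?W) * ennreal (y i)) = ennreal (\<Sum>i\<in>I. c i / ?W * y i)"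
    if y: "\<And>i. 0 \<le> y i" for y :: "'i \<Rightarrow> real"
  proof -
    have "(\<Sum>i\<in>I. ennreal (c i / ?W) * ennreal (y i)) = (\<Sum>i\<in>I. ennreal (c i / ?W * y i))"
      using c W y by (intro sum.cong refl ennreal_mult[symmetric]) auto
    also have "\<dots> = ennreal (\<Sum>i\<in>I. c i / ?W * y i)"
      using c W y by (intro sum_ennreal mult_nonneg_nonneg) auto
    finally show ?thesis .
  qed
  have "(\<integral>\<^sup>+\<theta>. ennreal (exp ((\<Sum>i\<in>I. c i * q i \<theta>) / ?W)) \<partial>M)
      \<le> (\<integral>\<^sup>+\<theta>. (\<Sum>i\<in>I. ennreal (c i / ?W) * ennreal (exp (q i \<theta>))) \<partial>M)"
  proof (rule nn_integral_mono)
    fix \<theta>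
    have "(\<Sum>i\<in>I. ennreal (c i / ?W) * ennreal (exp (q i \<theta>))) = ennreal (\<Sum>i\<in>I. c i / ?W * exp (q i \<theta>))"
      by (rule sum_weights) simp
    with pointwise[of \<theta>] show "ennreal (exp ((\<Sum>i\<in>I. c i * q i \<theta>) / ?W))
        \<le> (\<Sum>i\<in>I. ennreal (c i / ?W) * ennreal (exp (q i \<theta>)))"
      by (simp add: ennreal_leI)
  qed
  also have "\<dots> = (\<Sum>i\<in>I. ennreal (c i / ?W) * (\<integral>\<^sup>+\<theta>. ennreal (exp (q i \<theta>)) \<partial>M))"
    by (subst nn_integral_sum) (auto intro!: sum.cong nn_integral_cmult)
  also have "\<dots> \<le> (\<Sum>i\<in>I. ennreal (c i / ?W) * ennreal (exp 1))"
    by (intro sum_mono mult_left_mono le) auto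
  also have "\<dots> = ennreal (\<Sum>i\<in>I. c i / ?W * exp 1)"
    by (rule sum_weights) simp
  also have "(\<Sum>i\<in>I. c i / ?W * exp 1) = exp 1"
    using W by (subst sum_distrib_right[symmetric], subst sum_divide_distrib[symmetric]) simp
  finally show ?thesis .
qed

lemma prob_greater_le_exp_moment:
  fixes X :: "'a \<Rightarrow> real"
  assumes [measurable]: "X \<in> borel_measurable M"
    and le: "(\<integral>\<^sup>+\<theta>. ennreal (exp (X \<theta>)) \<partial>M) \<le> ennreal (exp b)"
  shows "prob {\<theta> \<in> space M. a < X \<theta>} \<le> exp (b - a)"
proof -
  have "emeasure M {\<theta> \<in> space M. a < X \<theta>}
      \<le> emeasure M {\<theta> \<in> space M. 1 \<le> ennreal (exp (- a)) * ennreal (exp (X \<theta>))}"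
    by (intro emeasure_mono) (auto simp: ennreal_mult[symmetric] simp flip: exp_add)
  also have "\<dots> \<le> ennreal (exp (- a)) * (\<integral>\<^sup>+\<theta>. ennreal (exp (X \<theta>)) * indicator (space M) \<theta> \<partial>M)"
    by (rule nn_integral_Markov_inequality) auto
  also have "(\<integral>\<^sup>+\<theta>. ennreal (exp (X \<theta>)) * indicator (space M) \<theta> \<partial>M) = (\<integral>\<^sup>+\<theta>. ennreal (exp (X \<theta>)) \<partial>M)"
    by (intro nn_integral_cong) simp
  also have "ennreal (exp (- a)) * \<dots> \<le> ennreal (exp (- a)) * ennreal (exp b)"
    by (intro mult_left_mono le) simp
  also have "\<dots> = ennreal (exp (b - a))"
    by (simp add: ennreal_mult[symmetric] exp_add[symmetric])
  finally show ?thesis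
    by (simp add: emeasure_eq_measure)
qed

text \<open>
  The optimal multiplier for a variance proxy \<open>R\<^sup>2\<close> is \<open>l = x / (2 * R)\<close>.
\<close>

lemma prob_greater_subgaussian:
  fixes X :: "'a \<Rightarrow> real"
  assumes [measurable]: "X \<in> borel_measurable M" and R: "0 < R"
    and le: "\<And>l. (\<integral>\<^sup>+\<theta>. ennreal (exp (l * X \<theta>)) \<partial>M) \<le> ennreal (exp (l\<^sup>2 * R\<^sup>2))"
    and x: "0 < x"
  shows "prob {\<theta> \<in> space M. x * R < X \<theta>} \<le> exp (- x\<^sup>2 / 4)"
proof -
  define l where "l = x / (2 * R)"
  have l: "0 < l" using R x by (simp add: l_def)
  have "prob {\<theta> \<in> space M. x * R < X \<theta>} = prob {\<theta> \<in> space M. l * (x * R) < l * X \<theta>}"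
    using l by simp
  also have "\<dots> \<le> exp (l\<^sup>2 * R\<^sup>2 - l * (x * R))"
    by (intro prob_greater_le_exp_moment le) simp
  also have "l\<^sup>2 * R\<^sup>2 - l * (x * R) = - x\<^sup>2 / 4"
    using R by (simp add: l_def power2_eq_square field_simps)
  finally show ?thesis .
qed

end

subsection \<open>Oracle calls at points independent of the sample\<close>

text \<open>
  \<open>F\<close> is the information available before the call. As it is independent of the sample \<open>Y\<close>, an
  \<open>F\<close>-measurable query point may be frozen while integrating over the sample.
\<close>

locale fresh_sample = prob_space M
  for M :: "'w measure" +
  fixes F :: "'w measure" and S :: "'s measure" and Y :: "'w \<Rightarrow> 's"
  assumes space_F: "space F = space M" and sets_F: "sets F \<subseteq> sets M"
    and Y_measurable [measurable]: "Y \<in> measurable M S"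
    and indep: "indep_set (sets F) {Y -` A \<inter> space M | A. A \<in> sets S}"
begin

lemma measurable_F: "f \<in> measurable F A \<Longrightarrow> f \<in> measurable M A"
  using space_F sets_F by (auto simp: measurable_def)

lemma measurable_id_F [measurable]: "(\<lambda>\<theta>. \<theta>) \<in> measurable M F"
  by (intro measurable_F measurable_ident_sets refl)

text \<open>The identity from \<open>M\<close> to \<open>F\<close>, taken as a random element,
  encodes the whole information at once. Independence becomes a product law, and Fubini's theorem
  replaces conditional expectations.\<close>

lemma distr_pair: "distr M F (\<lambda>\<theta>. \<theta>) \<Otimes>\<^sub>M distr M S Y = distr M (F \<Otimes>\<^sub>M S) (\<lambda>\<theta>. (\<theta>, Y \<theta>))"
proof -
  interpret Y: prob_space "distr M S Y"
    by (rule prob_space_distr) measurable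
  interpret F: prob_space "distr M F (\<lambda>\<theta>. \<theta>)"
    by (rule prob_space_distr) measurable
  show ?thesis
  proof (rule pair_measure_eqI)
    fix A B assume "A \<in> sets (distr M F (\<lambda>\<theta>. \<theta>))" "B \<in> sets (distr M S Y)"
    then have [measurable]: "A \<in> sets F" "B \<in> sets S" by auto
    have A: "A \<subseteq> space M"
      using sets.sets_into_space[of A F] space_F by simp
    have "prob A * prob (Y -` B \<inter> space M) = prob (A \<inter> (Y -` B \<inter> space M))"
      by (rule indep_setD[OF indep, symmetric]) auto
    moreover have "(\<lambda>\<theta>. (\<theta>, Y \<theta>)) -` (A \<times> B) \<inter> space M = A \<inter> (Y -` B \<inter> space M)"
      "(\<lambda>\<theta>. \<theta>) -` A \<inter> space M = A"
      using A by auto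
    ultimately show "emeasure (distr M F (\<lambda>\<theta>. \<theta>)) A * emeasure (distr M S Y) B
        = emeasure (distr M (F \<Otimes>\<^sub>M S) (\<lambda>\<theta>. (\<theta>, Y \<theta>))) (A \<times> B)"
      by (simp add: emeasure_distr emeasure_eq_measure ennreal_mult[symmetric])
  qed (unfold_locales, simp)
qed

lemma nn_integral_freeze:
  assumes h: "h \<in> borel_measurable (F \<Otimes>\<^sub>M S)"
  shows "(\<integral>\<^sup>+\<theta>. h (\<theta>, Y \<theta>) \<partial>M) = (\<integral>\<^sup>+\<theta>. \<integral>\<^sup>+\<theta>'. h (\<theta>, Y \<theta>') \<partial>M \<partial>M)"
proof -
  note [measurable] = h
  interpret Y: prob_space "distr M S Y"
    by (rule prob_space_distr) measurable
  have "(\<integral>\<^sup>+\<theta>. h (\<theta>, Y \<theta>) \<partial>M) = (\<integral>\<^sup>+x. h x \<partial>distr M (F \<Otimes>\<^sub>M S) (\<lambda>\<theta>. (\<theta>, Y \<theta>)))"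
    by (subst nn_integral_distr) auto
  also have "\<dots> = (\<integral>\<^sup>+x. h x \<partial>(distr M F (\<lambda>\<theta>. \<theta>) \<Otimes>\<^sub>M distr M S Y))"
    by (simp add: distr_pair)
  also have "\<dots> = (\<integral>\<^sup>+\<theta>. \<integral>\<^sup>+y. h (\<theta>, y) \<partial>distr M S Y \<partial>distr M F (\<lambda>\<theta>. \<theta>))"
    by (subst Y.nn_integral_fst) auto
  also have "\<dots> = (\<integral>\<^sup>+\<theta>. \<integral>\<^sup>+y. h (\<theta>, y) \<partial>distr M S Y \<partial>M)"
    by (subst nn_integral_distr) auto
  also have "\<dots> = (\<integral>\<^sup>+\<theta>. \<integral>\<^sup>+\<theta>'. h (\<theta>, Y \<theta>') \<partial>M \<partial>M)"
    by (intro nn_integral_cong nn_integral_distr) (auto simp: space_F)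
  finally show ?thesis .
qed

text \<open>The tower property as an inequality: \<open>\<psi>\<close> collects what is known before
  the call and passes through the inner integral. Iterated, it bounds the moment generating function
  of a martingale.\<close>

lemma nn_integral_freeze_le:
  assumes h: "h \<in> borel_measurable (F \<Otimes>\<^sub>M S)" and \<psi>: "\<psi> \<in> borel_measurable F"
    and le: "\<And>\<theta>. \<theta> \<in> space M \<Longrightarrow> (\<integral>\<^sup>+\<theta>'. h (\<theta>, Y \<theta>') \<partial>M) \<le> c"
  shows "(\<integral>\<^sup>+\<theta>. \<psi> \<theta> * h (\<theta>, Y \<theta>) \<partial>M) \<le> c * (\<integral>\<^sup>+\<theta>. \<psi> \<theta> \<partial>M)"
proof -
  note [measurable] = h \<psi> measurable_F[OF \<psi>]
  have "(\<integral>\<^sup>+\<theta>. \<psi> \<theta> * h (\<theta>, Y \<theta>) \<partial>M) = (\<integral>\<^sup>+\<theta>. \<integral>\<^sup>+\<theta>'. \<psi> \<theta> * h (\<theta>, Y \<theta>') \<partial>M \<partial>M)"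
    using nn_integral_freeze[of "\<lambda>x. \<psi> (fst x) * h x"] by simp
  also have "\<dots> \<le> (\<integral>\<^sup>+\<theta>. c * \<psi> \<theta> \<partial>M)"
  proof (rule nn_integral_mono)
    fix \<theta> assume \<theta>: "\<theta> \<in> space M"
    then have "(\<lambda>\<theta>'. (\<theta>, Y \<theta>')) \<in> measurable M (F \<Otimes>\<^sub>M S)"
      by (intro measurable_Pair measurable_const) (auto simp: space_F)
    then have "(\<lambda>\<theta>'. h (\<theta>, Y \<theta>')) \<in> borel_measurable M"
      using h by (rule measurable_compose)
    then have "(\<integral>\<^sup>+\<theta>'. \<psi> \<theta> * h (\<theta>, Y \<theta>') \<partial>M) = \<psi> \<theta> * (\<integral>\<^sup>+\<theta>'. h (\<theta>, Y \<theta>') \<partial>M)"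
      by (rule nn_integral_cmult)
    also have "\<dots> \<le> \<psi> \<theta> * c"
      by (intro mult_left_mono le \<theta>) simp
    finally show "(\<integral>\<^sup>+\<theta>'. \<psi> \<theta> * h (\<theta>, Y \<theta>') \<partial>M) \<le> c * \<psi> \<theta>"
      by (simp add: mult.commute)
  qed
  also have "\<dots> = c * (\<integral>\<^sup>+\<theta>. \<psi> \<theta> \<partial>M)"
    by (rule nn_integral_cmult) simp
  finally show ?thesis .
qed

lemma integral_freeze_zero:
  fixes h :: "'w \<times> 's \<Rightarrow> real"
  assumes h: "h \<in> borel_measurable (F \<Otimes>\<^sub>M S)" and int: "integrable M (\<lambda>\<theta>. h (\<theta>, Y \<theta>))"
    and zero: "\<And>\<theta>. \<theta> \<in> space M \<Longrightarrow> (\<integral>\<theta>'. h (\<theta>, Y \<theta>') \<partial>M) = 0"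
  shows "(\<integral>\<theta>. h (\<theta>, Y \<theta>) \<partial>M) = 0"
proof -
  note [measurable] = h
  interpret Y: prob_space "distr M S Y"
    by (rule prob_space_distr) measurable
  interpret F: prob_space "distr M F (\<lambda>\<theta>. \<theta>)"
    by (rule prob_space_distr) measurable
  interpret pair_sigma_finite "distr M F (\<lambda>\<theta>. \<theta>)" "distr M S Y" ..
  have int': "integrable (distr M F (\<lambda>\<theta>. \<theta>) \<Otimes>\<^sub>M distr M S Y) h"
    unfolding distr_pair using int by (subst integrable_distr_eq) auto
  have "(\<integral>\<theta>. h (\<theta>, Y \<theta>) \<partial>M) = (\<integral>x. h x \<partial>(distr M F (\<lambda>\<theta>. \<theta>) \<Otimes>\<^sub>M distr M S Y))"
    unfolding distr_pair by (subst integral_distr) auto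
  also have "\<dots> = (\<integral>\<theta>. \<integral>y. h (\<theta>, y) \<partial>distr M S Y \<partial>distr M F (\<lambda>\<theta>. \<theta>))"
    by (rule integral_fst'[OF int', symmetric])
  also have "\<dots> = (\<integral>\<theta>. 0 \<partial>distr M F (\<lambda>\<theta>. \<theta>))"
  proof (intro Bochner_Integration.integral_cong refl)
    fix \<theta> assume "\<theta> \<in> space (distr M F (\<lambda>\<theta>. \<theta>))"
    then have "\<theta> \<in> space M" "\<theta> \<in> space F"
      by (auto simp: space_F)
    then show "(\<integral>y. h (\<theta>, y) \<partial>distr M S Y) = 0"
      by (subst integral_distr) (auto simp: zero)
  qed
  finally show ?thesis by simp
qed

end

text \<open>From \<open>y \<le> exp (y - 1)\<close>, applied to the squared error over
  \<open>\<sigma>\<^sup>2\<close>; for \<open>\<sigma> = 0\<close> the oracle is almost surely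
  exact. Thus both halves of the result can share one setting with bounded variance.\<close>

lemma light_tail_imp_bounded_variance:
  fixes N :: "'a::euclidean_space \<Rightarrow> real"
  assumes "prob_space M" and norm: "is_norm N" and unbiased: "unbiased_oracle M S Z \<xi> F f"
    and tail: "light_tail M N Z \<xi> F f \<sigma>"
  shows "bounded_variance M N Z \<xi> F f \<sigma>"
  unfolding bounded_variance_def
proof (intro ballI allI impI)
  interpret prob_space M by fact
  fix x and i :: nat assume x: "x \<in> Z" and i: "1 \<le> i"
  let ?e = "\<lambda>\<theta>. dual_norm N (F x (\<xi> i \<theta>) - f x)"
  have "(\<lambda>\<theta>. F x (\<xi> i \<theta>)) \<in> borel_measurable M"
    using unbiased x i by (auto simp: unbiased_oracle_def has_bochner_integral_iff intro!: borel_measurable_integrable)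
  then have meas [measurable]: "?e \<in> borel_measurable M"
    by (intro measurable_compose[OF _ measurable_dual_norm[OF norm]]) simp
  show "integrable M (\<lambda>\<theta>. (?e \<theta>)\<^sup>2) \<and> expectation (\<lambda>\<theta>. (?e \<theta>)\<^sup>2) \<le> \<sigma>\<^sup>2"
  proof (cases "\<sigma> = 0")
    case True
    then have "AE \<theta> in M. F x (\<xi> i \<theta>) = f x"
      using tail x i by (simp add: light_tail_def)
    then have "AE \<theta> in M. (?e \<theta>)\<^sup>2 = 0"
      by eventually_elim (simp add: dual_norm_zero[OF norm])
    then show ?thesis
      using integrable_cong_AE[of "\<lambda>\<theta>. (?e \<theta>)\<^sup>2" M "\<lambda>_. 0"] integral_cong_AE[of "\<lambda>\<theta>. (?e \<theta>)\<^sup>2" M "\<lambda>_. 0"]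
      by simp
  next
    case False
    let ?q = "\<lambda>\<theta>. (?e \<theta>)\<^sup>2 / \<sigma>\<^sup>2"
    have q: "integrable M (\<lambda>\<theta>. exp (?q \<theta>))" "expectation (\<lambda>\<theta>. exp (?q \<theta>)) \<le> exp 1"
      using tail x i False by (auto simp: light_tail_def dual_norm_minus_commute[OF norm, of "f x"])
    have le: "?q \<theta> \<le> exp (?q \<theta> - 1)" for \<theta>
      using exp_ge_add_one_self[of "?q \<theta> - 1"] by simp
    have int: "integrable M (\<lambda>\<theta>. exp (?q \<theta> - 1))" and "expectation (\<lambda>\<theta>. exp (?q \<theta> - 1)) \<le> 1"
      using q by (simp_all add: exp_diff)
    have int_q: "integrable M ?q"
      by (rule Bochner_Integration.integrable_bound[OF int]) (auto intro!: AE_I2 le)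
    have "expectation ?q \<le> 1"
      using integral_mono[OF int_q int le] \<open>expectation (\<lambda>\<theta>. exp (?q \<theta> - 1)) \<le> 1\<close> by simp
    moreover have "integrable M (\<lambda>\<theta>. \<sigma>\<^sup>2 * ?q \<theta>)"
      by (intro integrable_mult_right int_q)
    ultimately show ?thesis
      using False by (simp add: field_simps)
  qed
qed

section \<open>Noise of an oracle call at a predictable query point\<close>

locale oracle_call = fresh_sample M F S Y
  for M :: "'w measure" and F :: "'w measure" and S :: "'s measure" and Y :: "'w \<Rightarrow> 's" +
  fixes Z :: "'a::euclidean_space set" and N :: "'a \<Rightarrow> real"
    and orc :: "'a \<Rightarrow> 's \<Rightarrow> 'a" and f :: "'a \<Rightarrow> 'a" and \<sigma> :: real
    and X :: "'w \<Rightarrow> 'a"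
  assumes norm: "is_norm N"
    and unbiased: "unbiased_oracle M S Z (\<lambda>_. Y) orc f"
    and variance: "bounded_variance M N Z (\<lambda>_. Y) orc f \<sigma>"
    and f_continuous: "continuous_on Z f"
    and X_measurable [measurable]: "X \<in> measurable F (restrict_space borel Z)"
    and \<sigma>_nonneg: "0 \<le> \<sigma>"
begin

definition noise :: "'w \<Rightarrow> 'a" where
  "noise \<theta> = orc (X \<theta>) (Y \<theta>) - f (X \<theta>)"

lemma X_in_Z: "\<theta> \<in> space M \<Longrightarrow> X \<theta> \<in> Z"
  using measurable_space[OF X_measurable] by (simp add: space_restrict_space space_F)

lemma measurable_joint_noise:
  "(\<lambda>(\<theta>, s). orc (X \<theta>) s - f (X \<theta>)) \<in> borel_measurable (F \<Otimes>\<^sub>M S)"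
proof -
  have [measurable]: "(\<lambda>(x, s). orc x s) \<in> borel_measurable (restrict_space borel Z \<Otimes>\<^sub>M S)"
    using unbiased by (simp add: unbiased_oracle_def)
  have [measurable]: "f \<in> borel_measurable (restrict_space borel Z)"
    using f_continuous by (rule borel_measurable_continuous_on_restrict)
  show ?thesis by measurable
qed

lemma measurable_pair_Y: "(\<lambda>\<theta>. (\<theta>, Y \<theta>)) \<in> measurable M (F \<Otimes>\<^sub>M S)"
  by measurable

lemma measurable_noise [measurable]: "noise \<in> borel_measurable M"
  using measurable_compose[OF measurable_pair_Y measurable_joint_noise] by (simp add: noise_def[abs_def])

lemma measurable_dual_noise [measurable]: "(\<lambda>\<theta>. dual_norm N (noise \<theta>)) \<in> borel_measurable M"
  by (rule measurable_compose[OF measurable_noise measurable_dual_norm[OF norm]])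

lemma nn_integral_noise_le:
  assumes g: "g \<in> borel_measurable borel"
    and le: "\<And>x. x \<in> Z \<Longrightarrow> (\<integral>\<^sup>+\<theta>. g (orc x (Y \<theta>) - f x) \<partial>M) \<le> c"
  shows "(\<integral>\<^sup>+\<theta>. g (noise \<theta>) \<partial>M) \<le> c"
proof -
  have "(\<lambda>p. g ((\<lambda>(\<theta>, s). orc (X \<theta>) s - f (X \<theta>)) p)) \<in> borel_measurable (F \<Otimes>\<^sub>M S)"
    using measurable_joint_noise g by (rule measurable_compose)
  from nn_integral_freeze_le[OF this, of "\<lambda>_. 1" c] le X_in_Z show ?thesis
    by (simp add: noise_def emeasure_space_1)
qed

lemma noise_variance:
  shows integrable_noise_square: "integrable M (\<lambda>\<theta>. (dual_norm N (noise \<theta>))\<^sup>2)"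
    and expectation_noise_square_le: "expectation (\<lambda>\<theta>. (dual_norm N (noise \<theta>))\<^sup>2) \<le> \<sigma>\<^sup>2"
proof -
  have le: "(\<integral>\<^sup>+\<theta>. ennreal ((dual_norm N (noise \<theta>))\<^sup>2) \<partial>M) \<le> ennreal (\<sigma>\<^sup>2)"
  proof (rule nn_integral_noise_le)
    fix x assume x: "x \<in> Z"
    then have "integrable M (\<lambda>\<theta>. (dual_norm N (orc x (Y \<theta>) - f x))\<^sup>2)"
      "expectation (\<lambda>\<theta>. (dual_norm N (orc x (Y \<theta>) - f x))\<^sup>2) \<le> \<sigma>\<^sup>2"
      using variance by (auto simp: bounded_variance_def)
    then show "(\<integral>\<^sup>+\<theta>. ennreal ((dual_norm N (orc x (Y \<theta>) - f x))\<^sup>2) \<partial>M) \<le> ennreal (\<sigma>\<^sup>2)"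
      by (subst nn_integral_eq_integral) (auto intro: ennreal_leI)
  qed (use measurable_dual_norm[OF norm] in measurable)
  show int: "integrable M (\<lambda>\<theta>. (dual_norm N (noise \<theta>))\<^sup>2)"
    by (rule integrableI_bounded) (auto intro: le_less_trans[OF le])
  show "expectation (\<lambda>\<theta>. (dual_norm N (noise \<theta>))\<^sup>2) \<le> \<sigma>\<^sup>2"
    using le nn_integral_eq_integral[OF int] by simp
qed

lemma noise_exact:
  assumes "\<sigma> = 0"
  shows "AE \<theta> in M. dual_norm N (noise \<theta>) = 0"
proof -
  have "expectation (\<lambda>\<theta>. (dual_norm N (noise \<theta>))\<^sup>2) = 0"
    using expectation_noise_square_le assms by (intro antisym integral_nonneg_AE) auto
  then show ?thesis
    using integral_nonneg_eq_0_iff_AE[OF integrable_noise_square] by auto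
qed

text \<open>At \<open>\<sigma> = 0\<close> the right-hand side is 0, so the identity says that the
  error vanishes almost surely. It allows squares of normalised errors to be used whether or not
  \<sigma> is zero.\<close>

lemma noise_scaled: "AE \<theta> in M. dual_norm N (noise \<theta>) = \<sigma> * (dual_norm N (noise \<theta>) / \<sigma>)"
  using noise_exact by (cases "\<sigma> = 0") auto

lemma noise_square_scaled:
  shows integrable_scaled_square: "integrable M (\<lambda>\<theta>. (dual_norm N (noise \<theta>) / \<sigma>)\<^sup>2)"
    and expectation_scaled_square_le: "expectation (\<lambda>\<theta>. (dual_norm N (noise \<theta>) / \<sigma>)\<^sup>2) \<le> 1"
  using integrable_noise_square expectation_noise_square_le
  by (auto simp: power_divide divide_le_eq_1)

text \<open>The direction is known before the call, so it is frozen along with the query point and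
  the centred error is integrated first. Fubini's theorem needs integrability beforehand, which
  follows from \<open>x \<le> 1 + x\<^sup>2\<close> and the variance bound.\<close>

lemma inner_noise_mean_zero:
  assumes d [measurable]: "d \<in> borel_measurable F" and bound: "\<And>\<theta>. \<theta> \<in> space M \<Longrightarrow> N (d \<theta>) \<le> D"
  shows integrable_inner_noise: "integrable M (\<lambda>\<theta>. inner (noise \<theta>) (d \<theta>))"
    and expectation_inner_noise: "expectation (\<lambda>\<theta>. inner (noise \<theta>) (d \<theta>)) = 0"
proof -
  have [measurable]: "d \<in> borel_measurable M"
    by (rule measurable_F[OF d])
  have "integrable M (\<lambda>\<theta>. D * (1 + (dual_norm N (noise \<theta>))\<^sup>2))"
    by (intro integrable_mult_right Bochner_Integration.integrable_add integrable_noise_square) simp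
  then show int: "integrable M (\<lambda>\<theta>. inner (noise \<theta>) (d \<theta>))"
  proof (rule Bochner_Integration.integrable_bound)
    show "AE \<theta> in M. norm (inner (noise \<theta>) (d \<theta>)) \<le> norm (D * (1 + (dual_norm N (noise \<theta>))\<^sup>2))"
    proof (rule AE_I2)
      fix \<theta> assume \<theta>: "\<theta> \<in> space M"
      let ?x = "dual_norm N (noise \<theta>)"
      have "\<bar>inner (noise \<theta>) (d \<theta>)\<bar> \<le> ?x * D"
        using abs_inner_le_dual_norm[OF norm] mult_left_mono[OF bound[OF \<theta>] dual_norm_nonneg[OF norm]]
        by (rule order_trans)
      also have "\<dots> \<le> (1 + ?x\<^sup>2) * D"
      proof (rule mult_right_mono)
        show "0 \<le> D" using bound[OF \<theta>] is_norm_nonneg[OF norm, of "d \<theta>"] by simp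
        show "?x \<le> 1 + ?x\<^sup>2"
          using sum_squares_bound[of ?x 1] dual_norm_nonneg[OF norm, of "noise \<theta>"] by simp
      qed
      finally show "norm (inner (noise \<theta>) (d \<theta>)) \<le> norm (D * (1 + ?x\<^sup>2))"
        by (simp add: mult.commute)
    qed
  qed measurable
  let ?h = "\<lambda>p. inner ((\<lambda>(\<theta>, s). orc (X \<theta>) s - f (X \<theta>)) p) (d (fst p))"
  have "(\<integral>\<theta>. ?h (\<theta>, Y \<theta>) \<partial>M) = 0"
  proof (rule integral_freeze_zero)
    show "?h \<in> borel_measurable (F \<Otimes>\<^sub>M S)"
      using measurable_joint_noise by measurable
    show "integrable M (\<lambda>\<theta>. ?h (\<theta>, Y \<theta>))"
      using int by (simp add: noise_def)
    fix \<theta> assume "\<theta> \<in> space M"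
    then have "has_bochner_integral M (\<lambda>\<theta>'. orc (X \<theta>) (Y \<theta>')) (f (X \<theta>))"
      using unbiased X_in_Z by (auto simp: unbiased_oracle_def)
    then show "(\<integral>\<theta>'. ?h (\<theta>, Y \<theta>') \<partial>M) = 0"
      by (simp add: has_bochner_integral_iff prob_space)
  qed
  then show "expectation (\<lambda>\<theta>. inner (noise \<theta>) (d \<theta>)) = 0"
    by (simp add: noise_def)
qed

context
  assumes tail: "light_tail M N Z (\<lambda>_. Y) orc f \<sigma>"
begin

lemma light_tail_scaled:
  assumes "x \<in> Z"
  shows "integrable M (\<lambda>\<theta>. exp ((dual_norm N (orc x (Y \<theta>) - f x) / \<sigma>)\<^sup>2))"
    and "expectation (\<lambda>\<theta>. exp ((dual_norm N (orc x (Y \<theta>) - f x) / \<sigma>)\<^sup>2)) \<le> exp 1"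
proof -
  show "integrable M (\<lambda>\<theta>. exp ((dual_norm N (orc x (Y \<theta>) - f x) / \<sigma>)\<^sup>2))"
    using tail assms
    by (cases "\<sigma> = 0") (auto simp: light_tail_def power_divide dual_norm_minus_commute[OF norm, of "f x"])
  show "expectation (\<lambda>\<theta>. exp ((dual_norm N (orc x (Y \<theta>) - f x) / \<sigma>)\<^sup>2)) \<le> exp 1"
    using tail assms
    by (cases "\<sigma> = 0")
      (auto simp: light_tail_def power_divide dual_norm_minus_commute[OF norm, of "f x"] prob_space)
qed

lemma exp_moment_noise:
  "(\<integral>\<^sup>+\<theta>. ennreal (exp ((dual_norm N (noise \<theta>) / \<sigma>)\<^sup>2)) \<partial>M) \<le> ennreal (exp 1)"
proof (rule nn_integral_noise_le)
  fix x assume "x \<in> Z"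
  from light_tail_scaled[OF this]
  show "(\<integral>\<^sup>+\<theta>. ennreal (exp ((dual_norm N (orc x (Y \<theta>) - f x) / \<sigma>)\<^sup>2)) \<partial>M) \<le> ennreal (exp 1)"
    by (subst nn_integral_eq_integral) (auto intro: ennreal_leI)
qed (use measurable_dual_norm[OF norm] in measurable)

text \<open>One step of the martingale argument, with variance proxy
  \<open>(\<sigma> * D)\<^sup>2\<close>; \<open>\<psi>\<close> is meant to carry the exponentials of
  all earlier steps.\<close>

lemma exp_moment_inner_noise:
  assumes d [measurable]: "d \<in> borel_measurable F" and bound: "\<And>\<theta>. \<theta> \<in> space M \<Longrightarrow> N (d \<theta>) \<le> D"
    and \<psi>: "\<psi> \<in> borel_measurable F"
  shows "(\<integral>\<^sup>+\<theta>. \<psi> \<theta> * ennreal (exp (inner (noise \<theta>) (d \<theta>))) \<partial>M)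
    \<le> ennreal (exp ((\<sigma> * D)\<^sup>2)) * (\<integral>\<^sup>+\<theta>. \<psi> \<theta> \<partial>M)"
proof -
  let ?h = "\<lambda>p. ennreal (exp (inner ((\<lambda>(\<theta>, s). orc (X \<theta>) s - f (X \<theta>)) p) (d (fst p))))"
  have "(\<integral>\<^sup>+\<theta>. \<psi> \<theta> * ?h (\<theta>, Y \<theta>) \<partial>M) \<le> ennreal (exp ((\<sigma> * D)\<^sup>2)) * (\<integral>\<^sup>+\<theta>. \<psi> \<theta> \<partial>M)"
  proof (rule nn_integral_freeze_le)
    show "?h \<in> borel_measurable (F \<Otimes>\<^sub>M S)"
      using measurable_joint_noise by measurable
    fix \<theta> assume \<theta>: "\<theta> \<in> space M"
    note x = X_in_Z[OF \<theta>]
    let ?e = "\<lambda>\<theta>'. orc (X \<theta>) (Y \<theta>') - f (X \<theta>)"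
    have mean: "has_bochner_integral M (\<lambda>\<theta>'. orc (X \<theta>) (Y \<theta>')) (f (X \<theta>))"
      using unbiased x by (auto simp: unbiased_oracle_def)
    have "(\<integral>\<^sup>+\<theta>'. ennreal (exp (inner (?e \<theta>') (d \<theta>))) \<partial>M) \<le> ennreal (exp ((\<sigma> * D)\<^sup>2))"
    proof (rule exp_moment_subgaussian)
      show "integrable M (\<lambda>\<theta>'. inner (?e \<theta>') (d \<theta>))"
        "expectation (\<lambda>\<theta>'. inner (?e \<theta>') (d \<theta>)) = 0"
        using mean by (auto simp: has_bochner_integral_iff prob_space)
      have "AE \<theta>' in M. dual_norm N (?e \<theta>') = \<sigma> * (dual_norm N (?e \<theta>') / \<sigma>)"
        using tail x by (cases "\<sigma> = 0") (auto simp: light_tail_def dual_norm_zero[OF norm] elim!: eventually_mono)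
      then show "AE \<theta>' in M. (inner (?e \<theta>') (d \<theta>))\<^sup>2 \<le> (\<sigma> * D)\<^sup>2 * (dual_norm N (?e \<theta>') / \<sigma>)\<^sup>2"
      proof eventually_elim
        case (elim \<theta>')
        have "\<bar>inner (?e \<theta>') (d \<theta>)\<bar> \<le> dual_norm N (?e \<theta>') * D"
          using abs_inner_le_dual_norm[OF norm] mult_left_mono[OF bound[OF \<theta>] dual_norm_nonneg[OF norm]]
          by (rule order_trans)
        then have "(inner (?e \<theta>') (d \<theta>))\<^sup>2 \<le> (dual_norm N (?e \<theta>') * D)\<^sup>2"
          using abs_le_square_iff by fastforce
        also have "dual_norm N (?e \<theta>') * D = \<sigma> * D * (dual_norm N (?e \<theta>') / \<sigma>)"
          using elim by (metis mult.assoc mult.commute)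
        finally show ?case
          by (simp only: power_mult_distrib)
      qed
    qed (fact light_tail_scaled[OF x])+
    then show "(\<integral>\<^sup>+\<theta>'. ?h (\<theta>, Y \<theta>') \<partial>M) \<le> ennreal (exp ((\<sigma> * D)\<^sup>2))"
      by simp
  qed (rule \<psi>)
  then show ?thesis
    by (simp add: noise_def)
qed

end

end

subsection \<open>The stochastic process\<close>

lemma dual_norm_scaleR_le:
  fixes N :: "'a::euclidean_space \<Rightarrow> real"
  assumes "is_norm N" "0 \<le> c"
  shows "dual_norm N (c *\<^sub>R \<eta>) \<le> c * dual_norm N \<eta>"
proof (rule dual_norm_leI[OF assms(1)])
  fix x assume "N x \<le> 1"
  then have "inner \<eta> x \<le> dual_norm N \<eta>"
    using order_trans[OF inner_le_dual_norm[OF assms(1)] mult_left_le] dual_norm_nonneg[OF assms(1)] by blast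
  then show "inner (c *\<^sub>R \<eta>) x \<le> c * dual_norm N \<eta>"
    using assms(2) by (simp add: mult_left_mono)
qed

text \<open>Summation by parts for an increasing weight. The induction has to keep the subtracted
  \<open>x (Suc n)\<close>, which is dropped only at the end.\<close>

lemma sum_weighted_differences_le:
  fixes a x :: "nat \<Rightarrow> real"
  assumes "\<And>t. t \<ge> 1 \<Longrightarrow> 0 \<le> a t" "\<And>t. t \<ge> 1 \<Longrightarrow> a t \<le> a (Suc t)"
    and "\<And>t. t \<ge> 1 \<Longrightarrow> 0 \<le> x t" "\<And>t. t \<ge> 1 \<Longrightarrow> x t \<le> B" and n: "1 \<le> n"
  shows "(\<Sum>t=1..n. a t * (x t - x (Suc t))) \<le> a n * B"
proof -
  have "(\<Sum>t=1..n. a t * (x t - x (Suc t))) \<le> a n * (B - x (Suc n))"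
    using n
  proof (induction rule: dec_induct)
    case base
    then show ?case
      using mult_left_mono[OF assms(4,1), of 1 1] by (simp add: right_diff_distrib)
  next
    case (step m)
    have "a m * (B - x (Suc m)) \<le> a (Suc m) * (B - x (Suc m))"
      using assms(2,4) step.hyps by (intro mult_right_mono) auto
    with step show ?case by (simp add: algebra_simps)
  qed
  also have "\<dots> \<le> a n * B"
    using assms(1,3) n by (intro mult_left_mono) auto
  finally show ?thesis .
qed

locale stochastic_amp =
  vi_setup Z N \<omega> grad\<omega> \<mu> \<Omega> G J gradG H L\<^sub>G L\<^sub>H + prob_space M
  for Z :: "'a::euclidean_space set" and N \<omega> grad\<omega> \<mu> \<Omega> G J gradG H L\<^sub>G L\<^sub>H
    and M :: "'w measure" +
  fixes \<sigma>\<^sub>G \<sigma>\<^sub>H \<sigma> :: real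
    and S :: "'s measure" and T :: "'t measure"
    and \<xi> :: "nat \<Rightarrow> 'w \<Rightarrow> 's" and \<zeta> :: "nat \<Rightarrow> 'w \<Rightarrow> 't"
    and oG :: "'a \<Rightarrow> 's \<Rightarrow> 'a" and oH :: "'a \<Rightarrow> 't \<Rightarrow> 'a"
    and \<alpha> \<gamma> :: "nat \<Rightarrow> real"
    and r1 :: 'a
    and w r wmd wag :: "nat \<Rightarrow> 'w \<Rightarrow> 'a"
  assumes prox_wd: "prox_well_defined Z \<omega> grad\<omega> J"
    and indep: "independent_samples M S T \<xi> \<zeta>"
    and SO_G: "unbiased_oracle M S Z \<xi> oG gradG"
    and SO_H: "unbiased_oracle M T Z \<zeta> oH H"
    and variance_G: "bounded_variance M N Z \<xi> oG gradG \<sigma>\<^sub>G"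
    and variance_H: "bounded_variance M N Z \<zeta> oH H \<sigma>\<^sub>H"
    and sigmas_nonneg: "0 \<le> \<sigma>\<^sub>G" "0 \<le> \<sigma>\<^sub>H"
    and \<sigma>_eq: "\<sigma> = sqrt (\<sigma>\<^sub>H\<^sup>2 + \<sigma>\<^sub>G\<^sup>2)"
    and \<alpha>_eq: "\<And>t. 1 \<le> t \<Longrightarrow> \<alpha> t = 2 / (real t + 1)"
    and denominator_pos: "\<And>t::nat. 1 \<le> t \<Longrightarrow>
          0 < 4 * L\<^sub>G + 3 * L\<^sub>H * real t + \<sigma> * (real t + 1) * sqrt (\<mu> * real t) / (sqrt 2 * \<Omega>)"
    and \<gamma>_eq: "\<And>t. 1 \<le> t \<Longrightarrow> \<gamma> t = \<mu> * real t /
          (4 * L\<^sub>G + 3 * L\<^sub>H * real t + \<sigma> * (real t + 1) * sqrt (\<mu> * real t) / (sqrt 2 * \<Omega>))"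
    and r1: "r1 \<in> Z"
    and init: "\<And>\<theta>. \<theta> \<in> space M \<Longrightarrow> r 1 \<theta> = r1 \<and> w 1 \<theta> = r1 \<and> wag 1 \<theta> = r1"
    and wmd_step: "\<And>t \<theta>. 1 \<le> t \<Longrightarrow> \<theta> \<in> space M \<Longrightarrow>
          wmd t \<theta> = (1 - \<alpha> t) *\<^sub>R wag t \<theta> + \<alpha> t *\<^sub>R r t \<theta>"
    and w_step: "\<And>t \<theta>. 1 \<le> t \<Longrightarrow> \<theta> \<in> space M \<Longrightarrow>
          w (t + 1) \<theta> = prox Z \<omega> grad\<omega> J (r t \<theta>) (\<gamma> t)
            (\<gamma> t *\<^sub>R oH (r t \<theta>) (\<zeta> (2 * t - 1) \<theta>) + \<gamma> t *\<^sub>R oG (wmd t \<theta>) (\<xi> t \<theta>))"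
    and r_step: "\<And>t \<theta>. 1 \<le> t \<Longrightarrow> \<theta> \<in> space M \<Longrightarrow>
          r (t + 1) \<theta> = prox Z \<omega> grad\<omega> J (r t \<theta>) (\<gamma> t)
            (\<gamma> t *\<^sub>R oH (w (t + 1) \<theta>) (\<zeta> (2 * t) \<theta>) + \<gamma> t *\<^sub>R oG (wmd t \<theta>) (\<xi> t \<theta>))"
    and wag_step: "\<And>t \<theta>. 1 \<le> t \<Longrightarrow> \<theta> \<in> space M \<Longrightarrow>
          wag (t + 1) \<theta> = (1 - \<alpha> t) *\<^sub>R wag t \<theta> + \<alpha> t *\<^sub>R w (t + 1) \<theta>"
begin

definition events_of :: "nat + nat \<Rightarrow> 'w set set" where
  "events_of = case_sum (\<lambda>i. {\<xi> i -` A \<inter> space M | A. A \<in> sets S})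
                        (\<lambda>i. {\<zeta> i -` A \<inter> space M | A. A \<in> sets T})"

definition info :: "(nat + nat) set \<Rightarrow> 'w measure" where
  "info I = sigma (space M) (\<Union>i\<in>I. events_of i)"

text \<open>
  Indices of the samples that are known before round \<open>t\<close> and in the middle of it, once \<open>w (t + 1)\<close> has
  been computed.
\<close>

definition past :: "nat \<Rightarrow> (nat + nat) set" where
  "past t = {1..<t} <+> {1..<2 * t - 1}"

definition mid :: "nat \<Rightarrow> (nat + nat) set" where
  "mid t = {1..<t + 1} <+> {1..<2 * t}"

lemma past_subset: "past t \<subseteq> {1..} <+> {1..}" and mid_subset: "mid t \<subseteq> {1..} <+> {1..}"
  by (auto simp: past_def mid_def)

lemma past_subset_mid: "past t \<subseteq> mid t" and mid_subset_past: "mid t \<subseteq> past (t + 1)"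
  by (auto simp: past_def mid_def)

lemma events_of_subset: "events_of i \<subseteq> Pow (space M)"
  by (auto simp: events_of_def split: sum.splits)

lemma xi_measurable: "1 \<le> i \<Longrightarrow> \<xi> i \<in> measurable M S"
  and zeta_measurable: "1 \<le> i \<Longrightarrow> \<zeta> i \<in> measurable M T"
  using indep by (auto simp: independent_samples_def)

lemma space_info [simp]: "space (info I) = space M"
  using events_of_subset unfolding info_def by (intro space_measure_of) auto

lemma sets_info: "sets (info I) = sigma_sets (space M) (\<Union>i\<in>I. events_of i)"
  using events_of_subset by (auto simp: info_def intro!: sets_measure_of)

lemma sets_info_mono: "I \<subseteq> I' \<Longrightarrow> sets (info I) \<subseteq> sets (info I')"
  unfolding sets_info by (intro sigma_sets_mono') auto

lemma measurable_info_mono: "I \<subseteq> I' \<Longrightarrow> f \<in> measurable (info I) A \<Longrightarrow> f \<in> measurable (info I') A"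
  using sets_info_mono[of I I'] by (auto simp: measurable_def)

lemma events_of_in_events: "i \<in> {1..} <+> {1..} \<Longrightarrow> events_of i \<subseteq> events"
  using xi_measurable zeta_measurable by (auto simp: events_of_def)

lemma sets_info_subset: "I \<subseteq> {1..} <+> {1..} \<Longrightarrow> sets (info I) \<subseteq> events"
  unfolding sets_info using events_of_in_events by (intro sets.sigma_sets_subset) blast

lemma measurable_xi_info: "Inl i \<in> I \<Longrightarrow> 1 \<le> i \<Longrightarrow> \<xi> i \<in> measurable (info I) S"
proof (rule measurableI)
  assume *: "Inl i \<in> I" "1 \<le> i"
  show "\<xi> i \<theta> \<in> space S" if "\<theta> \<in> space (info I)" for \<theta>
    using measurable_space[OF xi_measurable] * that by simp
  fix A assume "A \<in> sets S"
  then have "\<xi> i -` A \<inter> space M \<in> events_of (Inl i)"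
    unfolding events_of_def sum.case by blast
  with * show "\<xi> i -` A \<inter> space (info I) \<in> sets (info I)"
    by (auto simp: sets_info intro!: sigma_sets.Basic)
qed

lemma measurable_zeta_info: "Inr i \<in> I \<Longrightarrow> 1 \<le> i \<Longrightarrow> \<zeta> i \<in> measurable (info I) T"
proof (rule measurableI)
  assume *: "Inr i \<in> I" "1 \<le> i"
  show "\<zeta> i \<theta> \<in> space T" if "\<theta> \<in> space (info I)" for \<theta>
    using measurable_space[OF zeta_measurable] * that by simp
  fix A assume "A \<in> sets T"
  then have "\<zeta> i -` A \<inter> space M \<in> events_of (Inr i)"
    unfolding events_of_def sum.case by blast
  with * show "\<zeta> i -` A \<inter> space (info I) \<in> sets (info I)"
    by (auto simp: sets_info intro!: sigma_sets.Basic)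
qed

lemma Int_stable_preimages: "Int_stable {f -` A \<inter> space M | A. A \<in> sets B}"
proof (rule Int_stableI, safe)
  fix A A' assume "A \<in> sets B" "A' \<in> sets B"
  then show "\<exists>C. f -` A \<inter> space M \<inter> (f -` A' \<inter> space M) = f -` C \<inter> space M \<and> C \<in> sets B"
    by (intro exI[of _ "A \<inter> A'"]) auto
qed

text \<open>The samples are grouped into the disjoint index sets \<open>I\<close> and
  \<open>{j}\<close>. Preimages under one sample are closed under intersection, so independence
  passes to the generated sigma-algebras.\<close>

lemma indep_info:
  assumes I: "I \<subseteq> {1..} <+> {1..}" and j: "j \<in> {1..} <+> {1..}" "j \<notin> I"
  shows "indep_set (sets (info I)) (events_of j)"
proof -
  let ?I = "case_bool I {j}"
  have "indep_sets (\<lambda>b. sigma_sets (space M) (\<Union>i\<in>?I b. events_of i)) UNIV"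
  proof (rule indep_sets_collect_sigma)
    have "indep_sets events_of ({1..} <+> {1..})"
      using indep by (simp add: independent_samples_def events_of_def)
    then show "indep_sets events_of (\<Union>b\<in>UNIV. ?I b)"
      by (rule indep_sets_mono_index[rotated]) (use I j in \<open>auto split: bool.splits\<close>)
    show "Int_stable (events_of i)" for i
      by (auto simp: events_of_def Int_stable_preimages split: sum.split)
    show "disjoint_family_on ?I UNIV"
      using j by (auto simp: disjoint_family_on_def split: bool.splits)
  qed
  then have "indep_sets (case_bool (sets (info I)) (events_of j)) UNIV"
    by (rule indep_sets_mono_sets) (auto simp: sets_info intro: sigma_sets.Basic split: bool.splits)
  then show ?thesis
    by (simp add: indep_set_def)
qed

lemma fresh_xi:
  assumes "I \<subseteq> {1..} <+> {1..}" "1 \<le> i" "Inl i \<notin> I"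
  shows "fresh_sample M (info I) S (\<xi> i)"
proof unfold_locales
  show "indep_set (sets (info I)) {\<xi> i -` A \<inter> space M | A. A \<in> sets S}"
    using indep_info[of I "Inl i"] assms by (auto simp: events_of_def)
qed (use assms sets_info_subset xi_measurable in auto)

lemma fresh_zeta:
  assumes "I \<subseteq> {1..} <+> {1..}" "1 \<le> i" "Inr i \<notin> I"
  shows "fresh_sample M (info I) T (\<zeta> i)"
proof unfold_locales
  show "indep_set (sets (info I)) {\<zeta> i -` A \<inter> space M | A. A \<in> sets T}"
    using indep_info[of I "Inr i"] assms by (auto simp: events_of_def)
qed (use assms sets_info_subset zeta_measurable in auto)

abbreviation RZ :: "'a measure" where
  "RZ \<equiv> restrict_space borel Z"

lemma RZ_in_Z: "X \<in> measurable (info I) RZ \<Longrightarrow> \<theta> \<in> space M \<Longrightarrow> X \<theta> \<in> Z"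
  using measurable_space[of X "info I" RZ \<theta>] by (simp add: space_restrict_space)

lemma RZ_borel: "X \<in> measurable B RZ \<Longrightarrow> X \<in> borel_measurable B"
  by (simp add: measurable_restrict_space2_iff)

lemma measurable_convex_combination:
  assumes "X \<in> measurable B RZ" "Y \<in> measurable B RZ" "0 \<le> a" "a \<le> 1"
  shows "(\<lambda>\<theta>. (1 - a) *\<^sub>R X \<theta> + a *\<^sub>R Y \<theta>) \<in> measurable B RZ"
proof (rule measurable_restrict_space2)
  show "(\<lambda>\<theta>. (1 - a) *\<^sub>R X \<theta> + a *\<^sub>R Y \<theta>) \<in> borel_measurable B"
    using assms(1,2)[THEN RZ_borel] by measurable
  show "(\<lambda>\<theta>. (1 - a) *\<^sub>R X \<theta> + a *\<^sub>R Y \<theta>) \<in> space B \<rightarrow> Z"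
    using assms measurable_space[OF assms(1)] measurable_space[OF assms(2)]
    by (auto simp: space_restrict_space intro!: convexD[OF Z_convex])
qed

lemma measurable_oracle_error:
  assumes "unbiased_oracle M S' Z \<eta> orc f" "continuous_on Z f"
    and X [measurable]: "X \<in> measurable B RZ" and Y [measurable]: "Y \<in> measurable B S'"
  shows "(\<lambda>\<theta>. orc (X \<theta>) (Y \<theta>)) \<in> borel_measurable B"
    and "(\<lambda>\<theta>. orc (X \<theta>) (Y \<theta>) - f (X \<theta>)) \<in> borel_measurable B"
proof -
  have [measurable]: "(\<lambda>(x, s). orc x s) \<in> borel_measurable (RZ \<Otimes>\<^sub>M S')"
    using assms(1) by (simp add: unbiased_oracle_def)
  have [measurable]: "f \<in> borel_measurable RZ"
    using assms(2) by (rule borel_measurable_continuous_on_restrict)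
  show "(\<lambda>\<theta>. orc (X \<theta>) (Y \<theta>)) \<in> borel_measurable B"
    "(\<lambda>\<theta>. orc (X \<theta>) (Y \<theta>) - f (X \<theta>)) \<in> borel_measurable B"
    by measurable
qed

definition b :: "nat \<Rightarrow> real" where
  "b t = \<sigma> * (real t + 1) * sqrt (\<mu> * real t) / (sqrt 2 * \<Omega>)"

lemma \<sigma>_nonneg: "0 \<le> \<sigma>"
  by (simp add: \<sigma>_eq)

lemma b_nonneg: "0 \<le> b t"
  using \<sigma>_nonneg \<mu>_pos \<Omega>_pos by (simp add: b_def)

lemma b_eq_0: "1 \<le> t \<Longrightarrow> b t = 0 \<Longrightarrow> \<sigma> = 0"
  using \<mu>_pos \<Omega>_pos by (auto simp: b_def)

lemma \<gamma>_pos: "1 \<le> t \<Longrightarrow> 0 < \<gamma> t"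
  using denominator_pos[of t] \<mu>_pos by (simp add: \<gamma>_eq)

lemma \<alpha>_bounds: "1 \<le> t \<Longrightarrow> 0 \<le> \<alpha> t" "1 \<le> t \<Longrightarrow> \<alpha> t \<le> 1"
  by (auto simp: \<alpha>_eq)

lemma prox_J_exists:
  "z \<in> Z \<Longrightarrow> 0 < c \<Longrightarrow> \<exists>u. is_arg_min (prox_objective \<omega> grad\<omega> J z c \<eta>) (\<lambda>u. u \<in> Z) u"
  using prox_wd unfolding prox_well_defined_def by blast

definition eG :: "nat \<Rightarrow> 'w \<Rightarrow> 'a" where
  "eG t \<theta> = oG (wmd t \<theta>) (\<xi> t \<theta>) - gradG (wmd t \<theta>)"

definition e1 :: "nat \<Rightarrow> 'w \<Rightarrow> 'a" where
  "e1 t \<theta> = oH (r t \<theta>) (\<zeta> (2 * t - 1) \<theta>) - H (r t \<theta>)"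

definition e2 :: "nat \<Rightarrow> 'w \<Rightarrow> 'a" where
  "e2 t \<theta> = oH (w (t + 1) \<theta>) (\<zeta> (2 * t) \<theta>) - H (w (t + 1) \<theta>)"

text \<open>
  The auxiliary sequence tracks the maximiser of the accumulated noise \<open>\<Sum>t. t * inner (eG t + e2 t) u\<close>.
  Unlike the steps \<open>\<gamma> t\<close> of the method, its step \<open>1 / A\<close> is constant and is tuned to the horizon.
\<close>

primrec aux :: "real \<Rightarrow> nat \<Rightarrow> 'w \<Rightarrow> 'a" where
  "aux A 0 \<theta> = r1"
| "aux A (Suc t) \<theta> = prox Z \<omega> grad\<omega> (\<lambda>_. 0) (aux A t \<theta>) 1 (- ((real t / A) *\<^sub>R (eG t \<theta> + e2 t \<theta>)))"

lemma measurable_prox_J: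
  assumes "X \<in> measurable B RZ" "Y \<in> borel_measurable B" "0 < c"
  shows "(\<lambda>\<theta>. prox Z \<omega> grad\<omega> J (X \<theta>) c (Y \<theta>)) \<in> measurable B RZ"
  by (intro measurable_prox J_convex prox_J_exists assms)

lemma measurable_prox_zero:
  assumes "X \<in> measurable B RZ" "Y \<in> borel_measurable B"
  shows "(\<lambda>\<theta>. prox Z \<omega> grad\<omega> (\<lambda>_. 0) (X \<theta>) 1 (Y \<theta>)) \<in> measurable B RZ"
  by (intro measurable_prox convex_on_zero prox_zero_exists assms) simp

section \<open>Measurability of the iterates\<close>

text \<open>The prediction uses \<open>\<xi> t\<close> and \<open>\<zeta> (2 * t - 1)\<close> and is
  known at \<open>mid t\<close>; the correction also needs \<open>\<zeta> (2 * t)\<close> and is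
  known at \<open>past (t + 1)\<close>. Stated relative to the measurability of the input of a
  round, this closes the induction over rounds.\<close>

lemma round_measurable:
  assumes t: "1 \<le> t" and r: "r t \<in> measurable (info (past t)) RZ"
    and wag: "wag t \<in> measurable (info (past t)) RZ"
  shows measurable_wmd: "wmd t \<in> measurable (info (past t)) RZ"
    and measurable_w: "w (t + 1) \<in> measurable (info (mid t)) RZ"
    and measurable_r: "r (t + 1) \<in> measurable (info (past (t + 1))) RZ"
    and measurable_wag: "wag (t + 1) \<in> measurable (info (past (t + 1))) RZ"
    and measurable_eG: "eG t \<in> borel_measurable (info (mid t))"
    and measurable_e2: "e2 t \<in> borel_measurable (info (past (t + 1)))"
proof -
  have cong: "f \<in> measurable (info I) RZ \<longleftrightarrow> g \<in> measurable (info I) RZ"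
    if "\<And>\<theta>. \<theta> \<in> space M \<Longrightarrow> f \<theta> = g \<theta>" for f g I
    using that by (intro measurable_cong) simp
  show wmd: "wmd t \<in> measurable (info (past t)) RZ"
    using measurable_convex_combination[OF wag r \<alpha>_bounds[OF t]] wmd_step[OF t] by (subst cong) auto
  note to_mid = measurable_info_mono[OF past_subset_mid[of t]]
  note to_past = measurable_info_mono[OF mid_subset_past[of t]]
  have \<xi>: "\<xi> t \<in> measurable (info (mid t)) S" and \<zeta>1: "\<zeta> (2 * t - 1) \<in> measurable (info (mid t)) T"
    using t by (auto intro!: measurable_xi_info measurable_zeta_info simp: mid_def)
  have \<zeta>2: "\<zeta> (2 * t) \<in> measurable (info (past (t + 1))) T"
    using t by (auto intro!: measurable_zeta_info simp: past_def)
  note oG = measurable_oracle_error[OF SO_G gradG_continuous to_mid[OF wmd] \<xi>]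
  note oH1 = measurable_oracle_error(1)[OF SO_H continuous_on_H to_mid[OF r] \<zeta>1]
  show "eG t \<in> borel_measurable (info (mid t))"
    using oG(2) by (simp add: eG_def[abs_def])
  have "(\<lambda>\<theta>. prox Z \<omega> grad\<omega> J (r t \<theta>) (\<gamma> t)
      (\<gamma> t *\<^sub>R oH (r t \<theta>) (\<zeta> (2 * t - 1) \<theta>) + \<gamma> t *\<^sub>R oG (wmd t \<theta>) (\<xi> t \<theta>))) \<in> measurable (info (mid t)) RZ"
    by (intro measurable_prox_J to_mid[OF r] \<gamma>_pos[OF t] borel_measurable_add borel_measurable_scaleR
        borel_measurable_const oG(1) oH1)
  then show w: "w (t + 1) \<in> measurable (info (mid t)) RZ"
    using w_step[OF t] by (subst cong) auto
  note oH2 = measurable_oracle_error[OF SO_H continuous_on_H to_past[OF w] \<zeta>2]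
  show "e2 t \<in> borel_measurable (info (past (t + 1)))"
    using oH2(2) by (simp add: e2_def[abs_def])
  have "(\<lambda>\<theta>. prox Z \<omega> grad\<omega> J (r t \<theta>) (\<gamma> t)
      (\<gamma> t *\<^sub>R oH (w (t + 1) \<theta>) (\<zeta> (2 * t) \<theta>) + \<gamma> t *\<^sub>R oG (wmd t \<theta>) (\<xi> t \<theta>)))
      \<in> measurable (info (past (t + 1))) RZ"
    by (intro measurable_prox_J to_past[OF to_mid[OF r]] \<gamma>_pos[OF t] borel_measurable_add
        borel_measurable_scaleR borel_measurable_const to_past[OF oG(1)] oH2(1))
  then show "r (t + 1) \<in> measurable (info (past (t + 1))) RZ"
    using r_step[OF t] by (subst cong) auto
  show "wag (t + 1) \<in> measurable (info (past (t + 1))) RZ"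
    using measurable_convex_combination[OF to_past[OF to_mid[OF wag]] to_past[OF w] \<alpha>_bounds[OF t]]
      wag_step[OF t] by (subst cong) auto
qed

lemma state_measurable:
  assumes "1 \<le> t"
  shows "r t \<in> measurable (info (past t)) RZ \<and> wag t \<in> measurable (info (past t)) RZ"
  using assms
proof (induction rule: dec_induct)
  case base
  have "(\<lambda>\<theta>. r1) \<in> measurable (info (past 1)) RZ"
    using r1 by (intro measurable_const) (simp add: space_restrict_space)
  moreover have "f \<in> measurable (info (past 1)) RZ \<longleftrightarrow> (\<lambda>\<theta>. r1) \<in> measurable (info (past 1)) RZ"
    if "\<And>\<theta>. \<theta> \<in> space M \<Longrightarrow> f \<theta> = r1" for f
    using that by (intro measurable_cong) simp
  ultimately show ?case
    using init by blast
next
  case (step t)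
  then show ?case
    using measurable_r[of t] measurable_wag[of t] by simp
qed

lemmas r_measurable = conjunct1[OF state_measurable]
  and wag_measurable = conjunct2[OF state_measurable]

lemma
  assumes "1 \<le> t"
  shows wmd_measurable: "wmd t \<in> measurable (info (past t)) RZ"
    and w_measurable: "w (t + 1) \<in> measurable (info (mid t)) RZ"
    and eG_measurable: "eG t \<in> borel_measurable (info (mid t))"
    and e2_measurable: "e2 t \<in> borel_measurable (info (past (t + 1)))"
  using measurable_wmd measurable_w measurable_eG measurable_e2 assms r_measurable wag_measurable
  by blast+

lemma aux_measurable:
  assumes "1 \<le> t"
  shows "aux A t \<in> measurable (info (past t)) RZ"
  using assms
proof (induction rule: dec_induct)
  case base
  \<comment> \<open>The step from index 0 to 1 has the factor \<open>real 0 / A\<close>, so it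
    involves no noise and \<open>aux A 1\<close> is constant. From then on \<open>aux A t\<close>
    uses only rounds before \<open>t\<close>.\<close>
  have "(\<lambda>\<theta>. prox Z \<omega> grad\<omega> (\<lambda>_. 0) r1 1 0) \<in> measurable (info (past 1)) RZ"
    using r1 by (intro measurable_prox_zero measurable_const) (auto simp: space_restrict_space)
  moreover have "aux A 1 = (\<lambda>\<theta>. prox Z \<omega> grad\<omega> (\<lambda>_. 0) r1 1 0)"
    by (simp add: fun_eq_iff)
  ultimately show ?case by simp
next
  case (step t)
  have past: "past t \<subseteq> past (Suc t)"
    using past_subset_mid[of t] mid_subset_past[of t] by simp
  have "eG t \<in> borel_measurable (info (past (Suc t)))" "e2 t \<in> borel_measurable (info (past (Suc t)))"
    using measurable_info_mono[OF mid_subset_past eG_measurable[OF step.hyps(1)]] e2_measurable[OF step.hyps(1)]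
    by simp_all
  then have "(\<lambda>\<theta>. - ((real t / A) *\<^sub>R (eG t \<theta> + e2 t \<theta>))) \<in> borel_measurable (info (past (Suc t)))"
    by measurable
  from measurable_prox_zero[OF measurable_info_mono[OF past step.IH] this] show ?case
    by (simp add: aux.simps(2)[abs_def])
qed

lemma in_Z:
  assumes "1 \<le> t" "\<theta> \<in> space M"
  shows r_in_Z: "r t \<theta> \<in> Z" and wag_in_Z: "wag t \<theta> \<in> Z" and aux_in_Z: "aux A t \<theta> \<in> Z"
    and w_in_Z: "w (t + 1) \<theta> \<in> Z"
  using RZ_in_Z assms r_measurable wag_measurable aux_measurable w_measurable by blast+

lemma call_G:
  assumes "1 \<le> t"
  shows "oracle_call M (info (past t)) S (\<xi> t) Z N oG gradG \<sigma>\<^sub>G (wmd t)"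
proof -
  interpret fresh_sample M "info (past t)" S "\<xi> t"
    using assms by (intro fresh_xi past_subset) (auto simp: past_def)
  show ?thesis
    using norm SO_G variance_G gradG_continuous wmd_measurable[OF assms] sigmas_nonneg assms
    by unfold_locales (auto simp: unbiased_oracle_def bounded_variance_def)
qed

lemma call_H1:
  assumes "1 \<le> t"
  shows "oracle_call M (info (past t)) T (\<zeta> (2 * t - 1)) Z N oH H \<sigma>\<^sub>H (r t)"
proof -
  interpret fresh_sample M "info (past t)" T "\<zeta> (2 * t - 1)"
    using assms by (intro fresh_zeta past_subset) (auto simp: past_def)
  have "1 \<le> 2 * t - 1" using assms by simp
  then show ?thesis
    using norm SO_H variance_H continuous_on_H r_measurable[OF assms] sigmas_nonneg
    by unfold_locales (auto simp: unbiased_oracle_def bounded_variance_def)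
qed

lemma call_H2:
  assumes "1 \<le> t"
  shows "oracle_call M (info (mid t)) T (\<zeta> (2 * t)) Z N oH H \<sigma>\<^sub>H (w (t + 1))"
proof -
  interpret fresh_sample M "info (mid t)" T "\<zeta> (2 * t)"
    using assms by (intro fresh_zeta mid_subset) (auto simp: mid_def)
  have "1 \<le> 2 * t" using assms by simp
  then show ?thesis
    using norm SO_H variance_H continuous_on_H w_measurable[OF assms] sigmas_nonneg
    by unfold_locales (auto simp: unbiased_oracle_def bounded_variance_def)
qed

lemma noise_eG: "1 \<le> t \<Longrightarrow> oracle_call.noise (\<xi> t) oG gradG (wmd t) = eG t"
  and noise_e1: "1 \<le> t \<Longrightarrow> oracle_call.noise (\<zeta> (2 * t - 1)) oH H (r t) = e1 t"
  and noise_e2: "1 \<le> t \<Longrightarrow> oracle_call.noise (\<zeta> (2 * t)) oH H (w (t + 1)) = e2 t"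
  using oracle_call.noise_def[OF call_G] oracle_call.noise_def[OF call_H1] oracle_call.noise_def[OF call_H2]
  by (auto simp: fun_eq_iff eG_def e1_def e2_def)

section \<open>Pathwise estimate of the gap\<close>

text \<open>\<open>eG t\<close> is paired with points fixed before \<open>\<xi> t\<close> is drawn,
  \<open>e2 t\<close> with points fixed before \<open>\<zeta> (2 * t)\<close> is drawn, so each
  summand has conditional mean zero. The auxiliary point stands in for the comparison point
  \<open>u\<close>.\<close>

definition mart :: "real \<Rightarrow> nat \<Rightarrow> 'w \<Rightarrow> real" where
  "mart A t \<theta> = inner (eG t \<theta>) (- real t *\<^sub>R (r t \<theta> - aux A t \<theta>))
    + inner (e2 t \<theta>) (- real t *\<^sub>R (w (t + 1) \<theta> - aux A t \<theta>))"

text \<open>The first summand comes from the prox-steps of the method; the second is the price of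
  one step of the auxiliary sequence.\<close>

definition quad :: "real \<Rightarrow> nat \<Rightarrow> 'w \<Rightarrow> real" where
  "quad A t \<theta> = real t * (real t / (2 * b t)
      * ((dual_norm N (e2 t \<theta>) + dual_norm N (e1 t \<theta>))\<^sup>2 + (dual_norm N (eG t \<theta>))\<^sup>2))
    + (real t)\<^sup>2 / (2 * \<mu> * A) * (dual_norm N (eG t \<theta> + e2 t \<theta>))\<^sup>2"

text \<open>This is \<open>prox_zero_step\<close> for the scaled noise, multiplied back by
  \<open>A\<close>: a large \<open>A\<close> makes the squares cheap and the Bregman terms
  expensive.\<close>

lemma aux_step:
  assumes t: "1 \<le> t" and \<theta>: "\<theta> \<in> space M" and u: "u \<in> Z" and A: "0 \<le> A"
    and exact: "A = 0 \<Longrightarrow> dual_norm N (eG t \<theta> + e2 t \<theta>) = 0"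
  shows "real t * inner (eG t \<theta> + e2 t \<theta>) (u - aux A t \<theta>)
    \<le> A * (V (aux A t \<theta>) u - V (aux A (Suc t) \<theta>) u)
      + (real t)\<^sup>2 / (2 * \<mu> * A) * (dual_norm N (eG t \<theta> + e2 t \<theta>))\<^sup>2"
proof (cases "A = 0")
  case True
  then have "inner (eG t \<theta> + e2 t \<theta>) (u - aux A t \<theta>) \<le> 0"
    using inner_le_dual_norm[OF norm, of "eG t \<theta> + e2 t \<theta>" "u - aux A t \<theta>"] exact by simp
  with True show ?thesis
    by (simp add: mult_nonneg_nonpos)
next
  case False
  with A have A: "0 < A" by simp
  let ?e = "eG t \<theta> + e2 t \<theta>"
  have "inner ((real t / A) *\<^sub>R ?e) (u - aux A t \<theta>)
      \<le> V (aux A t \<theta>) u - V (aux A (Suc t) \<theta>) u + (dual_norm N ((real t / A) *\<^sub>R ?e))\<^sup>2 / (2 * \<mu>)"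
    unfolding aux.simps(2) by (intro prox_zero_step aux_in_Z t \<theta> u is_arg_min_prox prox_zero_exists)
  also have "(dual_norm N ((real t / A) *\<^sub>R ?e))\<^sup>2 \<le> (real t / A * dual_norm N ?e)\<^sup>2"
    using A by (intro power_mono dual_norm_scaleR_le dual_norm_nonneg norm) simp
  finally have "real t / A * inner ?e (u - aux A t \<theta>)
      \<le> V (aux A t \<theta>) u - V (aux A (Suc t) \<theta>) u + (real t / A * dual_norm N ?e)\<^sup>2 / (2 * \<mu>)"
    using \<mu>_pos by (simp add: divide_right_mono)
  then have "A * (real t / A * inner ?e (u - aux A t \<theta>))
      \<le> A * (V (aux A t \<theta>) u - V (aux A (Suc t) \<theta>) u + (real t / A * dual_norm N ?e)\<^sup>2 / (2 * \<mu>))"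
    using A by (intro mult_left_mono) auto
  moreover have "A * (real t / A * inner ?e (u - aux A t \<theta>)) = real t * inner ?e (u - aux A t \<theta>)"
    "A * ((real t / A * dual_norm N ?e)\<^sup>2 / (2 * \<mu>)) = (real t)\<^sup>2 / (2 * \<mu> * A) * (dual_norm N ?e)\<^sup>2"
    using A \<mu>_pos by (simp_all add: power2_eq_square field_simps)
  ultimately show ?thesis
    by (simp only: distrib_left)
qed

text \<open>
  At \<open>\<sigma> = 0\<close> and \<open>A = 0\<close> the divisions in \<open>quad\<close> yield \<open>0\<close>; the corresponding noise terms then have to
  vanish.
\<close>

definition exact_if_noiseless :: "real \<Rightarrow> nat \<Rightarrow> 'w \<Rightarrow> bool" where
  "exact_if_noiseless A t \<theta> \<longleftrightarrow>
    (\<sigma> = 0 \<longrightarrow> dual_norm N (eG t \<theta>) = 0 \<and> dual_norm N (e1 t \<theta>) = 0 \<and> dual_norm N (e2 t \<theta>) = 0) \<and>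
    (A = 0 \<longrightarrow> dual_norm N (eG t \<theta> + e2 t \<theta>) = 0)"

lemma round_bound:
  assumes t: "1 \<le> t" and \<theta>: "\<theta> \<in> space M" and u: "u \<in> Z" and A: "0 \<le> A"
    and exact: "exact_if_noiseless A t \<theta>"
  shows "real t * (real t + 1) / 2 * Q (wag (Suc t) \<theta>) u \<le> real t * (real t - 1) / 2 * Q (wag t \<theta>) u
    + (real t / \<gamma> t * (V (r t \<theta>) u - V (r (Suc t) \<theta>) u)
      + A * (V (aux A t \<theta>) u - V (aux A (Suc t) \<theta>) u) + quad A t \<theta> + mart A t \<theta>)"
proof -
  let ?h1 = "oH (r t \<theta>) (\<zeta> (2 * t - 1) \<theta>)" and ?h2 = "oH (w (t + 1) \<theta>) (\<zeta> (2 * t) \<theta>)"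
    and ?g = "oG (wmd t \<theta>) (\<xi> t \<theta>)"
  have r: "r t \<theta> \<in> Z" using r_in_Z[OF t \<theta>] .
  have "real t * (real t + 1) / 2 * Q (wag (t + 1) \<theta>) u \<le> real t * (real t - 1) / 2 * Q (wag t \<theta>) u
    + real t * ((V (r t \<theta>) u - V (r (t + 1) \<theta>) u) / \<gamma> t
      + real t / (2 * b t) * ((dual_norm N (?h2 - H (w (t + 1) \<theta>)) + dual_norm N (?h1 - H (r t \<theta>)))\<^sup>2
          + (dual_norm N (?g - gradG (wmd t \<theta>)))\<^sup>2)
      - inner (?g - gradG (wmd t \<theta>)) (r t \<theta> - u) - inner (?h2 - H (w (t + 1) \<theta>)) (w (t + 1) \<theta> - u))"
  proof (rule amp_step[where \<alpha> = "\<alpha> t"])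
    show "1 \<le> real t" using t by simp
    show "0 < 4 * L\<^sub>G + 3 * L\<^sub>H * real t + b t"
      "\<gamma> t = \<mu> * real t / (4 * L\<^sub>G + 3 * L\<^sub>H * real t + b t)"
      using denominator_pos[OF t] \<gamma>_eq[OF t] by (simp_all add: b_def)
    show "is_arg_min (prox_objective \<omega> grad\<omega> J (r t \<theta>) (\<gamma> t) (\<gamma> t *\<^sub>R ?h1 + \<gamma> t *\<^sub>R ?g)) (\<lambda>u. u \<in> Z) (w (t + 1) \<theta>)"
      unfolding w_step[OF t \<theta>] by (intro is_arg_min_prox prox_J_exists r \<gamma>_pos t)
    show "is_arg_min (prox_objective \<omega> grad\<omega> J (r t \<theta>) (\<gamma> t) (\<gamma> t *\<^sub>R ?h2 + \<gamma> t *\<^sub>R ?g)) (\<lambda>u. u \<in> Z) (r (t + 1) \<theta>)"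
      unfolding r_step[OF t \<theta>] by (intro is_arg_min_prox prox_J_exists r \<gamma>_pos t)
    show "dual_norm N (?h1 - H (r t \<theta>)) = 0 \<and> dual_norm N (?h2 - H (w (t + 1) \<theta>)) = 0
        \<and> dual_norm N (?g - gradG (wmd t \<theta>)) = 0" if "b t = 0"
      using exact b_eq_0[OF t that] unfolding exact_if_noiseless_def eG_def e1_def e2_def by blast
  qed (use wag_in_Z[OF t \<theta>] r u \<alpha>_eq[OF t] b_nonneg wmd_step[OF t \<theta>] wag_step[OF t \<theta>] in auto)
  \<comment> \<open>Inserting \<open>aux A t\<close> between the iterates and \<open>u\<close>
    splits off the only noise term that still depends on \<open>u\<close>; \<open>aux_step\<close>
    bounds it.\<close>
  moreover have "- (real t * inner (eG t \<theta>) (r t \<theta> - u)) - real t * inner (e2 t \<theta>) (w (t + 1) \<theta> - u)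
      = mart A t \<theta> + real t * inner (eG t \<theta> + e2 t \<theta>) (u - aux A t \<theta>)"
    by (simp add: mart_def inner_diff_right inner_add_left algebra_simps)
  moreover have "real t * inner (eG t \<theta> + e2 t \<theta>) (u - aux A t \<theta>)
    \<le> A * (V (aux A t \<theta>) u - V (aux A (Suc t) \<theta>) u)
      + (real t)\<^sup>2 / (2 * \<mu> * A) * (dual_norm N (eG t \<theta> + e2 t \<theta>))\<^sup>2"
    using exact by (intro aux_step t \<theta> u A) (simp add: exact_if_noiseless_def)
  moreover have eq: "s * (d / c + y - i - j) = s / c * d + s * y + (- (s * i) - s * j)" for s d c y i j :: real
    by (simp add: algebra_simps)
  ultimately show ?thesis
    unfolding quad_def eG_def[symmetric] e1_def[symmetric] e2_def[symmetric] Suc_eq_plus1 eq by linarith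
qed

text \<open>Once the Bregman terms are summed, the bound is free of \<open>u\<close>, so the
  supremum is taken pathwise, before any expectation.\<close>

lemma gap_bound:
  assumes n: "1 \<le> n" and \<theta>: "\<theta> \<in> space M" and A: "0 \<le> A"
    and exact: "\<And>t. t \<in> {1..n} \<Longrightarrow> exact_if_noiseless A t \<theta>"
  shows "real n * (real n + 1) / 2 * gap Z G H J (wag (n + 1) \<theta>)
    \<le> (real n / \<gamma> n * \<Omega>\<^sup>2 + A * \<Omega>\<^sup>2) + (\<Sum>t=1..n. quad A t \<theta>) + (\<Sum>t=1..n. mart A t \<theta>)" (is "?P * _ \<le> ?B")
proof -
  have P: "0 < ?P" using n by simp
  have "Q (wag (n + 1) \<theta>) u \<le> ?B / ?P" if u: "u \<in> Z" for u
  proof -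
    have V: "0 \<le> V z u" "V z u \<le> \<Omega>\<^sup>2" if "z \<in> Z" for z
      using bregman_nonneg[OF that u] V_bound[OF that u] by auto
    define f where "f t = real t / \<gamma> t * (V (r t \<theta>) u - V (r (Suc t) \<theta>) u)
      + A * (V (aux A t \<theta>) u - V (aux A (Suc t) \<theta>) u) + quad A t \<theta> + mart A t \<theta>" for t
    \<comment> \<open>Counting from \<open>m = 0\<close> removes the starting point: the weight
      \<open>t * (t - 1) / 2\<close> in the first round is 0.\<close>
    have "real m * (real m + 1) / 2 * Q (wag (Suc m) \<theta>) u \<le> (\<Sum>t=1..m. f t)" if "m \<le> n" for m
      using that
    proof (induction m)
      case (Suc m)
      have eq: "real (Suc m) * (real (Suc m) - 1) / 2 = real m * (real m + 1) / 2"
        by (simp add: algebra_simps)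
      have "real (Suc m) * (real (Suc m) + 1) / 2 * Q (wag (Suc (Suc m)) \<theta>) u
          \<le> real (Suc m) * (real (Suc m) - 1) / 2 * Q (wag (Suc m) \<theta>) u + f (Suc m)"
        unfolding f_def using Suc.prems by (intro round_bound \<theta> u A exact) auto
      moreover have "(\<Sum>t=1..Suc m. f t) = (\<Sum>t=1..m. f t) + f (Suc m)"
        by simp
      ultimately show ?case
        using Suc.IH Suc.prems unfolding eq by linarith
    qed simp
    from this[of n] have "?P * Q (wag (n + 1) \<theta>) u
        \<le> (\<Sum>t=1..n. real t / \<gamma> t * (V (r t \<theta>) u - V (r (Suc t) \<theta>) u))
          + (\<Sum>t=1..n. A * (V (aux A t \<theta>) u - V (aux A (Suc t) \<theta>) u))
          + (\<Sum>t=1..n. quad A t \<theta>) + (\<Sum>t=1..n. mart A t \<theta>)"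
      by (simp add: f_def sum.distrib del: aux.simps)
    also have "(\<Sum>t=1..n. real t / \<gamma> t * (V (r t \<theta>) u - V (r (Suc t) \<theta>) u)) \<le> real n / \<gamma> n * \<Omega>\<^sup>2"
    proof (rule sum_weighted_differences_le[OF _ _ _ _ n])
      fix t :: nat assume t: "1 \<le> t"
      show "0 \<le> real t / \<gamma> t" using \<gamma>_pos[OF t] by simp
      have eq: "real s / \<gamma> s = (4 * L\<^sub>G + 3 * L\<^sub>H * real s + b s) / \<mu>" if "1 \<le> s" for s
        using denominator_pos[OF that] that \<mu>_pos by (simp add: \<gamma>_eq[OF that] b_def)
      have "b t \<le> b (Suc t)"
        unfolding b_def using \<sigma>_nonneg \<Omega>_pos \<mu>_pos by (intro divide_right_mono mult_mono) auto
      then show "real t / \<gamma> t \<le> real (Suc t) / \<gamma> (Suc t)"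
        unfolding eq[OF t] eq[OF le_SucI[OF t]] using \<mu>_pos L\<^sub>H_nonneg
        by (intro divide_right_mono add_mono mult_left_mono) auto
      show "0 \<le> V (r t \<theta>) u" "V (r t \<theta>) u \<le> \<Omega>\<^sup>2"
        using V r_in_Z[OF t \<theta>] by auto
    qed
    also have "(\<Sum>t=1..n. A * (V (aux A t \<theta>) u - V (aux A (Suc t) \<theta>) u)) \<le> A * \<Omega>\<^sup>2"
      using V aux_in_Z[OF _ \<theta>] by (intro sum_weighted_differences_le[OF _ _ _ _ n] A) auto
    finally show ?thesis
      using P by (simp add: pos_le_divide_eq mult.commute)
  qed
  then have "gap Z G H J (wag (n + 1) \<theta>) \<le> ?B / ?P"
    by (simp add: gap_le_iff)
  then show ?thesis
    using P by (simp add: pos_le_divide_eq mult.commute)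
qed

end

subsection \<open>Numerical bounds\<close>

text \<open>Each summand is at most the average of \<open>sqrt\<close> at \<open>t - 1\<close> and
  \<open>t\<close>. For the concave function \<open>sqrt\<close> the trapezoidal rule underestimates
  the integral, which is \<open>2 / 3\<close> times the increment of
  \<open>n * sqrt n\<close>.\<close>

lemma sum_sqrt_weighted_le:
  "(\<Sum>t=1..n. sqrt (real t) * real t / (real t + 1)) \<le> 2 / 3 * (real n * sqrt (real n))"
proof (induction n)
  case (Suc n)
  define a where "a = sqrt (real n)"
  define c where "c = sqrt (real (Suc n))"
  have a: "0 \<le> a" "a\<^sup>2 = real n" and c: "0 < c" "c\<^sup>2 = real n + 1"
    by (auto simp: a_def c_def)
  have "a \<le> c" by (simp add: a_def c_def)
  have ca: "c\<^sup>2 - a\<^sup>2 = 1" using a c by simp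
  have "c * c\<^sup>2 / (c\<^sup>2 + 1) \<le> (a + c) / 2"
  proof -
    have "a * c \<le> c * c"
      using \<open>a \<le> c\<close> c(1) by (intro mult_right_mono) auto
    then have "a * (a * c) \<le> a * (c\<^sup>2 + 1)"
      using a(1) by (intro mult_left_mono) (auto simp: power2_eq_square)
    moreover have "c * (c\<^sup>2 - a\<^sup>2) = c"
      using ca by simp
    ultimately have "2 * (c * c\<^sup>2) \<le> (a + c) * (c\<^sup>2 + 1)"
      by (simp add: algebra_simps power2_eq_square)
    then show ?thesis
      using c by (simp add: divide_simps)
  qed
  moreover have "(a + c) / 2 \<le> 2 / 3 * (c * c\<^sup>2 - a * a\<^sup>2)"
  proof -
    have "3 * (a + c) = 3 * (a + c) * (c\<^sup>2 - a\<^sup>2)"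
      using ca by simp
    also have "\<dots> = (c - a) * (3 * (a + c)\<^sup>2)"
      by (simp add: power2_eq_square algebra_simps)
    also have "\<dots> \<le> (c - a) * (4 * (c\<^sup>2 + a * c + a\<^sup>2))"
      using \<open>a \<le> c\<close> zero_le_power2[of "a - c"]
      by (intro mult_left_mono) (auto simp: power2_eq_square algebra_simps)
    also have "\<dots> = 4 * (c * c\<^sup>2 - a * a\<^sup>2)"
      by (simp add: algebra_simps power2_eq_square)
    finally show ?thesis by linarith
  qed
  ultimately have "c * c\<^sup>2 / (c\<^sup>2 + 1) \<le> 2 / 3 * (c * c\<^sup>2 - a * a\<^sup>2)"
    by linarith
  have "sqrt (real (Suc n)) * real (Suc n) / (real (Suc n) + 1)
      \<le> 2 / 3 * (real (Suc n) * sqrt (real (Suc n))) - 2 / 3 * (real n * sqrt (real n))"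
  proof -
    have root: "sqrt (real (Suc n)) = c" "sqrt (real n) = a" and sq: "real (Suc n) = c\<^sup>2" "real n = a\<^sup>2"
      using a(2) c(2) by (simp_all add: c_def a_def)
    show ?thesis
      using \<open>c * c\<^sup>2 / (c\<^sup>2 + 1) \<le> 2 / 3 * (c * c\<^sup>2 - a * a\<^sup>2)\<close>
      unfolding root unfolding sq by (simp add: mult.commute right_diff_distrib)
  qed
  moreover have "(\<Sum>t=1..Suc n. sqrt (real t) * real t / (real t + 1))
      = (\<Sum>t=1..n. sqrt (real t) * real t / (real t + 1)) + sqrt (real (Suc n)) * real (Suc n) / (real (Suc n) + 1)"
    by simp
  ultimately show ?case
    using Suc.IH by linarith
qed simp

lemma sum_squares_eq: "(\<Sum>t=1..n. (real t)\<^sup>2) = real n * (real n + 1) * (2 * real n + 1) / 6"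
  by (induction n) (auto simp: field_simps power2_eq_square)

text \<open>\<open>sqrt 2\<close> comes from the step sizes, \<open>2 / sqrt 6\<close> from the
  auxiliary sequence and \<open>2 * sqrt 2 / sqrt 3\<close> from the martingale. At level
  \<open>x = 2 / sqrt 3 * l\<close> the tail \<open>exp (- x\<^sup>2 / 4)\<close> becomes
  \<open>exp (- l\<^sup>2 / 3)\<close>.\<close>

lemma numeric_sqrt_bounds:
  "sqrt 2 \<le> 1.415" "2 / sqrt 6 \<le> (0.817::real)" "2 * sqrt 2 / sqrt 3 \<le> (1.634::real)" "2 / sqrt 3 \<le> (1.155::real)"
proof -
  show "sqrt 2 \<le> 1.415" by (rule real_le_lsqrt) (auto simp: power2_eq_square)
  have "2 \<le> 0.817 * sqrt 6"
    using real_le_rsqrt[of "2 / 0.817" 6] by (simp add: power2_eq_square)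
  then show "2 / sqrt 6 \<le> (0.817::real)" by (simp add: field_simps)
  have "sqrt 3 \<ge> 1.732" by (rule real_le_rsqrt) (simp add: power2_eq_square)
  with \<open>sqrt 2 \<le> 1.415\<close> show "2 * sqrt 2 / sqrt 3 \<le> (1.634::real)" "2 / sqrt 3 \<le> (1.155::real)"
    by (auto simp: field_simps)
qed

context stochastic_amp
begin

subsection \<open>Convergence in expectation\<close>

text \<open>The value that balances \<open>A * \<Omega>\<^sup>2\<close> against the sum of
  \<open>t\<^sup>2 * (\<sigma>\<^sub>G + \<sigma>\<^sub>H)\<^sup>2 / (2 * \<mu> * A)\<close>, once
  \<open>2 * n + 1\<close> in the formula for the sum of squares is rounded up to
  \<open>2 * (n + 1)\<close>.\<close>

definition A :: "nat \<Rightarrow> real" where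
  "A n = (\<sigma>\<^sub>G + \<sigma>\<^sub>H) * (real n * (real n + 1)) / (\<Omega> * sqrt (6 * \<mu> * real n))"

definition K :: "nat \<Rightarrow> real" where
  "K n = (\<sigma>\<^sub>G + \<sigma>\<^sub>H) * \<Omega> / sqrt (\<mu> * real n)"

definition Det :: "nat \<Rightarrow> real" where
  "Det n = real n / \<gamma> n * \<Omega>\<^sup>2 + A n * \<Omega>\<^sup>2"

text \<open>Scale of the martingale sum: \<sigma> times the diameter bound times an upper bound for
  the root of the sum of \<open>t\<^sup>2\<close>.\<close>

definition R :: "nat \<Rightarrow> real" where
  "R n = \<sigma> * (\<Omega> * sqrt (2 / \<mu>)) * (real n * (real n + 1) / sqrt (3 * real n))"

text \<open>
  Weight of each normalised squared noise term in the sum of the \<open>quad (A n) t\<close>; the second index is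
  \<open>0\<close> for \<open>eG\<close>, \<open>1\<close> for \<open>e1\<close> and \<open>2\<close> for \<open>e2\<close>.
\<close>

definition weight :: "nat \<Rightarrow> nat \<times> nat \<Rightarrow> real" where
  "weight n = (\<lambda>(t, k).
     if k = 0 then (real t)\<^sup>2 / (2 * b t) * \<sigma>\<^sub>G\<^sup>2 + (real t)\<^sup>2 / (2 * \<mu> * A n) * ((\<sigma>\<^sub>G + \<sigma>\<^sub>H) * \<sigma>\<^sub>G)
     else if k = 1 then (real t)\<^sup>2 / (2 * b t) * (2 * \<sigma>\<^sub>H\<^sup>2)
     else (real t)\<^sup>2 / (2 * b t) * (2 * \<sigma>\<^sub>H\<^sup>2) + (real t)\<^sup>2 / (2 * \<mu> * A n) * ((\<sigma>\<^sub>G + \<sigma>\<^sub>H) * \<sigma>\<^sub>H))"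

definition sq :: "nat \<times> nat \<Rightarrow> 'w \<Rightarrow> real" where
  "sq = (\<lambda>(t, k). if k = 0 then (\<lambda>\<theta>. (dual_norm N (eG t \<theta>) / \<sigma>\<^sub>G)\<^sup>2)
     else if k = 1 then (\<lambda>\<theta>. (dual_norm N (e1 t \<theta>) / \<sigma>\<^sub>H)\<^sup>2)
     else (\<lambda>\<theta>. (dual_norm N (e2 t \<theta>) / \<sigma>\<^sub>H)\<^sup>2))"

abbreviation idx :: "nat \<Rightarrow> (nat \<times> nat) set" where
  "idx n \<equiv> {1..n} \<times> {0, 1, 2}"

text \<open>Each normalised square has mean at most 1, so \<open>W n\<close> bounds the mean of the
  weighted sum; it is also the scale of its exponential tail.\<close>

definition W :: "nat \<Rightarrow> real" where
  "W n = (\<Sum>i\<in>idx n. weight n i)"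

lemma \<sigma>_square: "\<sigma>\<^sup>2 = \<sigma>\<^sub>H\<^sup>2 + \<sigma>\<^sub>G\<^sup>2"
  by (simp add: \<sigma>_eq)

lemma \<sigma>_le: "\<sigma> \<le> \<sigma>\<^sub>G + \<sigma>\<^sub>H"
  using sqrt_sum_squares_le_sum[of \<sigma>\<^sub>H \<sigma>\<^sub>G] sigmas_nonneg by (simp add: \<sigma>_eq)

lemma \<sigma>_eq_0_iff: "\<sigma> = 0 \<longleftrightarrow> \<sigma>\<^sub>G = 0 \<and> \<sigma>\<^sub>H = 0"
  by (auto simp: \<sigma>_eq)

lemma A_nonneg: "0 \<le> A n"
  using sigmas_nonneg \<Omega>_pos \<mu>_pos by (simp add: A_def)

lemma A_eq_0: "1 \<le> n \<Longrightarrow> A n = 0 \<Longrightarrow> \<sigma>\<^sub>G = 0 \<and> \<sigma>\<^sub>H = 0"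
  using sigmas_nonneg \<Omega>_pos \<mu>_pos by (auto simp: A_def)

lemma K_nonneg: "0 \<le> K n"
  using sigmas_nonneg \<Omega>_pos \<mu>_pos by (simp add: K_def)

lemma K_le:
  assumes "2 \<le> n"
  shows "K n \<le> (\<sigma>\<^sub>G + \<sigma>\<^sub>H) * \<Omega> / sqrt (\<mu> * (real n - 1))"
  unfolding K_def using assms sigmas_nonneg \<Omega>_pos \<mu>_pos
  by (intro divide_left_mono mult_nonneg_nonneg mult_pos_pos) auto

lemma weight_nonneg: "0 \<le> weight n i"
  using sigmas_nonneg b_nonneg A_nonneg \<mu>_pos by (auto simp: weight_def split: prod.split)

text \<open>In units of \<open>K n\<close>, the summand \<open>b n\<close> of the last step size
  costs \<open>sqrt 2\<close> and the Bregman terms of the auxiliary sequence cost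
  \<open>2 / sqrt 6\<close>.\<close>

lemma Det_le:
  assumes n: "1 \<le> n"
  shows "2 / (real n * (real n + 1)) * Det n
    \<le> 8 * L\<^sub>G * \<Omega>\<^sup>2 / (\<mu> * real n * (real n + 1)) + 6 * L\<^sub>H * \<Omega>\<^sup>2 / (\<mu> * (real n + 1)) + 2.232 * K n"
proof -
  let ?p = "2 / (real n * (real n + 1))"
  have n0: "0 < real n" using n by simp
  have gam: "real n / \<gamma> n = (4 * L\<^sub>G + 3 * L\<^sub>H * real n + b n) / \<mu>"
    using denominator_pos[OF n] n \<mu>_pos by (simp add: \<gamma>_eq[OF n] b_def)
  have "?p * (real n / \<gamma> n * \<Omega>\<^sup>2)
      = 8 * L\<^sub>G * \<Omega>\<^sup>2 / (\<mu> * real n * (real n + 1)) + 6 * L\<^sub>H * \<Omega>\<^sup>2 / (\<mu> * (real n + 1)) + ?p * (b n / \<mu> * \<Omega>\<^sup>2)"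
  proof -
    have "?p * (4 * L\<^sub>G / \<mu> * \<Omega>\<^sup>2) = 8 * L\<^sub>G * \<Omega>\<^sup>2 / (\<mu> * real n * (real n + 1))"
      "?p * (3 * L\<^sub>H * real n / \<mu> * \<Omega>\<^sup>2) = 6 * L\<^sub>H * \<Omega>\<^sup>2 / (\<mu> * (real n + 1))"
      using n0 \<mu>_pos by (simp_all add: divide_simps)
    then show ?thesis
      unfolding gam add_divide_distrib distrib_right distrib_left by simp
  qed
  moreover have "?p * (b n / \<mu> * \<Omega>\<^sup>2) = sqrt 2 * (\<sigma> * \<Omega> / sqrt (\<mu> * real n))"
  proof -
    define s where "s = sqrt (\<mu> * real n)"
    have s: "0 < s" "\<mu> * real n = s * s"
      using n0 \<mu>_pos by (auto simp: s_def)
    have "?p * (b n / \<mu> * \<Omega>\<^sup>2) = 2 * \<sigma> * s * \<Omega> / (sqrt 2 * (\<mu> * real n))"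
    proof -
      have "2 / (m * k) * (\<sigma> * k * s / (q * \<Omega>) / \<mu> * \<Omega>\<^sup>2) = 2 * \<sigma> * s * \<Omega> / (q * (\<mu> * m))"
        if "m \<noteq> 0" "k \<noteq> 0" "q \<noteq> 0" for m k q :: real
        using that \<Omega>_pos \<mu>_pos by (simp add: field_simps power2_eq_square)
      from this[of "real n" "real n + 1" "sqrt 2"] show ?thesis
        unfolding b_def s_def[symmetric] using n0 by simp
    qed
    also have "\<dots> = 2 / sqrt 2 * (\<sigma> * \<Omega> / s)"
      unfolding s(2) using s(1) by (simp add: field_simps)
    finally show ?thesis
      by (simp add: s_def real_div_sqrt)
  qed
  moreover have "?p * (A n * \<Omega>\<^sup>2) = 2 / sqrt 6 * K n"
  proof -
    have "sqrt (6 * \<mu> * real n) = sqrt 6 * sqrt (\<mu> * real n)"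
      by (simp add: real_sqrt_mult)
    moreover have "2 / (m * k) * (s * (m * k) / (\<Omega> * (q * x)) * \<Omega>\<^sup>2) = 2 / q * (s * \<Omega> / x)"
      if "m \<noteq> 0" "k \<noteq> 0" for m k s q x :: real
      using that \<Omega>_pos by (simp add: power2_eq_square)
    from this[of "real n" "real n + 1" "\<sigma>\<^sub>G + \<sigma>\<^sub>H" "sqrt 6" "sqrt (\<mu> * real n)"]
    have "?p * ((\<sigma>\<^sub>G + \<sigma>\<^sub>H) * (real n * (real n + 1)) / (\<Omega> * (sqrt 6 * sqrt (\<mu> * real n))) * \<Omega>\<^sup>2)
        = 2 / sqrt 6 * ((\<sigma>\<^sub>G + \<sigma>\<^sub>H) * \<Omega> / sqrt (\<mu> * real n))"
      using n0 by linarith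
    ultimately show ?thesis
      by (simp only: A_def K_def)
  qed
  moreover have "sqrt 2 * (\<sigma> * \<Omega> / sqrt (\<mu> * real n)) \<le> 1.415 * K n"
    unfolding K_def using numeric_sqrt_bounds(1) \<sigma>_le \<sigma>_nonneg \<Omega>_pos \<mu>_pos
    by (intro mult_mono divide_right_mono mult_right_mono) auto
  moreover have "2 / sqrt 6 * K n \<le> 0.817 * K n"
    by (intro mult_right_mono numeric_sqrt_bounds K_nonneg)
  ultimately show ?thesis
    unfolding Det_def distrib_left by linarith
qed

text \<open>The squares from the prox-steps contribute \<open>8 / 3 * sqrt 2\<close>, those of the
  auxiliary sequence at most \<open>2 / sqrt 6\<close>. The latter repeats the Bregman cost in
  \<open>Det n\<close> because \<open>A n\<close> balances the two.\<close>

lemma W_le: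
  assumes n: "1 \<le> n"
  shows "2 / (real n * (real n + 1)) * W n \<le> 4.591 * K n"
proof -
  let ?p = "2 / (real n * (real n + 1))" and ?s = "\<sigma>\<^sub>G + \<sigma>\<^sub>H"
  have n0: "0 < real n" using n by simp
  have p: "0 \<le> ?p" by simp
  have "W n = (\<Sum>t=1..n. weight n (t, 0) + weight n (t, 1) + weight n (t, 2))"
  proof -
    have "W n = (\<Sum>t=1..n. \<Sum>k\<in>{0, 1, 2}. weight n (t, k))"
      unfolding W_def sum.cartesian_product by simp
    then show ?thesis by (simp add: add.assoc)
  qed
  also have "\<dots> = (\<Sum>t=1..n. (real t)\<^sup>2 / (2 * b t) * (\<sigma>\<^sub>G\<^sup>2 + 4 * \<sigma>\<^sub>H\<^sup>2) + (real t)\<^sup>2 * (?s\<^sup>2 / (2 * \<mu> * A n)))"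
    by (intro sum.cong refl) (simp add: weight_def power2_eq_square algebra_simps add_divide_distrib)
  also have "\<dots> = (\<Sum>t=1..n. (real t)\<^sup>2 / (2 * b t) * (\<sigma>\<^sub>G\<^sup>2 + 4 * \<sigma>\<^sub>H\<^sup>2))
      + real n * (real n + 1) * (2 * real n + 1) / 6 * (?s\<^sup>2 / (2 * \<mu> * A n))"
    by (simp only: sum.distrib sum_squares_eq sum_distrib_right[symmetric])
  finally have W: "W n = \<dots>" .
  have "(\<Sum>t=1..n. (real t)\<^sup>2 / (2 * b t) * (\<sigma>\<^sub>G\<^sup>2 + 4 * \<sigma>\<^sub>H\<^sup>2))
      \<le> (\<Sum>t=1..n. 2 * sqrt 2 * \<sigma> * \<Omega> / sqrt \<mu> * (sqrt (real t) * real t / (real t + 1)))"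
  proof (rule sum_mono)
    fix t assume "t \<in> {1..n}"
    then have t: "0 < real t" by simp
    \<comment> \<open>The operator errors enter through
      \<open>(x + y)\<^sup>2 \<le> 2 * x\<^sup>2 + 2 * y\<^sup>2\<close>, hence the 4. Enlarging to
      \<open>4 * \<sigma>\<^sup>2\<close> lets one factor \<sigma> cancel against
      \<open>b t\<close>.\<close>
    have "(real t)\<^sup>2 / (2 * b t) * (\<sigma>\<^sub>G\<^sup>2 + 4 * \<sigma>\<^sub>H\<^sup>2) \<le> (real t)\<^sup>2 / (2 * b t) * (4 * \<sigma>\<^sup>2)"
      using b_nonneg by (intro mult_left_mono) (auto simp: \<sigma>_square)
    also have "\<dots> = 2 * sqrt 2 * \<sigma> * \<Omega> / sqrt \<mu> * (sqrt (real t) * real t / (real t + 1))"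
    proof (cases "\<sigma> = 0")
      case False
      define x where "x = sqrt (real t)"
      have x: "0 < x" "real t = x * x" using t by (auto simp: x_def)
      have b: "b t = \<sigma> * (real t + 1) * (sqrt \<mu> * x) / (sqrt 2 * \<Omega>)"
        by (simp add: b_def x_def real_sqrt_mult)
      have eq: "(x * x)\<^sup>2 / (2 * (\<sigma> * k * (m * x) / (q * \<Omega>))) * (4 * \<sigma>\<^sup>2) = 2 * q * \<sigma> * \<Omega> / m * (x * (x * x) / k)"
        if "k \<noteq> 0" "m \<noteq> 0" "q \<noteq> 0" for k m q :: real
        using that False x(1) \<Omega>_pos by (simp add: field_simps power2_eq_square)
      show ?thesis
        unfolding x_def[symmetric] b unfolding x(2)
        by (rule eq) (use x(1) \<mu>_pos zero_le_square[of x] in \<open>auto simp: add_nonneg_eq_0_iff\<close>)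
    qed simp
    finally show "(real t)\<^sup>2 / (2 * b t) * (\<sigma>\<^sub>G\<^sup>2 + 4 * \<sigma>\<^sub>H\<^sup>2)
      \<le> 2 * sqrt 2 * \<sigma> * \<Omega> / sqrt \<mu> * (sqrt (real t) * real t / (real t + 1))" .
  qed
  also have "\<dots> = 2 * sqrt 2 * \<sigma> * \<Omega> / sqrt \<mu> * (\<Sum>t=1..n. sqrt (real t) * real t / (real t + 1))"
    by (simp only: sum_distrib_left)
  also have "\<dots> \<le> 2 * sqrt 2 * \<sigma> * \<Omega> / sqrt \<mu> * (2 / 3 * (real n * sqrt (real n)))"
    using \<sigma>_nonneg \<Omega>_pos \<mu>_pos by (intro mult_left_mono sum_sqrt_weighted_le) auto
  finally have "?p * (\<Sum>t=1..n. (real t)\<^sup>2 / (2 * b t) * (\<sigma>\<^sub>G\<^sup>2 + 4 * \<sigma>\<^sub>H\<^sup>2))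
      \<le> ?p * (2 * sqrt 2 * \<sigma> * \<Omega> / sqrt \<mu> * (2 / 3 * (real n * sqrt (real n))))"
    using p by (rule mult_left_mono)
  also have "\<dots> = 8 / 3 * sqrt 2 * (\<sigma> * \<Omega> / sqrt \<mu> * (sqrt (real n) / (real n + 1)))"
  proof -
    have cancel: "2 / (m * k) * (2 * q * s * x / y * (2 / 3 * (m * z))) = 8 / 3 * q * (s * x / y * (z / k))"
      if "m \<noteq> 0" for m k q s x y z :: real
      using that by (simp add: divide_simps)
    show ?thesis
      by (rule cancel) (use n0 in simp)
  qed
  also have "\<dots> \<le> 8 / 3 * 1.415 * (?s * \<Omega> / sqrt \<mu> * (1 / sqrt (real n)))"
  proof (intro mult_mono divide_right_mono mult_right_mono)
    show "sqrt (real n) / (real n + 1) \<le> 1 / sqrt (real n)"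
      using n0 by (simp add: divide_simps)
  qed (use numeric_sqrt_bounds(1) \<sigma>_le \<sigma>_nonneg sigmas_nonneg \<Omega>_pos \<mu>_pos in auto)
  also have "\<dots> = 8 / 3 * 1.415 * K n"
    by (simp add: K_def real_sqrt_mult)
  also have "\<dots> \<le> 3.774 * K n"
    by (intro mult_right_mono K_nonneg) simp
  finally have 1: "?p * (\<Sum>t=1..n. (real t)\<^sup>2 / (2 * b t) * (\<sigma>\<^sub>G\<^sup>2 + 4 * \<sigma>\<^sub>H\<^sup>2)) \<le> 3.774 * K n" .
  have "?p * (real n * (real n + 1) * (2 * real n + 1) / 6 * (?s\<^sup>2 / (2 * \<mu> * A n))) \<le> 2 / sqrt 6 * K n"
  proof (cases "?s = 0")
    case False
    then have s: "0 < ?s" using sigmas_nonneg by auto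
    define x where "x = sqrt (\<mu> * real n)"
    have x: "0 < x" "\<mu> * real n = x * x" using n0 \<mu>_pos by (auto simp: x_def)
    have "sqrt (6 * \<mu> * real n) = sqrt 6 * x"
      by (simp add: real_sqrt_mult x_def)
    then have A: "A n = ?s * (real n * (real n + 1)) / (\<Omega> * (sqrt 6 * x))"
      by (simp add: A_def)
    have cancel: "2 / (m * k) * (m * k * l / 6 * (z\<^sup>2 / (2 * \<mu> * (z * (m * k) / (\<Omega> * (q * x))))))
        = l / k * (q / 6 * (z * \<Omega> * x / (\<mu> * m)))"
      if "m \<noteq> 0" "k \<noteq> 0" "z \<noteq> 0" "q \<noteq> 0" for m k l z q :: real
      using that \<mu>_pos \<Omega>_pos x(1) by (simp add: field_simps power2_eq_square)
    have "?p * (real n * (real n + 1) * (2 * real n + 1) / 6 * (?s\<^sup>2 / (2 * \<mu> * A n)))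
        = (2 * real n + 1) / (real n + 1) * (sqrt 6 / 6 * (?s * \<Omega> * x / (\<mu> * real n)))"
      unfolding A by (rule cancel) (use s n0 in auto)
    also have "\<dots> \<le> 2 * (sqrt 6 / 6 * (?s * \<Omega> * x / (\<mu> * real n)))"
      using s n0 \<mu>_pos \<Omega>_pos x(1) by (intro mult_right_mono) (auto simp: divide_simps)
    also have "\<dots> = 2 / sqrt 6 * K n"
    proof -
      have "sqrt 6 / 6 = 1 / sqrt (6::real)"
        using real_div_sqrt[of 6] by (simp add: divide_simps)
      moreover have "?s * \<Omega> * x / (\<mu> * real n) = K n"
        unfolding K_def x_def[symmetric] x(2) using x(1) by simp
      ultimately show ?thesis by (simp only:)
    qed
    finally show ?thesis .
  qed (simp add: K_nonneg)
  also have "\<dots> \<le> 0.817 * K n"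
    by (intro mult_right_mono numeric_sqrt_bounds K_nonneg)
  finally show ?thesis
    using 1 unfolding W by (subst distrib_left) linarith
qed

lemma R_le:
  assumes n: "1 \<le> n"
  shows "2 / (real n * (real n + 1)) * R n \<le> 1.634 * K n"
proof -
  have n0: "0 < real n" using n by simp
  have "2 / (real n * (real n + 1)) * R n = 2 * (\<sigma> * (\<Omega> * sqrt (2 / \<mu>)) / sqrt (3 * real n))"
  proof -
    have "2 / m * (x * (m / y)) = 2 * (x / y)" if "m \<noteq> 0" for m x y :: real
      using that by simp
    then show ?thesis
      unfolding R_def using n0 by simp
  qed
  also have "\<dots> = 2 * sqrt 2 / sqrt 3 * (\<sigma> * \<Omega> / sqrt (\<mu> * real n))"
    by (simp add: real_sqrt_mult real_sqrt_divide mult_ac)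
  also have "\<dots> \<le> 1.634 * K n"
    unfolding K_def using numeric_sqrt_bounds(3) \<sigma>_le \<sigma>_nonneg \<Omega>_pos \<mu>_pos
    by (intro mult_mono divide_right_mono mult_right_mono) auto
  finally show ?thesis .
qed

lemma sum_variance_proxy_le:
  assumes n: "1 \<le> n"
  shows "(\<Sum>t=1..n. (real t * \<sigma> * (\<Omega> * sqrt (2 / \<mu>)))\<^sup>2) \<le> (R n)\<^sup>2"
proof -
  have n0: "0 < real n" using n by simp
  have "(\<Sum>t=1..n. (real t * \<sigma> * (\<Omega> * sqrt (2 / \<mu>)))\<^sup>2)
      = (\<sigma> * (\<Omega> * sqrt (2 / \<mu>)))\<^sup>2 * (real n * (real n + 1) * (2 * real n + 1) / 6)"
    unfolding sum_squares_eq[symmetric] sum_distrib_left by (simp add: power_mult_distrib mult_ac)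
  also have "\<dots> \<le> (\<sigma> * (\<Omega> * sqrt (2 / \<mu>)))\<^sup>2 * (real n * (real n + 1) / sqrt (3 * real n))\<^sup>2"
  proof (rule mult_left_mono)
    have "(real n * (real n + 1) / sqrt (3 * real n))\<^sup>2 = real n * (real n + 1) * (real n + 1) / 3"
      using n0 by (simp add: power_divide power2_eq_square field_simps)
    moreover have "real n * (real n + 1) * (2 * real n + 1) \<le> real n * (real n + 1) * (2 * (real n + 1))"
      by (intro mult_left_mono) auto
    moreover have "real n * (real n + 1) * (2 * (real n + 1)) = 2 * (real n * (real n + 1) * (real n + 1))"
      by simp
    ultimately show "real n * (real n + 1) * (2 * real n + 1) / 6 \<le> (real n * (real n + 1) / sqrt (3 * real n))\<^sup>2"
      by linarith
  qed simp
  finally show ?thesis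
    by (simp only: R_def power_mult_distrib)
qed

text \<open>In the auxiliary term the triangle inequality leaves
  \<open>\<sigma>\<^sub>G * x + \<sigma>\<^sub>H * z\<close>. Convexity of the square with weights
  \<open>\<sigma>\<^sub>G\<close> and \<open>\<sigma>\<^sub>H\<close> distributes it over
  \<open>x\<^sup>2\<close> and \<open>z\<^sup>2\<close> at total weight
  \<open>(\<sigma>\<^sub>G + \<sigma>\<^sub>H)\<^sup>2\<close>.\<close>

lemma quad_le:
  assumes "dual_norm N (eG t \<theta>) = \<sigma>\<^sub>G * (dual_norm N (eG t \<theta>) / \<sigma>\<^sub>G)"
    and "dual_norm N (e1 t \<theta>) = \<sigma>\<^sub>H * (dual_norm N (e1 t \<theta>) / \<sigma>\<^sub>H)"
    and "dual_norm N (e2 t \<theta>) = \<sigma>\<^sub>H * (dual_norm N (e2 t \<theta>) / \<sigma>\<^sub>H)"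
  shows "quad (A n) t \<theta> \<le> (\<Sum>k\<in>{0, 1, 2}. weight n (t, k) * sq (t, k) \<theta>)"
proof -
  obtain x y z where x: "dual_norm N (eG t \<theta>) / \<sigma>\<^sub>G = x" and y: "dual_norm N (e1 t \<theta>) / \<sigma>\<^sub>H = y"
    and z: "dual_norm N (e2 t \<theta>) / \<sigma>\<^sub>H = z" by blast
  note d = assms[unfolded x y z]
  have "(\<sigma>\<^sub>H * z + \<sigma>\<^sub>H * y)\<^sup>2 \<le> 2 * \<sigma>\<^sub>H\<^sup>2 * y\<^sup>2 + 2 * \<sigma>\<^sub>H\<^sup>2 * z\<^sup>2"
    using zero_le_power2[of "\<sigma>\<^sub>H * z - \<sigma>\<^sub>H * y"] by (simp add: power2_eq_square algebra_simps)
  then have "(\<sigma>\<^sub>H * z + \<sigma>\<^sub>H * y)\<^sup>2 + (\<sigma>\<^sub>G * x)\<^sup>2 \<le> \<sigma>\<^sub>G\<^sup>2 * x\<^sup>2 + 2 * \<sigma>\<^sub>H\<^sup>2 * y\<^sup>2 + 2 * \<sigma>\<^sub>H\<^sup>2 * z\<^sup>2"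
    by (simp add: power_mult_distrib)
  then have 1: "(real t)\<^sup>2 / (2 * b t) * ((\<sigma>\<^sub>H * z + \<sigma>\<^sub>H * y)\<^sup>2 + (\<sigma>\<^sub>G * x)\<^sup>2)
      \<le> (real t)\<^sup>2 / (2 * b t) * (\<sigma>\<^sub>G\<^sup>2 * x\<^sup>2 + 2 * \<sigma>\<^sub>H\<^sup>2 * y\<^sup>2 + 2 * \<sigma>\<^sub>H\<^sup>2 * z\<^sup>2)"
    by (rule mult_left_mono) (simp add: b_nonneg)
  have "(dual_norm N (eG t \<theta> + e2 t \<theta>))\<^sup>2 \<le> (\<sigma>\<^sub>G * x + \<sigma>\<^sub>H * z)\<^sup>2"
    using dual_norm_triangle[OF norm, of "eG t \<theta>" "e2 t \<theta>"] dual_norm_nonneg[OF norm]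
    unfolding d(1) d(3) by (intro power_mono) auto
  also have "\<dots> \<le> (\<sigma>\<^sub>G + \<sigma>\<^sub>H) * \<sigma>\<^sub>G * x\<^sup>2 + (\<sigma>\<^sub>G + \<sigma>\<^sub>H) * \<sigma>\<^sub>H * z\<^sup>2"
  proof -
    have "0 \<le> \<sigma>\<^sub>G * \<sigma>\<^sub>H * (x - z)\<^sup>2"
      using sigmas_nonneg by simp
    then show ?thesis
      by (simp add: power2_eq_square algebra_simps)
  qed
  finally have 2: "(real t)\<^sup>2 / (2 * \<mu> * A n) * (dual_norm N (eG t \<theta> + e2 t \<theta>))\<^sup>2
      \<le> (real t)\<^sup>2 / (2 * \<mu> * A n) * ((\<sigma>\<^sub>G + \<sigma>\<^sub>H) * \<sigma>\<^sub>G * x\<^sup>2 + (\<sigma>\<^sub>G + \<sigma>\<^sub>H) * \<sigma>\<^sub>H * z\<^sup>2)"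
    using \<mu>_pos A_nonneg by (intro mult_left_mono) auto
  have "quad (A n) t \<theta> = (real t)\<^sup>2 / (2 * b t) * ((\<sigma>\<^sub>H * z + \<sigma>\<^sub>H * y)\<^sup>2 + (\<sigma>\<^sub>G * x)\<^sup>2)
      + (real t)\<^sup>2 / (2 * \<mu> * A n) * (dual_norm N (eG t \<theta> + e2 t \<theta>))\<^sup>2"
    unfolding quad_def d[symmetric] by (simp add: power2_eq_square[of "real t"])
  also have "\<dots> \<le> (\<Sum>k\<in>{0, 1, 2}. weight n (t, k) * sq (t, k) \<theta>)"
    using add_mono[OF 1 2] by (simp add: weight_def sq_def x y z algebra_simps add_divide_distrib)
  finally show ?thesis .
qed

end

section \<open>Moments of the noise terms and the almost sure bound\<close>

context stochastic_amp
begin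

lemma r_direction:
  assumes t: "1 \<le> t"
  shows r_direction_measurable: "(\<lambda>\<theta>. c *\<^sub>R (r t \<theta> - aux a t \<theta>)) \<in> borel_measurable (info (past t))"
    and r_direction_le: "\<theta> \<in> space M \<Longrightarrow> N (c *\<^sub>R (r t \<theta> - aux a t \<theta>)) \<le> \<bar>c\<bar> * (\<Omega> * sqrt (2 / \<mu>))"
proof -
  note [measurable] = RZ_borel[OF r_measurable[OF t]] RZ_borel[OF aux_measurable[OF t]]
  show "(\<lambda>\<theta>. c *\<^sub>R (r t \<theta> - aux a t \<theta>)) \<in> borel_measurable (info (past t))"
    by measurable
  show "\<theta> \<in> space M \<Longrightarrow> N (c *\<^sub>R (r t \<theta> - aux a t \<theta>)) \<le> \<bar>c\<bar> * (\<Omega> * sqrt (2 / \<mu>))"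
    using t unfolding is_norm_scaleR[OF norm] by (intro mult_left_mono diameter_bound r_in_Z aux_in_Z) auto
qed

lemma w_direction:
  assumes t: "1 \<le> t"
  shows w_direction_measurable: "(\<lambda>\<theta>. c *\<^sub>R (w (t + 1) \<theta> - aux a t \<theta>)) \<in> borel_measurable (info (mid t))"
    and w_direction_le: "\<theta> \<in> space M \<Longrightarrow> N (c *\<^sub>R (w (t + 1) \<theta> - aux a t \<theta>)) \<le> \<bar>c\<bar> * (\<Omega> * sqrt (2 / \<mu>))"
proof -
  note [measurable] = RZ_borel[OF w_measurable[OF t]]
    RZ_borel[OF measurable_info_mono[OF past_subset_mid aux_measurable[OF t]]]
  show "(\<lambda>\<theta>. c *\<^sub>R (w (t + 1) \<theta> - aux a t \<theta>)) \<in> borel_measurable (info (mid t))"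
    by measurable
  show "\<theta> \<in> space M \<Longrightarrow> N (c *\<^sub>R (w (t + 1) \<theta> - aux a t \<theta>)) \<le> \<bar>c\<bar> * (\<Omega> * sqrt (2 / \<mu>))"
    using t unfolding is_norm_scaleR[OF norm] by (intro mult_left_mono diameter_bound w_in_Z aux_in_Z) auto
qed

lemma mart_mean_zero:
  assumes t: "1 \<le> t"
  shows integrable_mart: "integrable M (mart a t)" and expectation_mart: "expectation (mart a t) = 0"
proof -
  note G = oracle_call.inner_noise_mean_zero[OF call_G[OF t] r_direction_measurable[OF t] r_direction_le[OF t],
      unfolded noise_eG[OF t]]
  note H = oracle_call.inner_noise_mean_zero[OF call_H2[OF t] w_direction_measurable[OF t] w_direction_le[OF t],
      unfolded noise_e2[OF t]]
  have int: "integrable M (\<lambda>\<theta>. inner (eG t \<theta>) (- real t *\<^sub>R (r t \<theta> - aux a t \<theta>)))"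
    "integrable M (\<lambda>\<theta>. inner (e2 t \<theta>) (- real t *\<^sub>R (w (t + 1) \<theta> - aux a t \<theta>)))"
    by (rule G(1) H(1); assumption)+
  show "integrable M (mart a t)"
    unfolding mart_def by (intro Bochner_Integration.integrable_add int)
  show "expectation (mart a t) = 0"
    unfolding mart_def by (subst Bochner_Integration.integral_add[OF int]) (simp only: G(2) H(2))
qed

lemma mart_measurable:
  assumes t: "1 \<le> t"
  shows "mart a t \<in> borel_measurable (info (past (t + 1)))"
proof -
  note to_past = measurable_info_mono[OF mid_subset_past[of t]]
  note [measurable] = to_past[OF eG_measurable[OF t]] e2_measurable[OF t]
    to_past[OF w_direction_measurable[OF t]]
    to_past[OF measurable_info_mono[OF past_subset_mid r_direction_measurable[OF t]]]
  show ?thesis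
    unfolding mart_def by measurable
qed

lemma sq_moments:
  assumes t: "1 \<le> t"
  shows integrable_sq: "integrable M (sq (t, k))" and expectation_sq_le: "expectation (sq (t, k)) \<le> 1"
  using oracle_call.noise_square_scaled[OF call_G[OF t], unfolded noise_eG[OF t]]
    oracle_call.noise_square_scaled[OF call_H1[OF t], unfolded noise_e1[OF t]]
    oracle_call.noise_square_scaled[OF call_H2[OF t], unfolded noise_e2[OF t]]
  by (simp_all add: sq_def)

lemma AE_noise_scaled:
  "AE \<theta> in M. \<forall>t\<in>{1..n}. dual_norm N (eG t \<theta>) = \<sigma>\<^sub>G * (dual_norm N (eG t \<theta>) / \<sigma>\<^sub>G)
    \<and> dual_norm N (e1 t \<theta>) = \<sigma>\<^sub>H * (dual_norm N (e1 t \<theta>) / \<sigma>\<^sub>H)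
    \<and> dual_norm N (e2 t \<theta>) = \<sigma>\<^sub>H * (dual_norm N (e2 t \<theta>) / \<sigma>\<^sub>H)"
proof (rule AE_finite_allI)
  fix t assume "t \<in> {1..n}"
  then have t: "1 \<le> t" by simp
  show "AE \<theta> in M. dual_norm N (eG t \<theta>) = \<sigma>\<^sub>G * (dual_norm N (eG t \<theta>) / \<sigma>\<^sub>G)
    \<and> dual_norm N (e1 t \<theta>) = \<sigma>\<^sub>H * (dual_norm N (e1 t \<theta>) / \<sigma>\<^sub>H)
    \<and> dual_norm N (e2 t \<theta>) = \<sigma>\<^sub>H * (dual_norm N (e2 t \<theta>) / \<sigma>\<^sub>H)"
    using oracle_call.noise_scaled[OF call_G[OF t], unfolded noise_eG[OF t]]
      oracle_call.noise_scaled[OF call_H1[OF t], unfolded noise_e1[OF t]]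
      oracle_call.noise_scaled[OF call_H2[OF t], unfolded noise_e2[OF t]]
    by eventually_elim blast
qed simp

text \<open>The bound is only almost sure: where a variance parameter is 0, the oracle may err on a
  null set, and division by 0 would discard that error.\<close>

lemma AE_gap_bound:
  assumes n: "1 \<le> n"
  shows "AE \<theta> in M. gap Z G H J (wag (n + 1) \<theta>) \<le> 2 / (real n * (real n + 1))
    * (Det n + (\<Sum>i\<in>idx n. weight n i * sq i \<theta>) + (\<Sum>t=1..n. mart (A n) t \<theta>))"
  using AE_noise_scaled[of n] AE_space
proof eventually_elim
  case (elim \<theta>)
  note scaled = bspec[OF elim(1)]
  have "exact_if_noiseless (A n) t \<theta>" if t: "t \<in> {1..n}" for t
  proof -
    have zero: "dual_norm N (eG t \<theta>) = 0 \<and> dual_norm N (e1 t \<theta>) = 0 \<and> dual_norm N (e2 t \<theta>) = 0"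
      if "\<sigma>\<^sub>G = 0 \<and> \<sigma>\<^sub>H = 0"
      using scaled[OF t] that by auto
    have "dual_norm N (eG t \<theta> + e2 t \<theta>) = 0" if "\<sigma>\<^sub>G = 0 \<and> \<sigma>\<^sub>H = 0"
      using zero[OF that] dual_norm_triangle[OF norm, of "eG t \<theta>" "e2 t \<theta>"]
        dual_norm_nonneg[OF norm, of "eG t \<theta> + e2 t \<theta>"] by simp
    with zero show ?thesis
      using A_eq_0[OF n] \<sigma>_eq_0_iff unfolding exact_if_noiseless_def by blast
  qed
  from gap_bound[OF n elim(2) A_nonneg this]
  have "real n * (real n + 1) / 2 * gap Z G H J (wag (n + 1) \<theta>)
      \<le> Det n + (\<Sum>t=1..n. quad (A n) t \<theta>) + (\<Sum>t=1..n. mart (A n) t \<theta>)"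
    by (simp add: Det_def)
  also have "(\<Sum>t=1..n. quad (A n) t \<theta>) \<le> (\<Sum>t=1..n. \<Sum>k\<in>{0, 1, 2}. weight n (t, k) * sq (t, k) \<theta>)"
    using scaled by (intro sum_mono quad_le) blast+
  also have "\<dots> = (\<Sum>i\<in>idx n. weight n i * sq i \<theta>)"
    unfolding sum.cartesian_product by (intro sum.cong) auto
  finally have le: "real n * (real n + 1) / 2 * gap Z G H J (wag (n + 1) \<theta>)
      \<le> Det n + (\<Sum>i\<in>idx n. weight n i * sq i \<theta>) + (\<Sum>t=1..n. mart (A n) t \<theta>)"
    by simp
  have scale: "g \<le> 2 / m * B" if "m / 2 * g \<le> B" "0 < m" for m g B :: real
    using that by (simp add: field_simps)
  show ?case
    by (rule scale[OF le]) (use n in simp)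
qed

lemma gap_measurable: "1 \<le> t \<Longrightarrow> (\<lambda>\<theta>. gap Z G H J (wag t \<theta>)) \<in> borel_measurable M"
proof -
  assume t: "1 \<le> t"
  interpret fresh_sample M "info (past t)" S "\<xi> t"
    using t by (intro fresh_xi past_subset) (auto simp: past_def)
  show ?thesis
    by (rule measurable_compose[OF measurable_F[OF wag_measurable[OF t]] measurable_gap])
qed

lemma expectation_gap_le:
  assumes n: "1 \<le> n"
  shows "integrable M (\<lambda>\<theta>. gap Z G H J (wag (n + 1) \<theta>))"
    and "expectation (\<lambda>\<theta>. gap Z G H J (wag (n + 1) \<theta>))
      \<le> 8 * L\<^sub>G * \<Omega>\<^sup>2 / (\<mu> * real n * (real n + 1)) + 6 * L\<^sub>H * \<Omega>\<^sup>2 / (\<mu> * (real n + 1)) + 7 * K n"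
proof -
  let ?p = "2 / (real n * (real n + 1))"
  let ?q = "\<lambda>\<theta>. \<Sum>i\<in>idx n. weight n i * sq i \<theta>" and ?m = "\<lambda>\<theta>. \<Sum>t=1..n. mart (A n) t \<theta>"
  have int_q: "integrable M ?q" and int_m: "integrable M ?m"
    using integrable_sq integrable_mart by (auto intro!: Bochner_Integration.integrable_sum integrable_mult_right)
  have int: "integrable M (\<lambda>\<theta>. ?p * (Det n + ?q \<theta> + ?m \<theta>))"
    by (intro integrable_mult_right Bochner_Integration.integrable_add int_q int_m integrable_const)
  show int_gap: "integrable M (\<lambda>\<theta>. gap Z G H J (wag (n + 1) \<theta>))"
  \<comment> \<open>The gap is nonnegative, so the one-sided bound controls its absolute
    value.\<close>
  proof (rule Bochner_Integration.integrable_bound[OF int])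
    show "AE \<theta> in M. norm (gap Z G H J (wag (n + 1) \<theta>)) \<le> norm (?p * (Det n + ?q \<theta> + ?m \<theta>))"
      using AE_gap_bound[OF n] AE_space
    proof eventually_elim
      case (elim \<theta>)
      moreover have "0 \<le> gap Z G H J (wag (n + 1) \<theta>)"
        using elim(2) by (intro gap_nonneg wag_in_Z) simp
      ultimately show ?case
        unfolding real_norm_def by linarith
    qed
  qed (rule gap_measurable, simp)
  have "expectation ?q = (\<Sum>i\<in>idx n. weight n i * expectation (sq i))"
    using integrable_sq by (subst Bochner_Integration.integral_sum) auto
  also have "\<dots> \<le> (\<Sum>i\<in>idx n. weight n i * 1)"
    using expectation_sq_le by (intro sum_mono mult_left_mono weight_nonneg) auto
  finally have q: "expectation ?q \<le> W n"
    by (simp add: W_def)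
  have m: "expectation ?m = 0"
    using integrable_mart expectation_mart by (subst Bochner_Integration.integral_sum) auto
  have "expectation (\<lambda>\<theta>. gap Z G H J (wag (n + 1) \<theta>)) \<le> expectation (\<lambda>\<theta>. ?p * (Det n + ?q \<theta> + ?m \<theta>))"
    by (intro integral_mono_AE int_gap int AE_gap_bound n)
  also have "\<dots> = ?p * (Det n + expectation ?q + expectation ?m)"
    using int_q int_m by (simp add: Bochner_Integration.integral_add prob_space)
  also have "\<dots> \<le> ?p * (Det n + W n)"
    using q m by (intro mult_left_mono) auto
  also have "\<dots> \<le> 8 * L\<^sub>G * \<Omega>\<^sup>2 / (\<mu> * real n * (real n + 1)) + 6 * L\<^sub>H * \<Omega>\<^sup>2 / (\<mu> * (real n + 1)) + 7 * K n"
  proof -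
    have "2.232 * K n + 4.591 * K n \<le> 7 * K n"
      using K_nonneg[of n] by simp
    with Det_le[OF n] W_le[OF n] distrib_left[of ?p "Det n" "W n"] show ?thesis
      by linarith
  qed
  finally show "expectation (\<lambda>\<theta>. gap Z G H J (wag (n + 1) \<theta>))
      \<le> 8 * L\<^sub>G * \<Omega>\<^sup>2 / (\<mu> * real n * (real n + 1)) + 6 * L\<^sub>H * \<Omega>\<^sup>2 / (\<mu> * (real n + 1)) + 7 * K n" .
qed

subsection \<open>Large deviations\<close>

context
  assumes tail_G: "light_tail M N Z \<xi> oG gradG \<sigma>\<^sub>G" and tail_H: "light_tail M N Z \<zeta> oH H \<sigma>\<^sub>H"
begin

lemma tail_call:
  assumes "1 \<le> t"
  shows "light_tail M N Z (\<lambda>_. \<xi> t) oG gradG \<sigma>\<^sub>G" "light_tail M N Z (\<lambda>_. \<zeta> (2 * t - 1)) oH H \<sigma>\<^sub>H"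
    "light_tail M N Z (\<lambda>_. \<zeta> (2 * t)) oH H \<sigma>\<^sub>H"
  using tail_G tail_H assms by (auto simp: light_tail_def)

lemma exp_moment_sq:
  assumes t: "1 \<le> t"
  shows "(\<integral>\<^sup>+\<theta>. ennreal (exp (sq (t, k) \<theta>)) \<partial>M) \<le> ennreal (exp 1)"
  using oracle_call.exp_moment_noise[OF call_G[OF t] tail_call(1)[OF t], unfolded noise_eG[OF t]]
    oracle_call.exp_moment_noise[OF call_H1[OF t] tail_call(2)[OF t], unfolded noise_e1[OF t]]
    oracle_call.exp_moment_noise[OF call_H2[OF t] tail_call(3)[OF t], unfolded noise_e2[OF t]]
  by (simp add: sq_def)

text \<open>The calls are peeled off in reverse order: first \<open>e2 t\<close>, drawn last, with
  the exponential of \<open>eG t\<close> joined to \<open>\<psi>\<close>; then \<open>eG t\<close>.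
  The variance proxies add, which gives \<open>\<sigma>\<^sup>2\<close> and not
  \<open>(\<sigma>\<^sub>G + \<sigma>\<^sub>H)\<^sup>2\<close>.\<close>

lemma exp_moment_mart_step:
  assumes t: "1 \<le> t" and \<psi>: "\<psi> \<in> borel_measurable (info (past t))"
  shows "(\<integral>\<^sup>+\<theta>. \<psi> \<theta> * ennreal (exp (l * mart a t \<theta>)) \<partial>M)
    \<le> ennreal (exp (l\<^sup>2 * (real t * \<sigma> * (\<Omega> * sqrt (2 / \<mu>)))\<^sup>2)) * (\<integral>\<^sup>+\<theta>. \<psi> \<theta> \<partial>M)"
proof -
  let ?D = "\<bar>- l * real t\<bar> * (\<Omega> * sqrt (2 / \<mu>))"
  let ?r = "\<lambda>\<theta>. (- l * real t) *\<^sub>R (r t \<theta> - aux a t \<theta>)"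
  let ?w = "\<lambda>\<theta>. (- l * real t) *\<^sub>R (w (t + 1) \<theta> - aux a t \<theta>)"
  let ?\<psi>' = "\<lambda>\<theta>. \<psi> \<theta> * ennreal (exp (inner (eG t \<theta>) (?r \<theta>)))"
  note [measurable] = eG_measurable[OF t]
    measurable_info_mono[OF past_subset_mid r_direction_measurable[OF t]]
    measurable_info_mono[OF past_subset_mid \<psi>]
  have G: "(\<integral>\<^sup>+\<theta>. ?\<psi>' \<theta> \<partial>M) \<le> ennreal (exp ((\<sigma>\<^sub>G * ?D)\<^sup>2)) * (\<integral>\<^sup>+\<theta>. \<psi> \<theta> \<partial>M)"
    using oracle_call.exp_moment_inner_noise[OF call_G[OF t] tail_call(1)[OF t] r_direction_measurable[OF t]
        r_direction_le[OF t] \<psi>] unfolding noise_eG[OF t] .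
  have \<psi>': "?\<psi>' \<in> borel_measurable (info (mid t))"
    by measurable
  have "(\<integral>\<^sup>+\<theta>. \<psi> \<theta> * ennreal (exp (l * mart a t \<theta>)) \<partial>M)
      = (\<integral>\<^sup>+\<theta>. ?\<psi>' \<theta> * ennreal (exp (inner (e2 t \<theta>) (?w \<theta>))) \<partial>M)"
  proof (rule nn_integral_cong)
    fix \<theta>
    have "l * mart a t \<theta> = inner (eG t \<theta>) (?r \<theta>) + inner (e2 t \<theta>) (?w \<theta>)"
      by (simp add: mart_def algebra_simps)
    then show "\<psi> \<theta> * ennreal (exp (l * mart a t \<theta>)) = ?\<psi>' \<theta> * ennreal (exp (inner (e2 t \<theta>) (?w \<theta>)))"
      by (simp only: exp_add ennreal_mult exp_ge_zero mult.assoc)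
  qed
  also have "\<dots> \<le> ennreal (exp ((\<sigma>\<^sub>H * ?D)\<^sup>2)) * (\<integral>\<^sup>+\<theta>. ?\<psi>' \<theta> \<partial>M)"
    using oracle_call.exp_moment_inner_noise[OF call_H2[OF t] tail_call(3)[OF t] w_direction_measurable[OF t]
        w_direction_le[OF t] \<psi>'] unfolding noise_e2[OF t] .
  also have "\<dots> \<le> ennreal (exp ((\<sigma>\<^sub>H * ?D)\<^sup>2)) * (ennreal (exp ((\<sigma>\<^sub>G * ?D)\<^sup>2)) * (\<integral>\<^sup>+\<theta>. \<psi> \<theta> \<partial>M))"
    by (intro mult_left_mono G) simp
  also have "\<dots> = ennreal (exp ((\<sigma>\<^sub>H * ?D)\<^sup>2 + (\<sigma>\<^sub>G * ?D)\<^sup>2)) * (\<integral>\<^sup>+\<theta>. \<psi> \<theta> \<partial>M)"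
    by (simp add: exp_add ennreal_mult mult.assoc)
  also have "(\<sigma>\<^sub>H * ?D)\<^sup>2 + (\<sigma>\<^sub>G * ?D)\<^sup>2 = \<sigma>\<^sup>2 * ?D\<^sup>2"
    by (simp add: \<sigma>_square power_mult_distrib distrib_right)
  also have "\<dots> = l\<^sup>2 * (real t * \<sigma> * (\<Omega> * sqrt (2 / \<mu>)))\<^sup>2"
    by (simp add: power_mult_distrib mult_ac)
  finally show ?thesis .
qed

lemma exp_moment_mart:
  "(\<integral>\<^sup>+\<theta>. ennreal (exp (l * (\<Sum>t=1..n. mart a t \<theta>))) \<partial>M)
    \<le> ennreal (exp (l\<^sup>2 * (\<Sum>t=1..n. (real t * \<sigma> * (\<Omega> * sqrt (2 / \<mu>)))\<^sup>2)))"
proof (induction n)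
  case (Suc n)
  let ?c = "\<lambda>t. (real t * \<sigma> * (\<Omega> * sqrt (2 / \<mu>)))\<^sup>2"
  have "past (t + 1) \<subseteq> past (Suc n)" if "t \<le> n" for t
    using that by (auto simp: past_def)
  then have [measurable]: "mart a t \<in> borel_measurable (info (past (Suc n)))" if "t \<in> {1..n}" for t
    using that by (intro measurable_info_mono[OF _ mart_measurable]) auto
  have "(\<integral>\<^sup>+\<theta>. ennreal (exp (l * (\<Sum>t=1..Suc n. mart a t \<theta>))) \<partial>M)
      = (\<integral>\<^sup>+\<theta>. ennreal (exp (l * (\<Sum>t=1..n. mart a t \<theta>))) * ennreal (exp (l * mart a (Suc n) \<theta>)) \<partial>M)"
    by (intro nn_integral_cong) (simp add: distrib_left exp_add ennreal_mult)
  \<comment> \<open>The exponential of the first \<open>n\<close> terms is known before round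
    \<open>Suc n\<close> and serves as \<open>\<psi>\<close>.\<close>
  also have "\<dots> \<le> ennreal (exp (l\<^sup>2 * ?c (Suc n))) * (\<integral>\<^sup>+\<theta>. ennreal (exp (l * (\<Sum>t=1..n. mart a t \<theta>))) \<partial>M)"
    by (rule exp_moment_mart_step) (simp, measurable)
  also have "\<dots> \<le> ennreal (exp (l\<^sup>2 * ?c (Suc n))) * ennreal (exp (l\<^sup>2 * (\<Sum>t=1..n. ?c t)))"
    by (intro mult_left_mono Suc.IH) simp
  also have "\<dots> = ennreal (exp (l\<^sup>2 * (\<Sum>t=1..Suc n. ?c t)))"
    by (simp add: distrib_left exp_add ennreal_mult mult.commute)
  finally show ?case .
qed (simp add: emeasure_space_1)

lemma prob_mart_greater_le:
  assumes n: "1 \<le> n" and \<sigma>: "0 < \<sigma>" and x: "0 < x"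
  shows "prob {\<theta> \<in> space M. x * R n < (\<Sum>t=1..n. mart (A n) t \<theta>)} \<le> exp (- x\<^sup>2 / 4)"
proof (rule prob_greater_subgaussian[OF _ _ _ x])
  have "mart (A n) t \<in> borel_measurable M" if "t \<in> {1..n}" for t
    using that integrable_mart by (intro borel_measurable_integrable) auto
  then show "(\<lambda>\<theta>. \<Sum>t=1..n. mart (A n) t \<theta>) \<in> borel_measurable M"
    by (rule borel_measurable_sum)
  show "0 < R n"
    using n \<sigma> \<Omega>_pos \<mu>_pos by (simp add: R_def)
  show "(\<integral>\<^sup>+\<theta>. ennreal (exp (l * (\<Sum>t=1..n. mart (A n) t \<theta>))) \<partial>M) \<le> ennreal (exp (l\<^sup>2 * (R n)\<^sup>2))" for l
    by (rule order_trans[OF exp_moment_mart])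
      (intro ennreal_leI iffD2[OF exp_le_cancel_iff] mult_left_mono sum_variance_proxy_le n zero_le_power2)
qed

text \<open>Markov's inequality for the normalised sum, whose exponential moment is at most
  \<open>exp 1\<close>. If all weights vanish there is nothing to normalise by, but the event is
  empty.\<close>

lemma prob_sq_greater_le:
  "prob {\<theta> \<in> space M. l * W n < (\<Sum>i\<in>idx n. weight n i * sq i \<theta>)} \<le> exp (1 - l)"
proof (cases "W n = 0")
  case True
  then have "\<forall>i\<in>idx n. weight n i = 0"
    unfolding W_def using weight_nonneg by (subst (asm) sum_nonneg_eq_0_iff) auto
  then have "(\<Sum>i\<in>idx n. weight n i * sq i \<theta>) = 0" for \<theta>
    by (intro sum.neutral) simp
  with True show ?thesis by simp
next
  case False
  moreover have "0 \<le> W n"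
    unfolding W_def by (intro sum_nonneg weight_nonneg)
  ultimately have W: "0 < W n" by simp
  have [measurable]: "sq i \<in> borel_measurable M" if "i \<in> idx n" for i
    using that integrable_sq by (intro borel_measurable_integrable) auto
  have "prob {\<theta> \<in> space M. l * W n < (\<Sum>i\<in>idx n. weight n i * sq i \<theta>)}
      = prob {\<theta> \<in> space M. l < (\<Sum>i\<in>idx n. weight n i * sq i \<theta>) / W n}"
    using W by (simp add: pos_less_divide_eq)
  also have "\<dots> \<le> exp (1 - l)"
  proof (rule prob_greater_le_exp_moment)
    show "(\<integral>\<^sup>+\<theta>. ennreal (exp ((\<Sum>i\<in>idx n. weight n i * sq i \<theta>) / W n)) \<partial>M) \<le> ennreal (exp 1)"
      unfolding W_def using W[unfolded W_def] exp_moment_sq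
      by (intro exp_moment_weighted_sum weight_nonneg) auto
  qed measurable
  finally show ?thesis .
qed

lemma prob_gap_greater_le_aux:
  assumes n: "1 \<le> n" and \<sigma>: "0 < \<sigma>" and x: "0 < x"
    and B: "2 / (real n * (real n + 1)) * (Det n + l * W n + x * R n) \<le> B"
  shows "prob {\<theta> \<in> space M. B < gap Z G H J (wag (n + 1) \<theta>)} \<le> exp (1 - l) + exp (- x\<^sup>2 / 4)"
proof -
  let ?q = "\<lambda>\<theta>. \<Sum>i\<in>idx n. weight n i * sq i \<theta>" and ?m = "\<lambda>\<theta>. \<Sum>t=1..n. mart (A n) t \<theta>"
  let ?E = "{\<theta> \<in> space M. l * W n < ?q \<theta>}" and ?F = "{\<theta> \<in> space M. x * R n < ?m \<theta>}"
  have "sq i \<in> borel_measurable M" if "i \<in> idx n" for i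
    using that integrable_sq by (intro borel_measurable_integrable) auto
  then have E: "?E \<in> events" by measurable
  have "mart (A n) t \<in> borel_measurable M" if "t \<in> {1..n}" for t
    using that integrable_mart by (intro borel_measurable_integrable) auto
  then have F: "?F \<in> events" by measurable
  have "prob {\<theta> \<in> space M. B < gap Z G H J (wag (n + 1) \<theta>)} \<le> prob (?E \<union> ?F)"
  proof (rule finite_measure_mono_AE)
    show "AE \<theta> in M. \<theta> \<in> {\<theta> \<in> space M. B < gap Z G H J (wag (n + 1) \<theta>)} \<longrightarrow> \<theta> \<in> ?E \<union> ?F"
      using AE_gap_bound[OF n]
    proof eventually_elim
      case (elim \<theta>)
      show ?case
      proof (rule impI, rule ccontr)
        assume "\<theta> \<in> {\<theta> \<in> space M. B < gap Z G H J (wag (n + 1) \<theta>)}" "\<theta> \<notin> ?E \<union> ?F"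
        then have "B < gap Z G H J (wag (n + 1) \<theta>)" "Det n + ?q \<theta> + ?m \<theta> \<le> Det n + l * W n + x * R n"
          by auto
        moreover have "2 / (real n * (real n + 1)) * (Det n + ?q \<theta> + ?m \<theta>)
            \<le> 2 / (real n * (real n + 1)) * (Det n + l * W n + x * R n)"
          by (intro mult_left_mono) (use \<open>Det n + ?q \<theta> + ?m \<theta> \<le> _\<close> in auto)
        ultimately show False
          using elim B by linarith
      qed
    qed
  qed (use E F in auto)
  also have "\<dots> \<le> prob ?E + prob ?F"
    by (rule measure_Un_le[OF E F])
  also have "\<dots> \<le> exp (1 - l) + exp (- x\<^sup>2 / 4)"
    by (intro add_mono prob_sq_greater_le prob_mart_greater_le n \<sigma> x)
  finally show ?thesis .
qed

text \<open>At \<open>\<sigma> = 0\<close> the scale \<open>R n\<close> is 0, so no multiplier is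
  available for the exponential estimate. Weights and martingale vanish almost surely, and the
  deterministic part alone bounds the gap.\<close>

lemma prob_gap_noiseless:
  assumes n: "1 \<le> n" and \<sigma>: "\<sigma> = 0"
    and B: "2 / (real n * (real n + 1)) * Det n \<le> B"
  shows "prob {\<theta> \<in> space M. B < gap Z G H J (wag (n + 1) \<theta>)} = 0"
proof -
  have zero: "\<sigma>\<^sub>G = 0" "\<sigma>\<^sub>H = 0" using \<sigma> \<sigma>_eq_0_iff by auto
  have "AE \<theta> in M. \<not> B < gap Z G H J (wag (n + 1) \<theta>)"
    using AE_gap_bound[OF n] AE_noise_scaled[of n]
  proof eventually_elim
    case (elim \<theta>)
    have "weight n i = 0" for i
      unfolding weight_def by (simp add: zero split_beta)
    moreover have "mart (A n) t \<theta> = 0" if "t \<in> {1..n}" for t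
    proof -
      have "dual_norm N (eG t \<theta>) = 0" "dual_norm N (e2 t \<theta>) = 0"
        using bspec[OF elim(2) that] zero by auto
      then have "inner (eG t \<theta>) d = 0" "inner (e2 t \<theta>) d = 0" for d
        using abs_inner_le_dual_norm[OF norm, of "eG t \<theta>" d] abs_inner_le_dual_norm[OF norm, of "e2 t \<theta>" d]
        by auto
      then show ?thesis by (simp add: mart_def)
    qed
    ultimately show ?case
      using elim(1) B by (simp add: not_less)
  qed
  then show ?thesis
    using gap_measurable[of "n + 1"] by (subst prob_Collect_eq_0) auto
qed

text \<open>
  Below \<open>l = 9\<close> the prefactor \<open>3\<close> pays for the quadratic noise at level \<open>l\<close>; above, the Gaussian
  tail is much smaller than \<open>exp (- l)\<close>, so the martingale may be taken at the lower level \<open>2 * sqrt l\<close>.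
\<close>

lemma prob_gap_greater_le:
  assumes n: "1 \<le> n" and l: "0 < l"
    and B: "8 * L\<^sub>G * \<Omega>\<^sup>2 / (\<mu> * real n * (real n + 1)) + 6 * L\<^sub>H * \<Omega>\<^sup>2 / (\<mu> * (real n + 1)) + 7 * K n
      + l * (6 * K n) \<le> B"
  shows "prob {\<theta> \<in> space M. B < gap Z G H J (wag (n + 1) \<theta>)} \<le> 2 * exp (- l\<^sup>2 / 3) + 3 * exp (- l)"
proof -
  let ?p = "2 / (real n * (real n + 1))"
  \<comment> \<open>A pair of levels is admissible if its cost in units of \<open>K n\<close> stays
    within \<open>7 + 6 * l\<close>.\<close>
  have level: "?p * (Det n + a * W n + x * R n) \<le> B"
    if "0 \<le> a" "0 \<le> x" "2.232 + 4.591 * a + 1.634 * x \<le> 7 + 6 * l" for a x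
  proof -
    have "?p * (Det n + a * W n + x * R n) = ?p * Det n + a * (?p * W n) + x * (?p * R n)"
      by (simp add: distrib_left mult_ac)
    moreover have "a * (?p * W n) \<le> a * (4.591 * K n)" "x * (?p * R n) \<le> x * (1.634 * K n)"
      by (rule mult_left_mono[OF W_le[OF n] that(1)] mult_left_mono[OF R_le[OF n] that(2)])+
    moreover have "(2.232 + 4.591 * a + 1.634 * x) * K n \<le> (7 + 6 * l) * K n"
      by (intro mult_right_mono that K_nonneg)
    moreover have "(2.232 + 4.591 * a + 1.634 * x) * K n = 2.232 * K n + a * (4.591 * K n) + x * (1.634 * K n)"
      "(7 + 6 * l) * K n = 7 * K n + l * (6 * K n)"
      by (simp_all add: algebra_simps)
    ultimately show ?thesis
      using Det_le[OF n] B by linarith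
  qed
  consider "\<sigma> = 0" | "0 < \<sigma>" "l \<le> 9" | "0 < \<sigma>" "9 < l"
    using \<sigma>_nonneg by linarith
  then show ?thesis
  proof cases
    case 1
    have "?p * Det n \<le> B"
      using level[of 0 0] l by simp
    from prob_gap_noiseless[OF n 1 this] show ?thesis
      by simp
  next
    case 2
    \<comment> \<open>The slope \<open>4.591 + 1.634 * 1.155\<close> exceeds 6 by less than 0.479;
      for \<open>l \<le> 9\<close> the excess is covered by \<open>7 - 2.232\<close>.\<close>
    have "?p * (Det n + l * W n + 2 / sqrt 3 * l * R n) \<le> B"
    proof (rule level)
      have "2 / sqrt 3 * l \<le> 1.155 * l"
        using l by (intro mult_right_mono numeric_sqrt_bounds) auto
      with 2 show "2.232 + 4.591 * l + 1.634 * (2 / sqrt 3 * l) \<le> 7 + 6 * l"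
        by simp
    qed (use l in auto)
    then have "prob {\<theta> \<in> space M. B < gap Z G H J (wag (n + 1) \<theta>)}
        \<le> exp (1 - l) + exp (- (2 / sqrt 3 * l)\<^sup>2 / 4)"
      using l 2 by (intro prob_gap_greater_le_aux n) auto
    also have "(2 / sqrt 3 * l)\<^sup>2 / 4 = l\<^sup>2 / 3"
      by (simp add: power_mult_distrib power_divide)
    then have "exp (- (2 / sqrt 3 * l)\<^sup>2 / 4) = exp (- l\<^sup>2 / 3)"
      by simp
    also have "exp (1 - l) + exp (- l\<^sup>2 / 3) \<le> 3 * exp (- l) + 2 * exp (- l\<^sup>2 / 3)"
      using exp_le by (intro add_mono) (auto simp: exp_diff exp_minus field_simps)
    finally show ?thesis by simp
  next
    case 3
    have s: "3 \<le> sqrt l" "sqrt l * sqrt l = l"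
      using 3 l by (auto intro: real_le_rsqrt)
    \<comment> \<open>The levels \<open>1 + l\<close> and \<open>2 * sqrt l\<close> give both tails
      the value \<open>exp (- l)\<close>. Since \<open>9 < l\<close>, \<open>sqrt l\<close> is at
      most \<open>l / 3\<close>, which keeps the slope below 6.\<close>
    have "?p * (Det n + (1 + l) * W n + 2 * sqrt l * R n) \<le> B"
    proof (rule level)
      have "3 * sqrt l \<le> l"
        using mult_right_mono[OF s(1), of "sqrt l"] s by simp
      then have "1.1 * (3 * sqrt l) \<le> 1.1 * l"
        by (rule mult_left_mono) simp
      moreover have "1.634 * (2 * sqrt l) \<le> 1.1 * (3 * sqrt l)"
        using l by simp
      moreover have "2.232 + 4.591 * (1 + l) + 1.1 * l \<le> 7 + 6 * l"
        using 3 by (simp add: distrib_left add_divide_distrib)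
      ultimately show "2.232 + 4.591 * (1 + l) + 1.634 * (2 * sqrt l) \<le> 7 + 6 * l"
        by linarith
    qed (use l in auto)
    then have "prob {\<theta> \<in> space M. B < gap Z G H J (wag (n + 1) \<theta>)}
        \<le> exp (1 - (1 + l)) + exp (- (2 * sqrt l)\<^sup>2 / 4)"
      using l 3 by (intro prob_gap_greater_le_aux n) auto
    also have "\<dots> = 2 * exp (- l)"
      using l by (simp add: power_mult_distrib)
    also have "\<dots> \<le> 2 * exp (- l\<^sup>2 / 3) + 3 * exp (- l)"
      by simp
    finally show ?thesis .
  qed
qed

end

end

text \<open>The Bochner integral of a non-integrable function and the measure of a non-measurable
  set are 0, so integrability and measurability of the gap belong to the conclusion.\<close>

theorem corollary3p2:
  fixes Z :: "'a::euclidean_space set"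
    and N :: "'a \<Rightarrow> real"
    and G J \<omega> :: "'a \<Rightarrow> real"
    and gradG H grad\<omega> :: "'a \<Rightarrow> 'a"
    and L\<^sub>G L\<^sub>H \<mu> \<Omega> \<sigma>\<^sub>G \<sigma>\<^sub>H \<sigma> :: real
    and M :: "'w measure" and S :: "'s measure" and T :: "'t measure"
    and \<xi> :: "nat \<Rightarrow> 'w \<Rightarrow> 's" and \<zeta> :: "nat \<Rightarrow> 'w \<Rightarrow> 't"
    and oG :: "'a \<Rightarrow> 's \<Rightarrow> 'a" and oH :: "'a \<Rightarrow> 't \<Rightarrow> 'a"
    and \<alpha> \<gamma> C\<^sub>0 C\<^sub>1 :: "nat \<Rightarrow> real"
    and r1 :: 'a
    and w r wmd wag :: "nat \<Rightarrow> 'w \<Rightarrow> 'a"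
  assumes norm: "is_norm N"
    and Z: "Z \<noteq> {}" "closed Z" "convex Z"
    and G_C1: "has_gradient_on G gradG Z" "continuous_on Z gradG"
    and L\<^sub>G_nonneg: "0 \<le> L\<^sub>G"
    and G_smooth: "\<And>v u. v \<in> Z \<Longrightarrow> u \<in> Z \<Longrightarrow>
          0 \<le> G u - G v - inner (gradG v) (u - v) \<and>
          G u - G v - inner (gradG v) (u - v) \<le> L\<^sub>G / 2 * (N (u - v))\<^sup>2"
    and L\<^sub>H_nonneg: "0 \<le> L\<^sub>H"
    and H_monotone: "\<And>v u. v \<in> Z \<Longrightarrow> u \<in> Z \<Longrightarrow> 0 \<le> inner (H u - H v) (u - v)"
    and H_Lipschitz: "\<And>v u. v \<in> Z \<Longrightarrow> u \<in> Z \<Longrightarrow> dual_norm N (H u - H v) \<le> L\<^sub>H * N (u - v)"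
    and J_convex: "convex_on Z J"
    and J_subgradient: "\<And>u. u \<in> Z \<Longrightarrow> subdifferential Z J u \<noteq> {}"
    and \<mu>_pos: "0 < \<mu>"
    and \<omega>_diff: "has_gradient_on \<omega> grad\<omega> Z"
    and \<omega>_strongly_convex: "strongly_convex_on Z N \<mu> \<omega>"
    and prox_wd: "prox_well_defined Z \<omega> grad\<omega> J"
    and prob: "prob_space M"
    and indep: "independent_samples M S T \<xi> \<zeta>"
    and SO_G: "unbiased_oracle M S Z \<xi> oG gradG"
    and SO_H: "unbiased_oracle M T Z \<zeta> oH H"
    and sigmas_nonneg: "0 \<le> \<sigma>\<^sub>G" "0 \<le> \<sigma>\<^sub>H"
    and \<Omega>_pos: "0 < \<Omega>"
    and V_bound: "\<And>z1 z2. z1 \<in> Z \<Longrightarrow> z2 \<in> Z \<Longrightarrow> bregman \<omega> grad\<omega> z1 z2 \<le> \<Omega>\<^sup>2"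
    and \<sigma>_eq: "\<sigma> = sqrt (\<sigma>\<^sub>H\<^sup>2 + \<sigma>\<^sub>G\<^sup>2)"
    and \<alpha>_eq: "\<And>t. 1 \<le> t \<Longrightarrow> \<alpha> t = 2 / (real t + 1)"
    and denominator_pos: "\<And>t::nat. 1 \<le> t \<Longrightarrow>
          0 < 4 * L\<^sub>G + 3 * L\<^sub>H * real t + \<sigma> * (real t + 1) * sqrt (\<mu> * real t) / (sqrt 2 * \<Omega>)"
    and \<gamma>_eq: "\<And>t. 1 \<le> t \<Longrightarrow> \<gamma> t = \<mu> * real t /
          (4 * L\<^sub>G + 3 * L\<^sub>H * real t + \<sigma> * (real t + 1) * sqrt (\<mu> * real t) / (sqrt 2 * \<Omega>))"
    and r1: "r1 \<in> Z"
    and init: "\<And>\<theta>. \<theta> \<in> space M \<Longrightarrow> r 1 \<theta> = r1 \<and> w 1 \<theta> = r1 \<and> wag 1 \<theta> = r1"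
    and wmd_step: "\<And>t \<theta>. 1 \<le> t \<Longrightarrow> \<theta> \<in> space M \<Longrightarrow>
          wmd t \<theta> = (1 - \<alpha> t) *\<^sub>R wag t \<theta> + \<alpha> t *\<^sub>R r t \<theta>"
    and w_step: "\<And>t \<theta>. 1 \<le> t \<Longrightarrow> \<theta> \<in> space M \<Longrightarrow>
          w (t + 1) \<theta> = prox Z \<omega> grad\<omega> J (r t \<theta>) (\<gamma> t)
            (\<gamma> t *\<^sub>R oH (r t \<theta>) (\<zeta> (2 * t - 1) \<theta>) + \<gamma> t *\<^sub>R oG (wmd t \<theta>) (\<xi> t \<theta>))"
    and r_step: "\<And>t \<theta>. 1 \<le> t \<Longrightarrow> \<theta> \<in> space M \<Longrightarrow>
          r (t + 1) \<theta> = prox Z \<omega> grad\<omega> J (r t \<theta>) (\<gamma> t)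
            (\<gamma> t *\<^sub>R oH (w (t + 1) \<theta>) (\<zeta> (2 * t) \<theta>) + \<gamma> t *\<^sub>R oG (wmd t \<theta>) (\<xi> t \<theta>))"
    and wag_step: "\<And>t \<theta>. 1 \<le> t \<Longrightarrow> \<theta> \<in> space M \<Longrightarrow>
          wag (t + 1) \<theta> = (1 - \<alpha> t) *\<^sub>R wag t \<theta> + \<alpha> t *\<^sub>R w (t + 1) \<theta>"
    and C\<^sub>0_eq: "\<And>t. 2 \<le> t \<Longrightarrow> C\<^sub>0 t = 16 * L\<^sub>G * \<Omega>\<^sup>2 / (\<mu> * real t * (real t + 1))
            + 12 * L\<^sub>H * \<Omega>\<^sup>2 / (\<mu> * (real t + 1))
            + 7 * (\<sigma>\<^sub>G + \<sigma>\<^sub>H) * \<Omega> / sqrt (\<mu> * (real t - 1))"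
    and C\<^sub>1_eq: "\<And>t. 2 \<le> t \<Longrightarrow> C\<^sub>1 t = 6 * (\<sigma>\<^sub>G + \<sigma>\<^sub>H) * \<Omega> / sqrt (\<mu> * (real t - 1))"
  shows "(bounded_variance M N Z \<xi> oG gradG \<sigma>\<^sub>G \<and> bounded_variance M N Z \<zeta> oH H \<sigma>\<^sub>H \<longrightarrow>
            (\<forall>t\<ge>2. integrable M (\<lambda>\<theta>. gap Z G H J (wag (t + 1) \<theta>)) \<and>
                    (\<integral>\<theta>. gap Z G H J (wag (t + 1) \<theta>) \<partial>M) \<le> C\<^sub>0 t))
       \<and> (light_tail M N Z \<xi> oG gradG \<sigma>\<^sub>G \<and> light_tail M N Z \<zeta> oH H \<sigma>\<^sub>H \<longrightarrow>
            (\<forall>t\<ge>2. (\<lambda>\<theta>. gap Z G H J (wag (t + 1) \<theta>)) \<in> borel_measurable M \<and>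
                    (\<forall>l>0. measure M {\<theta> \<in> space M. gap Z G H J (wag (t + 1) \<theta>) > C\<^sub>0 t + l * C\<^sub>1 t}
                             \<le> 2 * exp (- l\<^sup>2 / 3) + 3 * exp (- l))))"
proof -
  have amp: "stochastic_amp Z N \<omega> grad\<omega> \<mu> \<Omega> G J gradG H L\<^sub>G L\<^sub>H M \<sigma>\<^sub>G \<sigma>\<^sub>H \<sigma> S T \<xi> \<zeta> oG oH \<alpha> \<gamma> r1 w r wmd wag"
    if "bounded_variance M N Z \<xi> oG gradG \<sigma>\<^sub>G" "bounded_variance M N Z \<zeta> oH H \<sigma>\<^sub>H"
    by (intro stochastic_amp.intro vi_setup.intro mirror_setup.intro vi_setup_axioms.intro
        stochastic_amp_axioms.intro; fact)
  let ?K' = "\<lambda>t. (\<sigma>\<^sub>G + \<sigma>\<^sub>H) * \<Omega> / sqrt (\<mu> * (real t - 1))"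
  have C\<^sub>0_ge: "8 * L\<^sub>G * \<Omega>\<^sup>2 / (\<mu> * real t * (real t + 1)) + 6 * L\<^sub>H * \<Omega>\<^sup>2 / (\<mu> * (real t + 1)) + 7 * k \<le> C\<^sub>0 t"
    if "2 \<le> t" "k \<le> ?K' t" for t k
  proof -
    \<comment> \<open>The estimates deliver half of the coefficients 16 and 12, and \<open>t\<close>
      in place of \<open>t - 1\<close> under the root. \<open>k\<close> stands for
      \<open>K t\<close>, which exists only once the locale is interpreted.\<close>
    have "8 * L\<^sub>G * \<Omega>\<^sup>2 / (\<mu> * real t * (real t + 1)) \<le> 16 * L\<^sub>G * \<Omega>\<^sup>2 / (\<mu> * real t * (real t + 1))"
      "6 * L\<^sub>H * \<Omega>\<^sup>2 / (\<mu> * (real t + 1)) \<le> 12 * L\<^sub>H * \<Omega>\<^sup>2 / (\<mu> * (real t + 1))"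
      using \<mu>_pos L\<^sub>G_nonneg L\<^sub>H_nonneg by (intro divide_right_mono mult_right_mono; simp)+
    moreover have "7 * (\<sigma>\<^sub>G + \<sigma>\<^sub>H) * \<Omega> / sqrt (\<mu> * (real t - 1)) = 7 * ?K' t"
      by simp
    ultimately show ?thesis
      unfolding C\<^sub>0_eq[OF that(1)] using that(2) by linarith
  qed
  have C\<^sub>1_ge: "l * (6 * k) \<le> l * C\<^sub>1 t" if "2 \<le> t" "k \<le> ?K' t" "0 < l" for t k l
  proof -
    have "6 * (\<sigma>\<^sub>G + \<sigma>\<^sub>H) * \<Omega> / sqrt (\<mu> * (real t - 1)) = 6 * ?K' t"
      by simp
    then have "6 * k \<le> C\<^sub>1 t"
      unfolding C\<^sub>1_eq[OF that(1)] using that(2) by linarith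
    then show ?thesis
      using that(3) by (intro mult_left_mono) auto
  qed
  show ?thesis
  proof (intro conjI impI allI; elim conjE)
    fix t :: nat
    assume A1: "bounded_variance M N Z \<xi> oG gradG \<sigma>\<^sub>G" "bounded_variance M N Z \<zeta> oH H \<sigma>\<^sub>H" and t: "2 \<le> t"
    interpret stochastic_amp Z N \<omega> grad\<omega> \<mu> \<Omega> G J gradG H L\<^sub>G L\<^sub>H M \<sigma>\<^sub>G \<sigma>\<^sub>H \<sigma> S T \<xi> \<zeta> oG oH \<alpha> \<gamma> r1 w r wmd wag
      by (rule amp[OF A1])
    have t1: "1 \<le> t" using t by simp
    show "integrable M (\<lambda>\<theta>. gap Z G H J (wag (t + 1) \<theta>))"
      by (rule expectation_gap_le(1)[OF t1])
    show "(\<integral>\<theta>. gap Z G H J (wag (t + 1) \<theta>) \<partial>M) \<le> C\<^sub>0 t"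
      using expectation_gap_le(2)[OF t1] C\<^sub>0_ge[OF t K_le[OF t]] by (rule order_trans)
  next
    fix t :: nat
    assume A2: "light_tail M N Z \<xi> oG gradG \<sigma>\<^sub>G" "light_tail M N Z \<zeta> oH H \<sigma>\<^sub>H" and t: "2 \<le> t"
    interpret stochastic_amp Z N \<omega> grad\<omega> \<mu> \<Omega> G J gradG H L\<^sub>G L\<^sub>H M \<sigma>\<^sub>G \<sigma>\<^sub>H \<sigma> S T \<xi> \<zeta> oG oH \<alpha> \<gamma> r1 w r wmd wag
      by (intro amp light_tail_imp_bounded_variance[OF prob norm SO_G A2(1)]
          light_tail_imp_bounded_variance[OF prob norm SO_H A2(2)])
    have t1: "1 \<le> t" using t by simp
    show "(\<lambda>\<theta>. gap Z G H J (wag (t + 1) \<theta>)) \<in> borel_measurable M"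
      by (rule gap_measurable) simp
    fix l :: real assume l: "0 < l"
    show "prob {\<theta> \<in> space M. gap Z G H J (wag (t + 1) \<theta>) > C\<^sub>0 t + l * C\<^sub>1 t} \<le> 2 * exp (- l\<^sup>2 / 3) + 3 * exp (- l)"
      by (rule prob_gap_greater_le[OF A2 t1 l])
        (intro add_mono C\<^sub>0_ge C\<^sub>1_ge t l K_le[OF t])
  qed
qed

end
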